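(* Let $H$ be a connected graph with a gluing $\varphi:U_1\to U_2$ (a bijection between two disjoint non-empty sets $U_1,U_2$ of vertices of $H$), and let $\mathcal G(H,\varphi)=(G_n)_{n\ge1}$ be the associated $H$-linear family. Then the generating function $F_{\mathcal G}(t,x)=\sum_{n\ge1}t^n\,E_{G_n}(x)$ is a rational fraction in $t,x$ with integer coefficients. The same holds for the generating function $F_{\mathcal G^\circ}(t,x)=\sum_{n\ge1}t^n\,E_{G^\circ_n}(x)$ of the associated $H$-circular family $\mathcal G^\circ(H,\varphi)=(G^\circ_n)_{n\ge1}$. Here $E_G(x)$ denotes the Euler-genus polynomial of $G$.
   Context: Graphs are finite, with loops and multiple edges allowed. For graphs $H_1,H_2$ and a bijection $\psi$ from a non-empty set of vertices of $H_1$ to a set of vertices of $H_2$ (a gluing), the vertex-amalgamation $H_1\circledast_\psi H_2$ is obtained from the disjoint union of $H_1$ and $H_2$ by identifying $u$ with $\psi(u)$ for every $u$ in the domain of $\psi$ (edges are kept). Likewise, the self-amalgamation of a graph along a bijection $\psi$ between two disjoint non-empty sets of its vertices identifies $u$ with $\psi(u)$ for all $u$. $H$-linear family: $G_1=H$, and $G_{n+1}$ is the vertex-amalgamation of $G_n$ with a new copy of $H$, where the vertices of $U_1$ in the last added copy of $H$ in $G_n$ (those not yet identified) are identified via $\varphi$ with the vertices of $U_2$ in the new copy. $H$-circular family: $G_n^\circ$ is the self-amalgamation of $G_n$ identifying via $\varphi$ the not yet identified vertices of $U_1$ (in the last copy of $H$) with the not yet identified vertices of $U_2$ (in the first copy of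 $H$). Euler-genus polynomial: $E_G(x)=\sum_{j\ge0}c_j(G)x^j$, where $c_j(G)$ is the number of general cellular embeddings (on orientable or non-orientable closed surfaces) of the connected graph $G$ with Euler-genus $j$, the Euler-genus being $2-|V|+|E|-\#\text{faces}$. General embeddings are described by signed rotation systems, i.e. a cyclic order of the edge-ends around each vertex together with a choice, for each edge, of being twisted or untwisted, and are counted up to reversing the local orientation at vertices; equivalently, one fixes a spanning tree of $G$ and requires its edges to be untwisted, so that $E_G(1)=2^{\beta(G)}\prod_v(d_v-1)!$ with $\beta(G)=|E|-|V|+1$. *)

theory Defs
  imports
    "Graph_Theory.Graph_Theory"
    "HOL-Combinatorics.Orbits"
    "HOL-Computational_Algebra.Polynomial_FPS"
begin

section \<open>Graphs and amalgamations\<close>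

text \<open>
  A finite undirected graph, with loops and multiple edges allowed, is a finite
  \<open>pre_digraph\<close> (\<^locale>\<open>fin_digraph\<close>): each arc stands for one undirected edge,
  and its direction is only a reference direction that serves to tell the two ends of the
  edge apart. The library's \<^const>\<open>connected\<close> ignores directions. Its \<open>forest\<close>
  and \<open>spanning_tree\<close> do not, which is why spanning trees are defined anew below.

  The identification \<open>u \<sim> \<psi> u\<close> (\<open>u \<in> U\<close>) is realised by replacing \<open>u\<close> with \<open>\<psi> u\<close>.
  This is the quotient graph whenever \<open>\<psi>\<close> is injective on \<open>U\<close> and \<open>U\<close> is disjoint from
  \<open>\<psi> ` U\<close>, as then every class is \<open>{u, \<psi> u}\<close> or a singleton.
\<close>

definition gluing :: "('v, 'e) pre_digraph \<Rightarrow> 'v set \<Rightarrow> 'v set \<Rightarrow> ('v \<Rightarrow> 'v) \<Rightarrow> bool" where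
  "gluing H U1 U2 \<phi> \<longleftrightarrow>
     U1 \<subseteq> verts H \<and> U2 \<subseteq> verts H \<and> U1 \<noteq> {} \<and> U1 \<inter> U2 = {} \<and> bij_betw \<phi> U1 U2"

definition self_amalgamation ::
  "('v, 'e) pre_digraph \<Rightarrow> 'v set \<Rightarrow> ('v \<Rightarrow> 'v) \<Rightarrow> ('v, 'e) pre_digraph" where
  "self_amalgamation G U \<psi> =
     (let r = (\<lambda>v. if v \<in> U then \<psi> v else v)
      in \<lparr>verts = r ` verts G, arcs = arcs G, tail = r \<circ> tail G, head = r \<circ> head G\<rparr>)"

text \<open>For graphs whose vertex sets and arc sets are disjoint.\<close>

definition disjoint_union ::
  "('v, 'e) pre_digraph \<Rightarrow> ('v, 'e) pre_digraph \<Rightarrow> ('v, 'e) pre_digraph" where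
  "disjoint_union G K =
     \<lparr>verts = verts G \<union> verts K,
      arcs = arcs G \<union> arcs K,
      tail = (\<lambda>e. if e \<in> arcs G then tail G e else tail K e),
      head = (\<lambda>e. if e \<in> arcs G then head G e else head K e)\<rparr>"

definition vertex_amalgamation ::
  "('v, 'e) pre_digraph \<Rightarrow> ('v, 'e) pre_digraph \<Rightarrow> 'v set \<Rightarrow> ('v \<Rightarrow> 'v) \<Rightarrow>
   ('v, 'e) pre_digraph" where
  "vertex_amalgamation G K U \<psi> = self_amalgamation (disjoint_union G K) U \<psi>"

definition graph_copy :: "nat \<Rightarrow> ('v, 'e) pre_digraph \<Rightarrow> (nat \<times> 'v, nat \<times> 'e) pre_digraph" where
  "graph_copy i H =
     \<lparr>verts = Pair i ` verts H,
      arcs = Pair i ` arcs H,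
      tail = (\<lambda>(j, e). (j, tail H e)),
      head = (\<lambda>(j, e). (j, head H e))\<rparr>"

text \<open>
  The \<open>n\<close>-th graph consists of the copies \<open>1, \<dots>, n\<close> of \<open>H\<close>. A vertex \<open>(i, u)\<close> with
  \<open>u \<in> U1\<close> and \<open>i < n\<close> has been renamed to \<open>(Suc i, \<phi> u)\<close>, so the vertices of the last
  copy keep their names, and so do the vertices of \<open>U2\<close> in the first copy. The family
  starts at \<open>n = 1\<close>; the value at \<open>0\<close> is a dummy (the empty graph).
\<close>

fun linear_family ::
  "('v, 'e) pre_digraph \<Rightarrow> 'v set \<Rightarrow> ('v \<Rightarrow> 'v) \<Rightarrow> nat \<Rightarrow> (nat \<times> 'v, nat \<times> 'e) pre_digraph" where
  "linear_family H U1 \<phi> 0 = (graph_copy 0 H)\<lparr>verts := {}, arcs := {}\<rparr>"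
| "linear_family H U1 \<phi> (Suc 0) = graph_copy 1 H"
| "linear_family H U1 \<phi> (Suc (Suc n)) =
     vertex_amalgamation (linear_family H U1 \<phi> (Suc n)) (graph_copy (Suc (Suc n)) H)
       ({Suc n} \<times> U1) (\<lambda>(i, u). (Suc i, \<phi> u))"

definition circular_family ::
  "('v, 'e) pre_digraph \<Rightarrow> 'v set \<Rightarrow> ('v \<Rightarrow> 'v) \<Rightarrow> nat \<Rightarrow> (nat \<times> 'v, nat \<times> 'e) pre_digraph" where
  "circular_family H U1 \<phi> n =
     self_amalgamation (linear_family H U1 \<phi> n) ({n} \<times> U1) (\<lambda>(i, u). (1, \<phi> u))"


section \<open>Edge-ends and spanning trees\<close>

text \<open>
  Every edge \<open>e\<close> yields two opposite arcs \<open>(e, False)\<close> and \<open>(e, True)\<close>. The arc \<open>(e, b)\<close> also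
  represents the edge-end at its tail, so that \<open>out_arcs (bidirect G) v\<close> is the set of
  edge-ends at \<open>v\<close>; a loop at \<open>v\<close> contributes two of them.
\<close>

definition bidirect :: "('v, 'e) pre_digraph \<Rightarrow> ('v, 'e \<times> bool) pre_digraph" where
  "bidirect G =
     \<lparr>verts = verts G,
      arcs = arcs G \<times> UNIV,
      tail = (\<lambda>(e, b). if b then head G e else tail G e),
      head = (\<lambda>(e, b). if b then tail G e else head G e)\<rparr>"

abbreviation edge_ends :: "('v, 'e) pre_digraph \<Rightarrow> ('e \<times> bool) set" where
  "edge_ends G \<equiv> arcs (bidirect G)"

abbreviation edge_ends_at :: "('v, 'e) pre_digraph \<Rightarrow> 'v \<Rightarrow> ('e \<times> bool) set" where
  "edge_ends_at G v \<equiv> out_arcs (bidirect G) v"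

text \<open>A cycle of length two in \<open>bidirect G\<close> that runs back and forth along one edge is not a
  cycle of the undirected graph, hence the distinctness condition.\<close>

definition undirected_cycle :: "('v, 'e) pre_digraph \<Rightarrow> ('e \<times> bool) list \<Rightarrow> bool" where
  "undirected_cycle G p \<longleftrightarrow> pre_digraph.cycle (bidirect G) p \<and> distinct (map fst p)"

definition is_spanning_tree :: "('v, 'e) pre_digraph \<Rightarrow> 'e set \<Rightarrow> bool" where
  "is_spanning_tree G T \<longleftrightarrow>
     T \<subseteq> arcs G \<and> connected (G\<lparr>arcs := T\<rparr>) \<and> (\<nexists>p. undirected_cycle (G\<lparr>arcs := T\<rparr>) p)"


section \<open>Signed rotation systems and Euler-genus polynomials\<close>

text \<open>
  A signed rotation system consists of a permutation \<open>\<rho>\<close> of the edge-ends whose restriction to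
  the edge-ends at each vertex is a single cycle, and the set \<open>X\<close> of twisted edges.
\<close>

definition signed_rotation_system ::
  "('v, 'e) pre_digraph \<Rightarrow> ('e \<times> bool \<Rightarrow> 'e \<times> bool) \<Rightarrow> 'e set \<Rightarrow> bool" where
  "signed_rotation_system G \<rho> X \<longleftrightarrow>
     \<rho> permutes edge_ends G \<and>
     (\<forall>v\<in>verts G. edge_ends_at G v \<noteq> {} \<longrightarrow> cyclic_on \<rho> (edge_ends_at G v)) \<and>
     X \<subseteq> arcs G"

text \<open>
  Replace vertices by discs and edges by bands attached according to \<open>\<rho>\<close>; the faces are the
  boundary components of the resulting surface. The end \<open>d\<close> of a band has two sides:
  \<open>(d, True)\<close> faces \<open>\<rho> d\<close>, and \<open>(d, False)\<close> faces the predecessor of \<open>d\<close>. The boundary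
  connects \<open>(d, True)\<close> to \<open>(\<rho> d, False)\<close> along the disc. Along the band of \<open>e\<close>, it
  connects each side of one end to the side with the other name at the other end if \<open>e\<close> is
  untwisted, and with the same name if \<open>e\<close> is twisted. An isolated vertex is a disc with
  no band, contributing a face of its own.
\<close>

definition face_steps ::
  "('v, 'e) pre_digraph \<Rightarrow> ('e \<times> bool \<Rightarrow> 'e \<times> bool) \<Rightarrow> 'e set \<Rightarrow>
   (('e \<times> bool) \<times> bool) rel" where
  "face_steps G \<rho> X =
     {((d, True), (\<rho> d, False)) | d. d \<in> edge_ends G} \<union>
     {(((e, b), s), ((e, \<not> b), if e \<in> X then s else \<not> s)) | e b s. e \<in> arcs G}"

definition faces ::
  "('v, 'e) pre_digraph \<Rightarrow> ('e \<times> bool \<Rightarrow> 'e \<times> bool) \<Rightarrow> 'e set \<Rightarrow>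
   (('e \<times> bool) \<times> bool) set set" where
  "faces G \<rho> X =
     (edge_ends G \<times> UNIV) // (face_steps G \<rho> X \<union> (face_steps G \<rho> X)\<inverse>)\<^sup>*"

definition num_faces ::
  "('v, 'e) pre_digraph \<Rightarrow> ('e \<times> bool \<Rightarrow> 'e \<times> bool) \<Rightarrow> 'e set \<Rightarrow> nat" where
  "num_faces G \<rho> X = card (faces G \<rho> X) + card {v \<in> verts G. edge_ends_at G v = {}}"

definition euler_genus ::
  "('v, 'e) pre_digraph \<Rightarrow> ('e \<times> bool \<Rightarrow> 'e \<times> bool) \<Rightarrow> 'e set \<Rightarrow> int" where
  "euler_genus G \<rho> X =
     2 - int (card (verts G)) + int (card (arcs G)) - int (num_faces G \<rho> X)"

text \<open>
  For connected \<open>G\<close>, general embeddings are counted through signed rotation systems in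
  which the edges of a fixed spanning tree are untwisted. The numbers \<open>c\<^sub>j(G)\<close> do not
  depend on the tree: each of these systems represents one class under reversals of the local
  orientation at all vertices but a root.
\<close>

definition general_embeddings ::
  "('v, 'e) pre_digraph \<Rightarrow> 'e set \<Rightarrow> (('e \<times> bool \<Rightarrow> 'e \<times> bool) \<times> 'e set) set" where
  "general_embeddings G T = {(\<rho>, X). signed_rotation_system G \<rho> X \<and> X \<inter> T = {}}"

definition euler_genus_count :: "('v, 'e) pre_digraph \<Rightarrow> nat \<Rightarrow> nat" where
  "euler_genus_count G j =
     card {(\<rho>, X) \<in> general_embeddings G (SOME T. is_spanning_tree G T). euler_genus G \<rho> X = int j}"

definition euler_genus_poly :: "('v, 'e) pre_digraph \<Rightarrow> int poly" where
  "euler_genus_poly G = Abs_poly (\<lambda>j. int (euler_genus_count G j))"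

lemma coeff_euler_genus_poly:
  "coeff (euler_genus_poly G) j = int (euler_genus_count G j)"
proof -
  have "euler_genus_count G j = 0" if "j > card (arcs G) + 2" for j
  proof -
    have "euler_genus G \<rho> X \<noteq> int j" for \<rho> X
      using that by (simp add: euler_genus_def)
    then show ?thesis by (simp add: euler_genus_count_def)
  qed
  then have "\<forall>\<^sub>\<infinity>j. int (euler_genus_count G j) = 0"
    unfolding MOST_nat by auto
  then show ?thesis
    by (simp add: euler_genus_poly_def Abs_poly_inverse)
qed

lemma finite_general_embeddings:
  assumes "finite (arcs G)"
  shows "finite (general_embeddings G T)"
proof (rule finite_subset)
  show "general_embeddings G T \<subseteq> {\<rho>. \<rho> permutes edge_ends G} \<times> Pow (arcs G)"
    by (auto simp: general_embeddings_def signed_rotation_system_def)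
  have "finite (edge_ends G)"
    using assms by (simp add: bidirect_def)
  then show "finite ({\<rho>. \<rho> permutes edge_ends G} \<times> Pow (arcs G))"
    using assms by (simp add: finite_permutations)
qed


section \<open>Generating functions\<close>

text \<open>
  A generating function is a power series in \<open>t\<close> over \<open>\<int>[x]\<close>; an
  \<open>int poly poly\<close> is a polynomial in \<open>t\<close> with coefficients in \<open>\<int>[x]\<close>.
\<close>

definition genus_gen_fun :: "(nat \<Rightarrow> ('v, 'e) pre_digraph) \<Rightarrow> int poly fps" where
  "genus_gen_fun \<G> = Abs_fps (\<lambda>n. if n \<ge> 1 then euler_genus_poly (\<G> n) else 0)"

definition rational_fraction :: "int poly fps \<Rightarrow> bool" where
  "rational_fraction F \<longleftrightarrow>
     (\<exists>P Q :: int poly poly. Q \<noteq> 0 \<and> fps_of_poly Q * F = fps_of_poly P)"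

end

theory Submission
  imports Defs
begin

text \<open>
  Summing over all signed rotation systems instead of those that are untwisted on a spanning
  tree multiplies the Euler-genus polynomial by \<open>2 ^ (|V| - 1)\<close>: reversing local orientations
  preserves faces, and every subset of the tree is the trace of exactly one cut avoiding a root.
  No tree of \<open>G\<^sub>n\<close> has to be chosen in this form. Since \<open>U1\<close> and \<open>U2\<close> are disjoint, the
  edge-ends of \<open>G\<^sub>n\<close> and of \<open>G\<^sub>n\<^sup>\<circ>\<close> split into \<open>n\<close> slots such that each vertex lies in one slot,
  and a signed rotation system is a word of length \<open>n\<close> over the signed rotation systems of
  \<open>G\<^sub>1\<^sup>\<circ>\<close>, except that in the linear case the last letter comes from \<open>H\<close>. Reading such a word from
  left to right, the number of faces is computed by a finite automaton whose state is the
  connectivity relation on the sides of edge-ends in the first and the current copy. Hence the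
  weighted counts satisfy a linear recurrence over \<open>\<int>[x]\<close>. Weights are powers of \<open>x\<close> with natural
  exponents because one counts the rank of the face graph rather than its components; the factors
  relating this to the Euler-genus polynomial are geometric in \<open>n\<close> and can be absorbed. That no
  embedding is lost through a negative Euler genus follows by comparing, over the field with two
  elements, cuts with boundaries of sets of faces.
\<close>

text \<open>Origin of the exponents: each edge gives four sides of edge-ends, so 4|E| minus the
  number of faces is the rank of the face graph. It exceeds the Euler genus by |V| + 3|E| - 2, which
  is affine in the number of copies. Slots are arranged cyclically in both families: slot
  \<open>n\<close> joins copy \<open>n\<close> to the edge-ends at \<open>U2\<close> in copy 1 even
  if nothing is glued there. So both families obtain their face steps from a word by the same
  formula, and they differ only in the letters allowed in the last slot. This is why the first copy
  has to be remembered: the last letter leads back to it. Since that letter opens no new copy, the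
  automaton does not read it; it is summed over in the output attached to each state. The recurrence
  comes from a dependence argument: vectors of weighted counts indexed by states are moved by one
  fixed matrix, more vectors than states are linearly dependent, and the matrix carries the
  dependence on to all later vectors. All this takes place in the integral domain of integer
  polynomials, where non-zero factors can be cancelled.\<close>

section \<open>Linear recurrences\<close>

text \<open>Gaussian elimination without division: for a pivot \<open>j\<close>, the
  cross-multiplied rows \<open>g\<close> vanish at \<open>s\<close>, and the induction hypothesis
  applies with one coordinate and one row less.\<close>

lemma linear_dependence_idom:
  fixes f :: "'i \<Rightarrow> 's \<Rightarrow> 'r :: idom"
  assumes "finite S" and "finite I" and "card S < card I"
  shows "\<exists>c. (\<exists>i\<in>I. c i \<noteq> 0) \<and> (\<forall>s\<in>S. (\<Sum>i\<in>I. c i * f i s) = 0)"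
  using assms
proof (induction S arbitrary: I f rule: finite_induct)
  case empty
  then obtain i where "i \<in> I" by fastforce
  then show ?case by (intro exI[of _ "\<lambda>_. 1"]) auto
next
  case (insert s S)
  show ?case
  proof (cases "\<exists>j\<in>I. f j s \<noteq> 0")
    case False
    obtain c where "\<exists>i\<in>I. c i \<noteq> 0" "\<forall>s\<in>S. (\<Sum>i\<in>I. c i * f i s) = 0"
      using insert.IH[OF insert.prems(1), of f] insert.prems(2) insert.hyps by auto
    with False show ?thesis by (intro exI[of _ c]) auto
  next
    case True
    then obtain j where j: "j \<in> I" "f j s \<noteq> 0" by blast
    define g where "g i u = f j s * f i u - f i s * f j u" for i u
    have "card S < card (I - {j})"
      using insert.prems insert.hyps j by simp
    then obtain c where c: "\<exists>i\<in>I - {j}. c i \<noteq> 0"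
      "\<forall>u\<in>S. (\<Sum>i\<in>I - {j}. c i * g i u) = 0"
      using insert.IH[of "I - {j}" g] insert.prems(1) by auto
    \<comment> \<open>Multiplying by the pivot \<open>f j s\<close> replaces division; as it is
      non-zero, a non-zero \<open>c i\<close> yields a non-zero \<open>b i\<close>. The value at
      \<open>j\<close> is forced by the other rows.\<close>
    define b where "b i = (if i = j then - (\<Sum>k\<in>I - {j}. c k * f k s) else c i * f j s)" for i
    have "(\<Sum>i\<in>I. b i * f i u) = (\<Sum>i\<in>I - {j}. c i * g i u)" for u
    proof -
      have "(\<Sum>i\<in>I. b i * f i u) = b j * f j u + (\<Sum>i\<in>I - {j}. b i * f i u)"
        using j insert.prems(1) by (simp add: sum.remove)
      also have "\<dots> = (\<Sum>i\<in>I - {j}. c i * f j s * f i u) - (\<Sum>i\<in>I - {j}. c i * f i s) * f j u"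
        by (simp add: b_def)
      also have "\<dots> = (\<Sum>i\<in>I - {j}. c i * g i u)"
        by (simp add: g_def sum_distrib_right flip: sum_subtractf) (simp add: algebra_simps)
      finally show ?thesis .
    qed
    moreover have "(\<Sum>i\<in>I - {j}. c i * g i s) = 0"
      by (simp add: g_def algebra_simps)
    moreover have "\<exists>i\<in>I. b i \<noteq> 0"
      using c(1) j by (auto simp: b_def)
    ultimately show ?thesis using c(2) by (intro exI[of _ b]) auto
  qed
qed

lemma sum_lists_snoc:
  assumes "finite C"
  shows "(\<Sum>w\<in>{w. set w \<subseteq> C \<and> length w = Suc n}. f w)
    = (\<Sum>w\<in>{w. set w \<subseteq> C \<and> length w = n}. \<Sum>c\<in>C. f (w @ [c]))"
proof -
  have "(\<Sum>w\<in>{w. set w \<subseteq> C \<and> length w = n}. \<Sum>c\<in>C. f (w @ [c]))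
    = (\<Sum>(w, c)\<in>{w. set w \<subseteq> C \<and> length w = n} \<times> C. f (w @ [c]))"
    by (simp add: sum.cartesian_product)
  also have "\<dots> = (\<Sum>w\<in>{w. set w \<subseteq> C \<and> length w = Suc n}. f w)"
    by (rule sum.reindex_bij_witness[of _ "\<lambda>w. (butlast w, last w)" "\<lambda>(w, c). w @ [c]"])
      (auto dest: in_set_butlastD simp: last_in_set length_Suc_conv_rev)
  finally show ?thesis by simp
qed

text \<open>Grouping words by state gives vectors \<open>a n\<close> that evolve by a matrix
  independent of \<open>n\<close>. A linear relation between the initial ones therefore persists
  under every shift, and \<open>tot\<close> inherits it because its sums are a fixed linear
  functional of \<open>a n\<close>.\<close>

lemma automaton_linear_recurrence:
  fixes wt tot :: "'c list \<Rightarrow> 'r :: idom" and \<sigma> :: "'c list \<Rightarrow> 's"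
  assumes C: "finite C" and S: "finite S" "\<And>w. \<sigma> w \<in> S"
    and \<delta>: "\<And>w c. set w \<subseteq> C \<Longrightarrow> c \<in> C \<Longrightarrow> \<sigma> (w @ [c]) = \<delta> (\<sigma> w) c"
    and \<omega>: "\<And>w c. set w \<subseteq> C \<Longrightarrow> c \<in> C \<Longrightarrow> wt (w @ [c]) = \<omega> (\<sigma> w) c * wt w"
    and g: "\<And>w. set w \<subseteq> C \<Longrightarrow> tot w = g (\<sigma> w) * wt w"
  obtains d q where "\<exists>i\<le>d. q i \<noteq> 0"
    and "\<And>n. (\<Sum>i\<le>d. q i * (\<Sum>w\<in>{w. set w \<subseteq> C \<and> length w = n + i}. tot w)) = 0"
proof -
  let ?W = "\<lambda>n. {w. set w \<subseteq> C \<and> length w = n}"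
  define a where "a n s = (\<Sum>w\<in>?W n. if \<sigma> w = s then wt w else 0)" for n s
  have split: "(\<Sum>w\<in>?W n. h (\<sigma> w) * wt w) = (\<Sum>s\<in>S. h s * a n s)" for n and h :: "'s \<Rightarrow> 'r"
  proof -
    have "(\<Sum>s\<in>S. h s * a n s) = (\<Sum>s\<in>S. \<Sum>w\<in>?W n. if \<sigma> w = s then h s * wt w else 0)"
      by (simp add: a_def sum_distrib_left if_distrib cong: if_cong)
    also have "\<dots> = (\<Sum>w\<in>?W n. \<Sum>s\<in>S. if \<sigma> w = s then h s * wt w else 0)"
      by (rule sum.swap)
    also have "\<dots> = (\<Sum>w\<in>?W n. h (\<sigma> w) * wt w)"
      using S by (simp add: sum.delta')
    finally show ?thesis by simp
  qed
  \<comment> \<open>The transfer matrix: its entry from \<open>s\<close> to \<open>s'\<close>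
    collects the weights \<open>\<omega> s c\<close> of all letters leading from \<open>s\<close> to
    \<open>s'\<close>.\<close>
  have step: "a (Suc n) s' = (\<Sum>s\<in>S. (\<Sum>c\<in>C. if \<delta> s c = s' then \<omega> s c else 0) * a n s)" for n s'
  proof -
    have "a (Suc n) s' = (\<Sum>w\<in>?W n. \<Sum>c\<in>C. if \<sigma> (w @ [c]) = s' then wt (w @ [c]) else 0)"
      unfolding a_def by (rule sum_lists_snoc[OF C])
    also have "\<dots> = (\<Sum>w\<in>?W n. (\<Sum>c\<in>C. if \<delta> (\<sigma> w) c = s' then \<omega> (\<sigma> w) c else 0) * wt w)"
      by (rule sum.cong) (auto simp: \<delta> \<omega> sum_distrib_right if_distrib cong: if_cong intro!: sum.cong)
    also have "\<dots> = (\<Sum>s\<in>S. (\<Sum>c\<in>C. if \<delta> s c = s' then \<omega> s c else 0) * a n s)"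
      by (rule split)
    finally show ?thesis .
  qed
  \<comment> \<open>The \<open>card S + 1\<close> vectors \<open>a 0\<close>, ...,
    \<open>a (card S)\<close> have only \<open>card S\<close> coordinates.\<close>
  obtain q where q: "\<exists>i\<in>{..card S}. q i \<noteq> 0"
    "\<forall>s\<in>S. (\<Sum>i\<in>{..card S}. q i * a i s) = 0"
    using linear_dependence_idom[of S "{..card S}" a] S by auto
  have rec: "\<forall>s\<in>S. (\<Sum>i\<le>card S. q i * a (n + i) s) = 0" for n
  proof (induction n)
    case 0
    then show ?case using q by simp
  next
    case (Suc n)
    show ?case
    proof
      fix s' assume "s' \<in> S"
      let ?m = "\<lambda>s. \<Sum>c\<in>C. if \<delta> s c = s' then \<omega> s c else 0"
      have "(\<Sum>i\<le>card S. q i * a (Suc n + i) s') = (\<Sum>i\<le>card S. \<Sum>s\<in>S. ?m s * (q i * a (n + i) s))"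
        by (simp add: step sum_distrib_left mult.left_commute)
      also have "\<dots> = (\<Sum>s\<in>S. ?m s * (\<Sum>i\<le>card S. q i * a (n + i) s))"
        by (subst sum.swap) (simp add: sum_distrib_left)
      also have "\<dots> = 0" using Suc by simp
      finally show "(\<Sum>i\<le>card S. q i * a (Suc n + i) s') = 0" .
    qed
  qed
  have tot: "(\<Sum>w\<in>?W n. tot w) = (\<Sum>s\<in>S. g s * a n s)" for n
    using g by (simp add: flip: split)
  have "(\<Sum>i\<le>card S. q i * (\<Sum>w\<in>?W (n + i). tot w)) = 0" for n
  proof -
    have "(\<Sum>i\<le>card S. q i * (\<Sum>w\<in>?W (n + i). tot w))
        = (\<Sum>i\<le>card S. \<Sum>s\<in>S. g s * (q i * a (n + i) s))"
      by (simp add: tot sum_distrib_left mult.left_commute)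
    also have "\<dots> = (\<Sum>s\<in>S. g s * (\<Sum>i\<le>card S. q i * a (n + i) s))"
      by (subst sum.swap) (simp add: sum_distrib_left)
    finally show ?thesis using rec by simp
  qed
  then show thesis using that[of "card S" q] q(1) by auto
qed

lemma fps_of_poly_exists:
  fixes F :: "'a :: comm_semiring_1 fps"
  assumes "\<And>m. m > d \<Longrightarrow> fps_nth F m = 0"
  shows "\<exists>P. fps_of_poly P = F"
proof -
  have "\<forall>\<^sub>\<infinity>m. fps_nth F m = 0"
    using assms unfolding MOST_nat by blast
  then have "fps_of_poly (Abs_poly (fps_nth F)) = F"
    by (intro fps_ext) (simp add: Abs_poly_inverse)
  then show ?thesis ..
qed

text \<open>\<open>Q\<close> carries the coefficients \<open>q\<close> in reverse order, so for
  \<open>m > d\<close> the coefficient of t^m in \<open>Q * F\<close> is the recurrence at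
  \<open>n = m - d\<close>. This \<open>n\<close> is at least 1, so the coefficient of
  \<open>F\<close> at 0 never enters.\<close>

lemma rational_fraction_if_recurrence:
  assumes q: "\<exists>i\<le>d. q i \<noteq> 0" and rec: "\<And>n. n \<ge> 1 \<Longrightarrow> (\<Sum>i\<le>d. q i * fps_nth F (n + i)) = 0"
  shows "rational_fraction F"
proof -
  define Q where "Q = (\<Sum>i\<le>d. monom (q i) (d - i))"
  have coeff: "coeff Q j = (if j \<le> d then q (d - j) else 0)" for j
  proof -
    have "coeff Q j = (\<Sum>i\<le>d. if d - i = j then q i else 0)"
      by (simp add: Q_def coeff_sum)
    also have "\<dots> = (\<Sum>i\<le>d. if i = d - j then (if j \<le> d then q (d - j) else 0) else 0)"
      by (rule sum.cong) auto
    also have "\<dots> = (if j \<le> d then q (d - j) else 0)"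
      by (simp add: sum.delta)
    finally show ?thesis .
  qed
  have "Q \<noteq> 0"
  proof -
    obtain i where "i \<le> d" "q i \<noteq> 0" using q by blast
    then have "coeff Q (d - i) \<noteq> 0" by (simp add: coeff)
    then show ?thesis by auto
  qed
  moreover have "fps_nth (fps_of_poly Q * F) m = 0" if "m > d" for m
  proof -
    have "fps_nth (fps_of_poly Q * F) m = (\<Sum>j=0..m. coeff Q j * fps_nth F (m - j))"
      by (simp add: fps_mult_nth)
    also have "\<dots> = (\<Sum>j=0..d. coeff Q j * fps_nth F (m - j))"
      using that by (intro sum.mono_neutral_right) (auto simp: coeff)
    also have "\<dots> = (\<Sum>i\<le>d. q i * fps_nth F ((m - d) + i))"
      using that by (intro sum.reindex_bij_witness[of _ "\<lambda>i. d - i" "\<lambda>i. d - i"])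
        (auto simp: coeff intro!: arg_cong2[where f="(*)"] arg_cong[where f="fps_nth F"])
    also have "\<dots> = 0" using that by (intro rec) simp
    finally show ?thesis .
  qed
  then have "\<exists>P. fps_of_poly P = fps_of_poly Q * F"
    by (rule fps_of_poly_exists)
  ultimately show ?thesis unfolding rational_fraction_def by metis
qed

section \<open>Components after adding edges\<close>

text \<open>The relation by which \<open>faces\<close> forms its quotient, so that faces are the
  classes of \<open>eq_closure (face_steps G \<rho> X)\<close>.\<close>

abbreviation eq_closure :: "'a rel \<Rightarrow> 'a rel" where
  "eq_closure E \<equiv> (E \<union> E\<inverse>)\<^sup>*"

lemma equiv_eq_closure: "equiv UNIV (eq_closure E)"
  by (intro equivI refl_rtrancl sym_rtrancl sym_Un_converse trans_rtrancl) simp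

lemma eq_closure_sym: "(x, y) \<in> eq_closure E \<Longrightarrow> (y, x) \<in> eq_closure E"
  using equiv_eq_closure[of E] by (meson equivE symE)

lemma eq_closure_mono: "E \<subseteq> F \<Longrightarrow> eq_closure E \<subseteq> eq_closure F"
  by (intro rtrancl_mono) auto

lemma eq_closure_image_eq_iff:
  "eq_closure E `` {x} = eq_closure E `` {y} \<longleftrightarrow> (x, y) \<in> eq_closure E"
  using eq_equiv_class_iff[OF equiv_eq_closure, of x y E] by simp

lemma eq_closure_minimal:
  assumes "E \<subseteq> R" and "equiv UNIV R"
  shows "eq_closure E \<subseteq> R"
proof -
  have "E \<union> E\<inverse> \<subseteq> R" using assms by (auto elim!: equivE dest: symD)
  then have "eq_closure E \<subseteq> R\<^sup>*" by (rule rtrancl_mono)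
  also have "R\<^sup>* = R"
    using assms(2) by (metis equivE rtrancl_trancl_reflcl refl_Id sup.absorb1 trancl_id Id_def
        refl_on_def subrelI pair_in_Id_conv UNIV_I)
  finally show ?thesis .
qed

text \<open>A path between window points consists of edges of \<open>F\<close> and stretches in
  \<open>E\<close>. Each stretch starts and ends in the window, so \<open>s\<close> already records
  it. The map \<open>\<iota>\<close> may identify window points: with a single copy, the first and
  the current position show the same copy.\<close>

lemma window_eq_closure:
  fixes \<iota> :: "'y \<Rightarrow> 'v"
  assumes win: "\<And>y z. y \<in> Y \<Longrightarrow> z \<in> Y \<Longrightarrow> (\<iota> y, \<iota> z) \<in> eq_closure E \<longleftrightarrow> (y, z) \<in> eq_closure s"
    and s: "s \<subseteq> Y \<times> Y" and F: "F \<subseteq> Y \<times> Y" and yz: "y \<in> Y" "z \<in> Y"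
  shows "(\<iota> y, \<iota> z) \<in> eq_closure (E \<union> map_prod \<iota> \<iota> ` F) \<longleftrightarrow> (y, z) \<in> eq_closure (s \<union> F)"
    (is "_ \<in> ?A \<longleftrightarrow> _ \<in> ?B")
proof
  assume "(\<iota> y, \<iota> z) \<in> ?A"
  \<comment> \<open>Invariant along the path: its current end hangs by \<open>E\<close> alone on a
    window point that \<open>s \<union> F\<close> connects to \<open>y\<close>.\<close>
  have "\<exists>z'\<in>Y. (y, z') \<in> ?B \<and> (\<iota> z', v) \<in> eq_closure E" if "(\<iota> y, v) \<in> ?A" for v
    using that
  proof (induction rule: rtrancl_induct)
    case base
    then show ?case using yz by blast
  next
    case (step u v)
    then obtain z' where z': "z' \<in> Y" "(y, z') \<in> ?B" "(\<iota> z', u) \<in> eq_closure E" by blast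
    from step.hyps(2) consider "(u, v) \<in> E \<union> E\<inverse>"
      | a b where "(a, b) \<in> F \<union> F\<inverse>" "u = \<iota> a" "v = \<iota> b" by auto
    then show ?case
    proof cases
      case 1
      then show ?thesis using z' by (meson rtrancl.rtrancl_into_rtrancl)
    next
      case 2
      then have ab: "a \<in> Y" "b \<in> Y" using F by auto
      then have "(z', a) \<in> eq_closure s" using win z' 2 by blast
      then have "(z', a) \<in> ?B" using eq_closure_mono[of s "s \<union> F"] by blast
      moreover have "(a, b) \<in> ?B" using 2 by auto
      ultimately have "(y, b) \<in> ?B" using z' by (meson rtrancl_trans)
      then show ?thesis using ab 2 by blast
    qed
  qed
  then obtain z' where z': "z' \<in> Y" "(y, z') \<in> ?B" "(\<iota> z', \<iota> z) \<in> eq_closure E"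
    using \<open>(\<iota> y, \<iota> z) \<in> ?A\<close> by blast
  then have "(z', z) \<in> eq_closure s" using win yz by blast
  then have "(z', z) \<in> ?B" using eq_closure_mono[of s "s \<union> F"] by blast
  then show "(y, z) \<in> ?B" using z' by (meson rtrancl_trans)
next
  assume "(y, z) \<in> ?B"
  then have "z \<in> Y \<and> (\<iota> y, \<iota> z) \<in> ?A"
  proof (induction rule: rtrancl_induct)
    case base
    then show ?case using yz by simp
  next
    case (step u v)
    then have uv: "u \<in> Y" "v \<in> Y" using s F by auto
    have "(\<iota> u, \<iota> v) \<in> ?A"
    proof (cases "(u, v) \<in> s \<union> s\<inverse>")
      case True
      then have "(\<iota> u, \<iota> v) \<in> eq_closure E" using win uv by blast
      then show ?thesis using eq_closure_mono[of E "E \<union> map_prod \<iota> \<iota> ` F"] by blast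
    next
      case False
      then have "(u, v) \<in> F \<union> F\<inverse>" using step by blast
      then have "(\<iota> u, \<iota> v) \<in> map_prod \<iota> \<iota> ` F \<union> (map_prod \<iota> \<iota> ` F)\<inverse>" by force
      then show ?thesis by (intro r_into_rtrancl) auto
    qed
    then show ?case using step uv by (meson rtrancl_trans)
  qed
  then show "(\<iota> y, \<iota> z) \<in> ?A" ..
qed

section \<open>Counting classes through a window\<close>

lemma card_image_eq_if_same_kernel:
  assumes "\<And>x y. x \<in> A \<Longrightarrow> y \<in> A \<Longrightarrow> f x = f y \<longleftrightarrow> g x = g y"
  shows "card (f ` A) = card (g ` A)"
proof (rule bij_betw_same_card)
  have "g (inv_into A f (f x)) = g x" if "x \<in> A" for x
    using that assms by (metis f_inv_into_f imageI inv_into_into)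
  then show "bij_betw (\<lambda>b. g (inv_into A f b)) (f ` A) (g ` A)"
    using assms by (auto simp: bij_betw_def inj_on_def image_image)
qed

lemma quotient_conv_image: "A // R = (\<lambda>x. R `` {x}) ` A"
  by (auto simp: quotient_def)

lemma card_quotient_eq_closure:
  assumes "\<And>x y. x \<in> A \<Longrightarrow> y \<in> A \<Longrightarrow> (f x, f y) \<in> eq_closure E \<longleftrightarrow> (x, y) \<in> eq_closure s"
  shows "card ((f ` A) // eq_closure E) = card (A // eq_closure s)"
  unfolding quotient_conv_image image_image
  by (rule card_image_eq_if_same_kernel) (simp add: eq_closure_image_eq_iff assms)

text \<open>The window lemma for an empty initial graph; there its hypothesis says that
  \<open>f\<close> is injective.\<close>

lemma card_quotient_inj:
  assumes "inj f"
  shows "card ((f ` A) // eq_closure (map_prod f f ` E)) = card (A // eq_closure E)"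
proof (rule card_quotient_eq_closure)
  fix x y
  show "(f x, f y) \<in> eq_closure (map_prod f f ` E) \<longleftrightarrow> (x, y) \<in> eq_closure E"
    using window_eq_closure[of UNIV f "{}" "{}" E x y] assms by (simp add: inj_eq)
qed

text \<open>Classes that meet the window correspond to window classes; the others are kept apart
  because edges added in the window will leave them alone.\<close>

lemma card_quotient_window:
  fixes \<iota> :: "'y \<Rightarrow> 'v"
  assumes win: "\<And>y z. y \<in> Y \<Longrightarrow> z \<in> Y \<Longrightarrow> (\<iota> y, \<iota> z) \<in> eq_closure E \<longleftrightarrow> (y, z) \<in> eq_closure s"
    and V: "finite V" and Y: "\<iota> ` Y \<subseteq> V"
  shows "card (V // eq_closure E)
    = card (Y // eq_closure s) + card {C \<in> V // eq_closure E. C \<inter> \<iota> ` Y = {}}"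
proof -
  let ?B = "{C \<in> V // eq_closure E. C \<inter> \<iota> ` Y = {}}"
  have "V // eq_closure E = (\<iota> ` Y) // eq_closure E \<union> ?B"
  proof (intro equalityI subsetI)
    fix C assume C: "C \<in> V // eq_closure E"
    show "C \<in> (\<iota> ` Y) // eq_closure E \<union> ?B"
    proof (cases "C \<inter> \<iota> ` Y = {}")
      case False
      then obtain y where y: "y \<in> Y" "\<iota> y \<in> C" by blast
      obtain x where "C = eq_closure E `` {x}" using C by (auto elim: quotientE)
      then have "C = eq_closure E `` {\<iota> y}"
        using y by (metis Image_singleton_iff eq_closure_image_eq_iff)
      then show ?thesis using y by (auto simp: quotient_conv_image)
    qed (use C in blast)
  next
    fix C assume "C \<in> (\<iota> ` Y) // eq_closure E \<union> ?B"
    then show "C \<in> V // eq_closure E" using Y by (auto simp: quotient_conv_image)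
  qed
  moreover have "(\<iota> ` Y) // eq_closure E \<inter> ?B = {}"
    by (auto simp: quotient_conv_image)
  moreover have "finite (V // eq_closure E)" using V by (simp add: quotient_conv_image)
  ultimately have "card (V // eq_closure E) = card ((\<iota> ` Y) // eq_closure E) + card ?B"
    by (metis (no_types, lifting) card_Un_disjoint finite_Un)
  then show ?thesis using card_quotient_eq_closure[of Y \<iota> E s] win by simp
qed

text \<open>Only classes meeting the window can merge, so \<open>V\<close> loses as many classes as
  the window does. The additive form avoids truncated subtraction.\<close>

lemma card_quotient_add_edges:
  fixes \<iota> :: "'y \<Rightarrow> 'v"
  assumes win: "\<And>y z. y \<in> Y \<Longrightarrow> z \<in> Y \<Longrightarrow> (\<iota> y, \<iota> z) \<in> eq_closure E \<longleftrightarrow> (y, z) \<in> eq_closure s"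
    and s: "s \<subseteq> Y \<times> Y" and F: "F \<subseteq> Y \<times> Y" and V: "finite V" and Y: "\<iota> ` Y \<subseteq> V"
  shows "card (V // eq_closure E) + card (Y // eq_closure (s \<union> F))
    = card (V // eq_closure (E \<union> map_prod \<iota> \<iota> ` F)) + card (Y // eq_closure s)"
proof -
  let ?E = "E \<union> map_prod \<iota> \<iota> ` F" and ?X = "\<iota> ` Y"
  \<comment> \<open>A class that avoids the window can never use an edge of \<open>F\<close>, so it
    survives unchanged.\<close>
  have same: "eq_closure ?E `` {x} = eq_closure E `` {x}"
    if "eq_closure E `` {x} \<inter> ?X = {}" for x
  proof -
    have "(x, v) \<in> eq_closure E" if "(x, v) \<in> eq_closure ?E" for v
      using that
    proof (induction rule: rtrancl_induct)
      case (step u v)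
      then have "u \<notin> ?X" using \<open>eq_closure E `` {x} \<inter> ?X = {}\<close> by auto
      then have "(u, v) \<in> E \<union> E\<inverse>" using step.hyps(2) F by auto
      then show ?case using step.IH by (meson rtrancl.rtrancl_into_rtrancl)
    qed simp
    then show ?thesis using eq_closure_mono[of E ?E] by blast
  qed
  have "{C \<in> V // eq_closure E. C \<inter> ?X = {}} = {C \<in> V // eq_closure ?E. C \<inter> ?X = {}}"
  proof (intro equalityI subsetI)
    fix C assume "C \<in> {C \<in> V // eq_closure E. C \<inter> ?X = {}}"
    then obtain x where "x \<in> V" "C = eq_closure E `` {x}" "C \<inter> ?X = {}"
      by (auto simp: quotient_conv_image)
    then show "C \<in> {C \<in> V // eq_closure ?E. C \<inter> ?X = {}}"
      using same[of x] by (auto simp: quotient_conv_image)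
  next
    fix C assume "C \<in> {C \<in> V // eq_closure ?E. C \<inter> ?X = {}}"
    then obtain x where x: "x \<in> V" "C = eq_closure ?E `` {x}" "C \<inter> ?X = {}"
      by (auto simp: quotient_conv_image)
    then have "eq_closure E `` {x} \<inter> ?X = {}"
      using eq_closure_mono[of E ?E] by blast
    then show "C \<in> {C \<in> V // eq_closure E. C \<inter> ?X = {}}"
      using same[of x] x by (auto simp: quotient_conv_image)
  qed
  moreover have "(\<iota> y, \<iota> z) \<in> eq_closure ?E \<longleftrightarrow> (y, z) \<in> eq_closure (s \<union> F)"
    if "y \<in> Y" "z \<in> Y" for y z
    using window_eq_closure[OF win s F that] .
  ultimately show ?thesis
    using card_quotient_window[of Y \<iota> E s V, OF win V Y]
      card_quotient_window[of Y \<iota> ?E "s \<union> F" V, OF _ V Y] by simp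
qed

lemma eq_closure_outside:
  assumes "E \<subseteq> V \<times> V" and "(x, y) \<in> eq_closure E" and "x \<notin> V"
  shows "y = x"
  using assms(2) assms(1,3) by (induction rule: rtrancl_induct) auto

lemma card_quotient_isolated:
  assumes "finite V" "finite W" "V \<inter> W = {}" "E \<subseteq> V \<times> V"
  shows "card ((V \<union> W) // eq_closure E) = card (V // eq_closure E) + card W"
proof -
  have W: "eq_closure E `` {w} = {w}" if "w \<in> W" for w
    using that assms eq_closure_outside[of E V w] by auto
  have "(V \<union> W) // eq_closure E = V // eq_closure E \<union> (\<lambda>w. {w}) ` W"
    using W by (auto simp: quotient_conv_image)
  moreover have "V // eq_closure E \<inter> (\<lambda>w. {w}) ` W = {}"
  proof -
    have "x = w" if "eq_closure E `` {x} = {w}" for x w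
      using that by blast
    then show ?thesis using assms(3) by (auto simp: quotient_conv_image)
  qed
  moreover have "finite (V // eq_closure E)" using assms by (simp add: quotient_conv_image)
  ultimately show ?thesis
    using assms by (simp add: card_Un_disjoint card_image)
qed

lemma card_quotient_le: "finite V \<Longrightarrow> card (V // R) \<le> card V"
  by (simp add: quotient_conv_image card_image_le)

text \<open>The trace of \<open>eq_closure E\<close> on the window is already an equivalence there,
  so closing it again adds nothing. This makes traces admissible as \<open>s\<close> in the window
  lemmas.\<close>

lemma restrict_eq_closure:
  fixes \<iota> :: "'y \<Rightarrow> 'v"
  defines "s \<equiv> \<lambda>Y E. {(y, z) \<in> Y \<times> Y. (\<iota> y, \<iota> z) \<in> eq_closure E}"
  assumes "y \<in> Y" "z \<in> Y"
  shows "(\<iota> y, \<iota> z) \<in> eq_closure E \<longleftrightarrow> (y, z) \<in> eq_closure (s Y E)"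
proof
  assume "(\<iota> y, \<iota> z) \<in> eq_closure E"
  then have "(y, z) \<in> s Y E" using assms by (simp add: s_def)
  then show "(y, z) \<in> eq_closure (s Y E)" by auto
next
  assume "(y, z) \<in> eq_closure (s Y E)"
  then show "(\<iota> y, \<iota> z) \<in> eq_closure E"
  proof (induction rule: rtrancl_induct)
    case (step u v)
    then have "(\<iota> u, \<iota> v) \<in> eq_closure E" unfolding s_def using eq_closure_sym by fastforce
    then show ?case using step.IH by (rule rtrancl_trans[rotated])
  qed simp
qed

lemma card_quotient_anti_mono:
  assumes "finite V" "E \<subseteq> E'"
  shows "card (V // eq_closure E') \<le> card (V // eq_closure E)"
proof -
  have "V // eq_closure E' = (\<lambda>C. eq_closure E' `` C) ` (V // eq_closure E)"
  proof -
    have "eq_closure E' `` (eq_closure E `` {x}) = eq_closure E' `` {x}" for x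
      using eq_closure_mono[OF assms(2)] by (blast intro: rtrancl_trans)
    then show ?thesis unfolding quotient_conv_image image_image by simp
  qed
  then show ?thesis using assms(1) by (simp add: quotient_conv_image card_image_le)
qed

text \<open>Unlike the number of components, the rank only grows when edges are added, so its increments
  can be exponents of polynomials.\<close>

definition rank :: "'a set \<Rightarrow> 'a rel \<Rightarrow> nat" where
  "rank V E = card V - card (V // eq_closure E)"

definition rank_gain :: "'a set \<Rightarrow> 'a rel \<Rightarrow> 'a rel \<Rightarrow> nat" where
  "rank_gain Y s F = card (Y // eq_closure s) - card (Y // eq_closure (s \<union> F))"

text \<open>Added edges never increase the number of classes, so all truncated differences are
  genuine and the balance of classes becomes an addition of ranks.\<close>

lemma rank_add_edges:
  assumes win: "\<And>y z. y \<in> Y \<Longrightarrow> z \<in> Y \<Longrightarrow> (\<iota> y, \<iota> z) \<in> eq_closure E \<longleftrightarrow> (y, z) \<in> eq_closure s"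
    and s: "s \<subseteq> Y \<times> Y" and F: "F \<subseteq> Y \<times> Y" and V: "finite V" and Y: "finite Y" "\<iota> ` Y \<subseteq> V"
  shows "rank V (E \<union> map_prod \<iota> \<iota> ` F) = rank_gain Y s F + rank V E"
proof -
  have "card (Y // eq_closure (s \<union> F)) \<le> card (Y // eq_closure s)"
    by (rule card_quotient_anti_mono[OF Y(1)]) simp
  moreover have "card (V // eq_closure E) \<le> card V" by (rule card_quotient_le[OF V])
  moreover have "card (V // eq_closure E) + card (Y // eq_closure (s \<union> F))
    = card (V // eq_closure (E \<union> map_prod \<iota> \<iota> ` F)) + card (Y // eq_closure s)"
    using win s F V Y(2) by (rule card_quotient_add_edges)
  ultimately show ?thesis unfolding rank_def rank_gain_def by linarith
qed

text \<open>An isolated vertex adds one vertex and one class. Hence a copy that no step has reached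
  yet can be included at no cost.\<close>

lemma rank_isolated:
  assumes "finite V" "finite W" "V \<inter> W = {}" "E \<subseteq> V \<times> V"
  shows "rank (V \<union> W) E = rank V E"
  using assms card_quotient_isolated[OF assms] by (simp add: rank_def card_Un_disjoint)

section \<open>Spanning trees and cuts\<close>

definition links :: "('v, 'e) pre_digraph \<Rightarrow> 'e set \<Rightarrow> 'v rel" where
  "links G T = (\<lambda>e. (tail G e, head G e)) ` T"

lemma links_in_closure: "e \<in> T \<Longrightarrow> (tail G e, head G e) \<in> eq_closure (links G T)"
  by (auto simp: links_def)

lemma bidirect_simps [simp]:
  "verts (bidirect G) = verts G" "arcs (bidirect G) = arcs G \<times> UNIV"
  "tail (bidirect G) (e, b) = (if b then head G e else tail G e)"
  "head (bidirect G) (e, b) = (if b then tail G e else head G e)"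
  by (simp_all add: bidirect_def)

lemma connected_subgraph_iff:
  assumes "wf_digraph G" "T \<subseteq> arcs G"
  shows "connected (G\<lparr>arcs := T\<rparr>) \<longleftrightarrow>
    verts G \<noteq> {} \<and> (\<forall>u\<in>verts G. \<forall>v\<in>verts G. (u, v) \<in> eq_closure (links G T))"
proof -
  interpret wf_digraph G by fact
  let ?G = "G\<lparr>arcs := T\<rparr>"
  have wf: "wf_digraph ?G" using assms(2) by unfold_locales auto
  interpret S: pair_wf_digraph "mk_symmetric ?G"
    by (rule wf_digraph.wellformed_mk_symmetric[OF wf])
  have "parcs (mk_symmetric ?G) = links G T \<union> (links G T)\<inverse>"
    by (auto simp: parcs_mk_symmetric links_def)
  then show ?thesis
    by (simp add: connected_def strongly_connected_def S.reachable_conv' cong: ball_cong)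
qed

lemma connected_iff:
  assumes "wf_digraph G"
  shows "connected G \<longleftrightarrow>
    verts G \<noteq> {} \<and> (\<forall>u\<in>verts G. \<forall>v\<in>verts G. (u, v) \<in> eq_closure (links G (arcs G)))"
  using connected_subgraph_iff[OF assms order_refl] by simp

lemma wf_bidirect: "wf_digraph G \<Longrightarrow> T \<subseteq> arcs G \<Longrightarrow> wf_digraph (bidirect (G\<lparr>arcs := T\<rparr>))"
  by (auto simp: wf_digraph_def)

lemma awalk_imp_eq_closure:
  assumes "pre_digraph.cas (bidirect (G\<lparr>arcs := T\<rparr>)) u p v" and "fst ` set p \<subseteq> S"
  shows "(u, v) \<in> eq_closure (links G S)"
  using assms
proof (induction p arbitrary: u)
  case Nil
  then show ?case by (simp add: pre_digraph.cas.simps)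
next
  case (Cons a p)
  obtain e b where a: "a = (e, b)" by fastforce
  have "(head (bidirect (G\<lparr>arcs := T\<rparr>)) a, v) \<in> eq_closure (links G S)"
    using Cons by (simp add: pre_digraph.cas.simps)
  moreover have "(u, head (bidirect (G\<lparr>arcs := T\<rparr>)) a) \<in> eq_closure (links G S)"
    using Cons.prems a links_in_closure[of e S G] eq_closure_sym
    by (auto simp: pre_digraph.cas.simps)
  ultimately show ?case by (meson rtrancl_trans)
qed

lemma eq_closure_imp_awalk:
  assumes "wf_digraph G" "T \<subseteq> arcs G" "u \<in> verts G" "(u, v) \<in> eq_closure (links G T)"
  shows "\<exists>p. pre_digraph.awalk (bidirect (G\<lparr>arcs := T\<rparr>)) u p v"
proof -
  interpret W: wf_digraph "bidirect (G\<lparr>arcs := T\<rparr>)" using assms by (intro wf_bidirect)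
  have "links G T \<union> (links G T)\<inverse> \<subseteq> arcs_ends (bidirect (G\<lparr>arcs := T\<rparr>))"
    by (force simp: links_def arcs_ends_conv)
  then have "(u, v) \<in> (arcs_ends (bidirect (G\<lparr>arcs := T\<rparr>)))\<^sup>*"
    using assms(4) rtrancl_mono by blast
  then have "reachable (bidirect (G\<lparr>arcs := T\<rparr>)) u v" using assms(3) by (simp add: W.reachable_conv')
  then show ?thesis by (simp add: W.reachable_awalk)
qed

text \<open>An edge used again, in either direction, would lead the walk back to the tail of its
  first use, a repeated vertex.\<close>

lemma apath_distinct_edges:
  assumes "pre_digraph.cas (bidirect G) u p v"
    and "distinct (pre_digraph.awalk_verts (bidirect G) u p)"
  shows "distinct (map fst p)"
  using assms
proof (induction p arbitrary: u)
  case (Cons a p)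
  interpret pre_digraph "bidirect G" .
  let ?w = "awalk_verts (head (bidirect G) a) p"
  have ends: "{tail (bidirect G) c, head (bidirect G) c} \<subseteq> set (awalk_verts w q)"
    if "cas w q v" "c \<in> set q" for w q c
    using that
  proof (induction q arbitrary: w)
    case (Cons b q)
    then show ?case by (cases q) auto
  qed simp
  have "fst a \<notin> fst ` set p"
  proof
    assume "fst a \<in> fst ` set p"
    then obtain c where c: "c \<in> set p" "fst c = fst a" by auto
    then obtain e b b' where "a = (e, b)" "c = (e, b')" by (metis prod.collapse)
    then have "tail (bidirect G) a \<in> {tail (bidirect G) c, head (bidirect G) c}"
      by auto
    then have "tail (bidirect G) a \<in> set ?w"
      using ends[OF _ c(1)] Cons.prems by auto
    then show False using Cons.prems by simp
  qed
  then show ?case using Cons.IH[of "head (bidirect G) a"] Cons.prems by simp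
qed simp

text \<open>The bridge criterion for forests: a walk that joins the ends of \<open>e\<close> without
  using \<open>e\<close> shortens to a path, and \<open>e\<close> closes it to a cycle.\<close>

lemma no_undirected_cycle_iff:
  assumes "wf_digraph G" "T \<subseteq> arcs G"
  shows "(\<nexists>p. undirected_cycle (G\<lparr>arcs := T\<rparr>) p) \<longleftrightarrow>
    (\<forall>e\<in>T. (tail G e, head G e) \<notin> eq_closure (links G (T - {e})))"
proof -
  let ?B = "\<lambda>T. bidirect (G\<lparr>arcs := T\<rparr>)"
  have "(\<exists>p. undirected_cycle (G\<lparr>arcs := T\<rparr>) p) \<longleftrightarrow>
    (\<exists>e\<in>T. (tail G e, head G e) \<in> eq_closure (links G (T - {e})))"
  proof
    assume "\<exists>p. undirected_cycle (G\<lparr>arcs := T\<rparr>) p"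
    then obtain p u where p: "pre_digraph.awalk (?B T) u p u" "p \<noteq> []" "distinct (map fst p)"
      by (auto simp: undirected_cycle_def pre_digraph.cycle_def)
    then obtain a q where a: "p = a # q" by (cases p) auto
    obtain e b where e: "a = (e, b)" by fastforce
    have "e \<in> T" "fst ` set q \<subseteq> T - {e}" "tail (?B T) a = u"
      and cas: "pre_digraph.cas (?B T) (head (?B T) a) q u"
      using p a e by (auto simp: pre_digraph.awalk_def pre_digraph.cas.simps)
    moreover have "(head (?B T) a, u) \<in> eq_closure (links G (T - {e}))"
      using awalk_imp_eq_closure[OF cas] calculation by simp
    ultimately show "\<exists>e\<in>T. (tail G e, head G e) \<in> eq_closure (links G (T - {e}))"
      using e eq_closure_sym by (force split: if_splits)
  next
    assume "\<exists>e\<in>T. (tail G e, head G e) \<in> eq_closure (links G (T - {e}))"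
    then obtain e where e: "e \<in> T" "(head G e, tail G e) \<in> eq_closure (links G (T - {e}))"
      using eq_closure_sym by metis
    interpret W: wf_digraph "?B (T - {e})" using assms by (intro wf_bidirect) auto
    have "head G e \<in> verts G" using assms e by (auto simp: wf_digraph_def)
    then obtain p where "W.awalk (head G e) p (tail G e)"
      using eq_closure_imp_awalk[OF assms(1) _ _ e(2)] assms(2) by auto
    then have "W.apath (head G e) (W.awalk_to_apath p) (tail G e)"
      by (rule W.apath_awalk_to_apath)
    then obtain q where q: "W.awalk (head G e) q (tail G e)" "distinct (W.awalk_verts (head G e) q)"
      by (auto simp: W.apath_def)
    have dist: "distinct (map fst q)"
      using apath_distinct_edges q by (auto simp: W.awalk_def)
    \<comment> \<open>The vertex sequence of a walk depends on \<open>tail\<close> and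
      \<open>head\<close> alone, on which both graphs agree, so \<open>q\<close> can be reused with
      the larger edge set.\<close>
    have "compatible (?B T) (?B (T - {e}))" by (auto simp: compatible_def bidirect_def fun_eq_iff)
    note verts_eq = compatible_awalk_verts[OF this] and cas_eq = compatible_cas[OF this]
    have "pre_digraph.awalk (?B T) (tail G e) ((e, False) # q) (tail G e)"
      using q e assms
      by (auto simp: pre_digraph.awalk_def pre_digraph.cas.simps cas_eq wf_digraph_def)
    moreover have "distinct (tl (pre_digraph.awalk_verts (?B T) (tail G e) ((e, False) # q)))"
      using q by (simp add: pre_digraph.awalk_verts.simps verts_eq)
    moreover have "e \<notin> fst ` set q" using q by (auto simp: W.awalk_def)
    ultimately have "undirected_cycle (G\<lparr>arcs := T\<rparr>) ((e, False) # q)"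
      using dist unfolding undirected_cycle_def pre_digraph.cycle_def by auto
    then show "\<exists>p. undirected_cycle (G\<lparr>arcs := T\<rparr>) p" ..
  qed
  then show ?thesis by blast
qed

lemma is_spanning_tree_iff:
  assumes "wf_digraph G"
  shows "is_spanning_tree G T \<longleftrightarrow> T \<subseteq> arcs G \<and> verts G \<noteq> {} \<and>
    (\<forall>u\<in>verts G. \<forall>v\<in>verts G. (u, v) \<in> eq_closure (links G T)) \<and>
    (\<forall>e\<in>T. (tail G e, head G e) \<notin> eq_closure (links G (T - {e})))"
  using connected_subgraph_iff[OF assms] no_undirected_cycle_iff[OF assms]
  unfolding is_spanning_tree_def by blast

text \<open>Take a minimal edge set that connects all vertices: an edge whose ends stay connected
  without it could be dropped.\<close>

lemma spanning_tree_exists: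
  assumes "fin_digraph G" "connected G"
  shows "\<exists>T. is_spanning_tree G T"
proof -
  interpret fin_digraph G by fact
  let ?P = "\<lambda>T. T \<subseteq> arcs G \<and> (\<forall>u\<in>verts G. \<forall>v\<in>verts G. (u, v) \<in> eq_closure (links G T))"
  have "?P (arcs G)" using assms(2) by (simp add: connected_iff wf_digraph_axioms)
  then have "\<exists>T\<in>{T \<in> Pow (arcs G). ?P T}. T \<subseteq> arcs G \<and> (\<forall>S\<in>{T \<in> Pow (arcs G). ?P T}. S \<subseteq> T \<longrightarrow> T = S)"
    by (intro finite_has_minimal2) auto
  then obtain T where T: "?P T" and min: "\<And>S. ?P S \<Longrightarrow> S \<subseteq> T \<Longrightarrow> T = S" by auto
  have "(tail G e, head G e) \<notin> eq_closure (links G (T - {e}))" if "e \<in> T" for e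
  proof
    assume *: "(tail G e, head G e) \<in> eq_closure (links G (T - {e}))"
    have "links G T \<subseteq> eq_closure (links G (T - {e}))"
      using * links_in_closure[of _ "T - {e}" G] by (auto simp: links_def)
    then have "eq_closure (links G T) \<subseteq> eq_closure (links G (T - {e}))"
      by (intro eq_closure_minimal equiv_eq_closure)
    then have "?P (T - {e})" using T by blast
    then show False using min[of "T - {e}"] that by auto
  qed
  moreover have "verts G \<noteq> {}" using assms(2) by (simp add: connected_iff wf_digraph_axioms)
  ultimately show ?thesis using T is_spanning_tree_iff[OF wf_digraph_axioms] by blast
qed

section \<open>Cuts and their traces on a spanning tree\<close>

definition edge_cut :: "('v, 'e) pre_digraph \<Rightarrow> 'v set \<Rightarrow> 'e set" where
  "edge_cut G W = {e \<in> arcs G. (tail G e \<in> W) \<noteq> (head G e \<in> W)}"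

lemma edge_cut_sym_diff: "edge_cut G (sym_diff A B) = sym_diff (edge_cut G A) (edge_cut G B)"
  by (auto simp: edge_cut_def)

text \<open>Along a tree path from the root, which lies in neither set, membership switches exactly
  at the cut edges, so the trace determines the set.\<close>

lemma spanning_tree_cut_unique:
  assumes "wf_digraph G" "is_spanning_tree G T" "r \<in> verts G"
    and W: "W \<subseteq> verts G - {r}" "W' \<subseteq> verts G - {r}" "edge_cut G W \<inter> T = edge_cut G W' \<inter> T"
  shows "W = W'"
proof -
  have T: "T \<subseteq> arcs G" "\<forall>u\<in>verts G. \<forall>v\<in>verts G. (u, v) \<in> eq_closure (links G T)"
    using assms is_spanning_tree_iff by blast+
  have "v \<in> W \<longleftrightarrow> v \<in> W'" if "v \<in> verts G" for v
  proof -
    have "(r, v) \<in> eq_closure (links G T)" using T that assms by blast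
    then show ?thesis
    proof (induction rule: rtrancl_induct)
      case base
      then show ?case using W by blast
    next
      case (step u v)
      then obtain e where e: "e \<in> T" "(u, v) = (tail G e, head G e) \<or> (v, u) = (tail G e, head G e)"
        by (auto simp: links_def)
      then have "e \<in> edge_cut G W \<longleftrightarrow> e \<in> edge_cut G W'" using W by blast
      then show ?case using e step T by (auto simp: edge_cut_def)
    qed
  qed
  then show ?thesis using W by blast
qed

text \<open>The fundamental cut of \<open>e\<close>: removing \<open>e\<close> splits the tree into
  two parts, and \<open>W\<close> is the part without the root.\<close>

lemma spanning_tree_cut_single:
  assumes "wf_digraph G" "is_spanning_tree G T" "r \<in> verts G" "e \<in> T"
  shows "\<exists>W\<subseteq>verts G - {r}. edge_cut G W \<inter> T = {e}"
proof -
  interpret wf_digraph G by fact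
  have T: "T \<subseteq> arcs G" "\<And>u v. u \<in> verts G \<Longrightarrow> v \<in> verts G \<Longrightarrow> (u, v) \<in> eq_closure (links G T)"
    and e: "(tail G e, head G e) \<notin> eq_closure (links G (T - {e}))"
    using assms is_spanning_tree_iff by blast+
  let ?R = "eq_closure (links G (T - {e}))"
  define W where "W = {v \<in> verts G. (r, v) \<notin> ?R}"
  have verts: "tail G f \<in> verts G" "head G f \<in> verts G" if "f \<in> T" for f using that T by auto
  have "tail G f \<in> W \<longleftrightarrow> head G f \<in> W" if "f \<in> T" "f \<noteq> e" for f
  proof -
    have "(tail G f, head G f) \<in> ?R" using that by (intro links_in_closure) auto
    then have "(r, tail G f) \<in> ?R \<longleftrightarrow> (r, head G f) \<in> ?R"
      by (meson eq_closure_sym rtrancl_trans)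
    then show ?thesis using verts[OF that(1)] by (simp add: W_def)
  qed
  moreover have "(tail G e \<in> W) \<noteq> (head G e \<in> W)"
  proof -
    have "\<not> ((r, tail G e) \<in> ?R \<and> (r, head G e) \<in> ?R)"
      using e by (meson eq_closure_sym rtrancl_trans)
    moreover have "(r, tail G e) \<in> ?R \<or> (r, head G e) \<in> ?R"
    proof (rule ccontr)
      assume none: "\<not> ?thesis"
      have "(r, v) \<in> ?R" if "(r, v) \<in> eq_closure (links G T)" for v
        using that
      proof (induction rule: rtrancl_induct)
        case (step u v)
        then obtain f where f: "f \<in> T" "(u, v) = (tail G f, head G f) \<or> (v, u) = (tail G f, head G f)"
          by (auto simp: links_def)
        with none step.IH have "f \<in> T - {e}" by auto
        then have "(u, v) \<in> ?R" using f links_in_closure[of f "T - {e}" G] eq_closure_sym by auto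
        then show ?case using step.IH by (meson rtrancl_trans)
      qed simp
      then show False using none T(2)[OF assms(3) verts(1)[OF assms(4)]] by blast
    qed
    ultimately show ?thesis using verts[OF assms(4)] by (auto simp: W_def)
  qed
  ultimately have "edge_cut G W \<inter> T = {e}" using T(1) assms(4) by (auto simp: edge_cut_def)
  moreover have "W \<subseteq> verts G - {r}" by (auto simp: W_def)
  ultimately show ?thesis by blast
qed

text \<open>Cuts are closed under symmetric difference, so the fundamental cuts of the edges of
  \<open>X\<close> can be added modulo 2.\<close>

lemma spanning_tree_cut_exists:
  assumes "fin_digraph G" "is_spanning_tree G T" "r \<in> verts G" "X \<subseteq> T"
  shows "\<exists>W\<subseteq>verts G - {r}. edge_cut G W \<inter> T = X"
proof -
  interpret fin_digraph G by fact
  have "T \<subseteq> arcs G" using assms(2) by (simp add: is_spanning_tree_def)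
  then have "X \<subseteq> arcs G" using assms(4) by simp
  then have "finite X" using finite_arcs by (rule finite_subset)
  then show ?thesis using \<open>X \<subseteq> T\<close>
  proof (induction rule: finite_induct)
    case empty
    then show ?case by (intro exI[of _ "{}"]) (auto simp: edge_cut_def)
  next
    case (insert e X)
    then obtain W where W: "W \<subseteq> verts G - {r}" "edge_cut G W \<inter> T = X" by auto
    obtain W' where W': "W' \<subseteq> verts G - {r}" "edge_cut G W' \<inter> T = {e}"
      using spanning_tree_cut_single[OF wf_digraph_axioms assms(2,3), of e] insert.prems by blast
    have "edge_cut G (sym_diff W W') \<inter> T = sym_diff (edge_cut G W \<inter> T) (edge_cut G W' \<inter> T)"
      unfolding edge_cut_sym_diff by blast
    also have "\<dots> = insert e X" unfolding W(2) W'(2) using insert.hyps by blast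
    finally have "edge_cut G (sym_diff W W') \<inter> T = insert e X" .
    moreover have "sym_diff W W' \<subseteq> verts G - {r}" using W(1) W'(1) by blast
    ultimately show ?case by (intro exI[of _ "sym_diff W W'"] conjI)
  qed
qed

lemma spanning_tree_cut_bij:
  assumes "fin_digraph G" "is_spanning_tree G T" "r \<in> verts G"
  shows "bij_betw (\<lambda>W. edge_cut G W \<inter> T) (Pow (verts G - {r})) (Pow T)"
proof -
  have "wf_digraph G" using assms(1) by (simp add: fin_digraph_def)
  then have "inj_on (\<lambda>W. edge_cut G W \<inter> T) (Pow (verts G - {r}))"
    using spanning_tree_cut_unique[OF _ assms(2,3)] by (intro inj_onI) simp
  moreover have "Pow T \<subseteq> (\<lambda>W. edge_cut G W \<inter> T) ` Pow (verts G - {r})"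
  proof
    fix X assume "X \<in> Pow T"
    then obtain W where "W \<subseteq> verts G - {r}" "edge_cut G W \<inter> T = X"
      using spanning_tree_cut_exists[OF assms] by blast
    then show "X \<in> (\<lambda>W. edge_cut G W \<inter> T) ` Pow (verts G - {r})" by auto
  qed
  ultimately show ?thesis by (auto simp: bij_betw_def)
qed

text \<open>Comparing sizes in the bijection between cuts and subsets of \<open>T\<close> gives
  2^(|V| - 1) = 2^|T|, which spares an induction over trees.\<close>

lemma card_spanning_tree:
  assumes "fin_digraph G" "is_spanning_tree G T"
  shows "card (verts G) = Suc (card T)"
proof -
  interpret fin_digraph G by fact
  obtain r where r: "r \<in> verts G" using assms(2) is_spanning_tree_iff[OF wf_digraph_axioms] by blast
  have "finite T" using assms(2) finite_subset[OF _ finite_arcs] by (auto simp: is_spanning_tree_def)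
  then have "2 ^ card (verts G - {r}) = (2 :: nat) ^ card T"
    using bij_betw_same_card[OF spanning_tree_cut_bij[OF assms r]] by (simp add: card_Pow)
  then have "card (verts G - {r}) = card T" by simp
  moreover have "card (verts G) > 0" using r by (auto simp: card_gt_0_iff)
  ultimately show ?thesis using r by simp
qed

section \<open>Reversing local orientations\<close>

lemma tail_rotation:
  assumes "wf_digraph G" "signed_rotation_system G \<rho> X"
  shows "tail (bidirect G) (\<rho> d) = tail (bidirect G) d"
proof (cases "d \<in> edge_ends G")
  case True
  let ?v = "tail (bidirect G) d"
  have "?v \<in> verts G" using True assms(1) by (cases d) (auto simp: wf_digraph_def)
  moreover have d: "d \<in> edge_ends_at G ?v" using True by simp
  ultimately have "cyclic_on \<rho> (edge_ends_at G ?v)"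
    using assms(2) unfolding signed_rotation_system_def by blast
  then have "\<rho> d \<in> edge_ends_at G ?v" using d by (rule cyclic_on_inI)
  then show ?thesis by simp
next
  case False
  moreover have "\<rho> permutes edge_ends G" using assms(2) by (simp add: signed_rotation_system_def)
  ultimately show ?thesis by (metis permutes_not_in)
qed

definition reverse_rotation ::
  "('v, 'e) pre_digraph \<Rightarrow> 'v set \<Rightarrow> ('e \<times> bool \<Rightarrow> 'e \<times> bool) \<Rightarrow> 'e \<times> bool \<Rightarrow> 'e \<times> bool" where
  "reverse_rotation G W \<rho> d = (if tail (bidirect G) d \<in> W then inv \<rho> d else \<rho> d)"

text \<open>The symmetric difference toggles the twist of an edge with exactly one end in
  \<open>W\<close>; an edge with both ends there, in particular a loop, is reversed twice and keeps
  its twist.\<close>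

definition flip ::
  "('v, 'e) pre_digraph \<Rightarrow> 'v set \<Rightarrow> ('e \<times> bool \<Rightarrow> 'e \<times> bool) \<times> 'e set \<Rightarrow>
   ('e \<times> bool \<Rightarrow> 'e \<times> bool) \<times> 'e set" where
  "flip G W s = (reverse_rotation G W (fst s), sym_diff (snd s) (edge_cut G W))"

context
  fixes G :: "('v, 'e) pre_digraph" and \<rho> :: "'e \<times> bool \<Rightarrow> 'e \<times> bool" and X :: "'e set"
  assumes G: "fin_digraph G" and srs: "signed_rotation_system G \<rho> X"
begin

interpretation fin_digraph G by (rule G)

lemma permutes_edge_ends: "\<rho> permutes edge_ends G"
  using srs by (simp add: signed_rotation_system_def)

lemma tail_inv_rotation: "tail (bidirect G) (inv \<rho> d) = tail (bidirect G) d"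
  using tail_rotation[OF wf_digraph_axioms srs, of "inv \<rho> d"]
  by (simp add: permutes_inverses[OF permutes_edge_ends])

text \<open>Rotations stay at their vertex, so both applications take the same branch of the
  definition.\<close>

lemma reverse_rotation_inverse:
  "reverse_rotation G W (inv \<rho>) (reverse_rotation G W \<rho> d) = d"
  "reverse_rotation G W \<rho> (reverse_rotation G W (inv \<rho>) d) = d"
  using tail_rotation[OF wf_digraph_axioms srs] tail_inv_rotation
  by (simp_all add: reverse_rotation_def permutes_inverses[OF permutes_edge_ends]
      permutes_inv_inv[OF permutes_edge_ends])

lemma inv_reverse_rotation: "inv (reverse_rotation G W \<rho>) = reverse_rotation G W (inv \<rho>)"
  by (rule inv_unique_comp) (simp_all add: fun_eq_iff reverse_rotation_inverse)

lemma reverse_rotation_srs: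
  "signed_rotation_system G (reverse_rotation G W \<rho>) (sym_diff X (edge_cut G W))"
proof -
  have "reverse_rotation G W \<rho> permutes edge_ends G"
    unfolding permutes_def
  proof (intro conjI allI impI)
    show "\<exists>!d'. reverse_rotation G W \<rho> d' = d" for d
      using reverse_rotation_inverse by metis
  next
    fix d assume "d \<notin> edge_ends G"
    then show "reverse_rotation G W \<rho> d = d"
      using permutes_not_in[OF permutes_edge_ends] permutes_not_in[OF permutes_inv[OF permutes_edge_ends]]
      by (simp add: reverse_rotation_def)
  qed
  moreover have "cyclic_on (reverse_rotation G W \<rho>) (edge_ends_at G v)"
    if v: "v \<in> verts G" "edge_ends_at G v \<noteq> {}" for v
  proof -
    have cyc: "cyclic_on \<rho> (edge_ends_at G v)"
      using that srs by (simp add: signed_rotation_system_def)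
    have "finite (edge_ends G)" by simp
    then have "permutation \<rho>"
      using permutes_edge_ends unfolding permutation_permutes by blast
    then have "cyclic_on (inv \<rho>) (edge_ends_at G v)"
      using cyc by (simp add: cyclic_on_def orbit_inv_eq)
    moreover have "cyclic_on (reverse_rotation G W \<rho>) (edge_ends_at G v)
        \<longleftrightarrow> cyclic_on (if v \<in> W then inv \<rho> else \<rho>) (edge_ends_at G v)"
      by (rule cyclic_cong) (auto simp: reverse_rotation_def)
    ultimately show ?thesis using cyc by simp
  qed
  moreover have "sym_diff X (edge_cut G W) \<subseteq> arcs G"
    using srs by (auto simp: signed_rotation_system_def edge_cut_def)
  ultimately show ?thesis by (simp add: signed_rotation_system_def)
qed

lemma flip_flip: "flip G W (flip G W (\<rho>, X)) = (\<rho>, X)"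
proof -
  have "reverse_rotation G W (reverse_rotation G W \<rho>) d = \<rho> d" for d
  proof -
    have "reverse_rotation G W (reverse_rotation G W \<rho>) d
      = (if tail (bidirect G) d \<in> W then reverse_rotation G W (inv \<rho>) d else reverse_rotation G W \<rho> d)"
      by (subst reverse_rotation_def) (simp add: inv_reverse_rotation)
    also have "\<dots> = \<rho> d"
      by (simp add: reverse_rotation_def permutes_inv_inv[OF permutes_edge_ends])
    finally show ?thesis .
  qed
  then show ?thesis by (auto simp: flip_def fun_eq_iff)
qed

text \<open>Reversing the local orientation at the vertices of \<open>W\<close> exchanges the two sides of
  the edge-ends at these vertices.\<close>

lemma face_steps_reverse:
  fixes W :: "'v set"
  assumes "(x, y) \<in> face_steps G \<rho> X"
  defines "f \<equiv> \<lambda>(d, s). (d, s \<noteq> (tail (bidirect G) d \<in> W))"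
  defines "E \<equiv> face_steps G (reverse_rotation G W \<rho>) (sym_diff X (edge_cut G W))"
  shows "(f x, f y) \<in> E \<union> E\<inverse>"
proof -
  from assms(1) consider
    (disc) d where "d \<in> edge_ends G" "x = (d, True)" "y = (\<rho> d, False)"
  | (band) e b s where "e \<in> arcs G" "x = ((e, b), s)" "y = ((e, \<not> b), if e \<in> X then s else \<not> s)"
    by (auto simp: face_steps_def)
  then show ?thesis
  proof cases
    case disc
    have t: "tail (bidirect G) (\<rho> d) = tail (bidirect G) d"
      by (rule tail_rotation[OF wf_digraph_axioms srs])
    have \<rho>d: "\<rho> d \<in> edge_ends G"
      using disc permutes_in_image[OF permutes_edge_ends] by blast
    show ?thesis
    proof (cases "tail (bidirect G) d \<in> W")
      case True
      \<comment> \<open>At a reversed vertex the successor of \<open>\<rho> d\<close> is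
        \<open>d\<close>, so the disc step reappears in \<open>E\<close> with its ends exchanged;
        this is why the claim admits \<open>E\<inverse>\<close>.\<close>
      then have "reverse_rotation G W \<rho> (\<rho> d) = d"
        by (simp add: reverse_rotation_def t permutes_inverses[OF permutes_edge_ends])
      then have "((\<rho> d, True), (d, False)) \<in> E" using \<rho>d unfolding E_def face_steps_def by force
      then show ?thesis using True disc t by (simp add: f_def)
    next
      case False
      then have "((d, True), (\<rho> d, False)) \<in> E"
        using disc(1) unfolding E_def face_steps_def by (force simp: reverse_rotation_def)
      then show ?thesis using False disc t by (simp add: f_def)
    qed
  next
    case band
    let ?s = "s \<noteq> (tail (bidirect G) (e, b) \<in> W)"
    have "(((e, b), ?s), ((e, \<not> b), if e \<in> sym_diff X (edge_cut G W) then ?s else \<not> ?s)) \<in> E"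
      using band(1) unfolding E_def face_steps_def by blast
    moreover have "f y = ((e, \<not> b), if e \<in> sym_diff X (edge_cut G W) then ?s else \<not> ?s)"
      using band by (cases b; cases s) (auto simp: f_def edge_cut_def)
    ultimately show ?thesis using band by (simp add: f_def)
  qed
qed

end

lemma num_faces_flip:
  fixes G :: "('v, 'e) pre_digraph"
  assumes G: "fin_digraph G" and srs: "signed_rotation_system G \<rho> X" and \<rho>': "flip G W (\<rho>, X) = (\<rho>', X')"
  shows "num_faces G \<rho>' X' = num_faces G \<rho> X"
proof -
  define f :: "('e \<times> bool) \<times> bool \<Rightarrow> ('e \<times> bool) \<times> bool" where
    "f = (\<lambda>(d, s). (d, s \<noteq> (tail (bidirect G) d \<in> W)))"
  have ff: "f (f x) = x" for x by (cases x) (auto simp: f_def)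
  then have "inj f" by (metis injI)
  have fV: "f ` (edge_ends G \<times> UNIV) = edge_ends G \<times> UNIV"
  proof (intro equalityI subsetI)
    fix x :: "('e \<times> bool) \<times> bool" assume x: "x \<in> edge_ends G \<times> UNIV"
    then have "f x \<in> edge_ends G \<times> UNIV" by (auto simp: f_def)
    then show "x \<in> f ` (edge_ends G \<times> UNIV)" using ff[of x] by (metis imageI)
  qed (auto simp: f_def)
  define E where "E = face_steps G \<rho> X"
  define E' where "E' = face_steps G \<rho>' X'"
  have eqs: "\<rho>' = reverse_rotation G W \<rho>" "X' = sym_diff X (edge_cut G W)"
    using \<rho>' by (auto simp: flip_def)
  have srs': "signed_rotation_system G \<rho>' X'"
    using reverse_rotation_srs[OF G srs] eqs by simp
  \<comment> \<open>Since \<open>flip\<close> is an involution, the same lemma carries the steps of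
    the flipped system back, with the roles exchanged.\<close>
  have flip_back: "flip G W (\<rho>', X') = (\<rho>, X)" using flip_flip[OF G srs, of W] \<rho>' by simp
  have 1: "(f x, f y) \<in> E' \<union> E'\<inverse>" if "(x, y) \<in> E" for x y
    using face_steps_reverse[OF G srs, of x y W] that by (simp add: f_def E_def E'_def eqs)
  have 2: "(f x, f y) \<in> E \<union> E\<inverse>" if "(x, y) \<in> E'" for x y
    using face_steps_reverse[OF G srs', of x y W] that flip_back
    by (simp add: f_def E_def E'_def flip_def)
  have "map_prod f f ` (E \<union> E\<inverse>) = E' \<union> E'\<inverse>"
  proof (intro equalityI subsetI)
    fix z assume "z \<in> map_prod f f ` (E \<union> E\<inverse>)"
    then show "z \<in> E' \<union> E'\<inverse>" using 1 by fastforce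
  next
    fix z assume "z \<in> E' \<union> E'\<inverse>"
    then obtain x y where "z = (x, y)" "(x, y) \<in> E' \<or> (y, x) \<in> E'" by (cases z) auto
    then have "(f x, f y) \<in> E \<union> E\<inverse>" using 2 by fastforce
    then have "map_prod f f (f x, f y) \<in> map_prod f f ` (E \<union> E\<inverse>)" by (rule imageI)
    then show "z \<in> map_prod f f ` (E \<union> E\<inverse>)" using \<open>z = (x, y)\<close> by (simp add: ff)
  qed
  moreover have "map_prod f f ` (E \<union> E\<inverse>) = map_prod f f ` E \<union> (map_prod f f ` E)\<inverse>" by force
  ultimately have "card ((f ` (edge_ends G \<times> UNIV)) // eq_closure E')
    = card ((edge_ends G \<times> UNIV) // eq_closure E)"
    using card_quotient_inj[OF \<open>inj f\<close>, of "edge_ends G \<times> UNIV" E] by simp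
  then show ?thesis unfolding fV by (simp add: num_faces_def faces_def E_def E'_def)
qed

text \<open>The summand is a function of the number of faces because flips preserve that number; the
  factor counts the vertex sets avoiding a root.\<close>

lemma sum_signed_rotation_systems:
  fixes G :: "('v, 'e) pre_digraph" and h :: "nat \<Rightarrow> 'a :: comm_semiring_1"
  assumes G: "fin_digraph G" and T: "is_spanning_tree G T"
  shows "(\<Sum>(\<rho>, X)\<in>{(\<rho>, X). signed_rotation_system G \<rho> X}. h (num_faces G \<rho> X))
    = 2 ^ (card (verts G) - 1) * (\<Sum>(\<rho>, X)\<in>general_embeddings G T. h (num_faces G \<rho> X))"
proof -
  interpret fin_digraph G by fact
  obtain r where r: "r \<in> verts G"
    using T is_spanning_tree_iff[OF wf_digraph_axioms] by blast
  let ?P = "Pow (verts G - {r})"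
  define S where "S = {(\<rho>, X). signed_rotation_system G \<rho> X}"
  let ?GE = "general_embeddings G T"
  \<comment> \<open>\<open>U s\<close> is the one set avoiding \<open>r\<close> whose cut agrees
    with the twists of \<open>s\<close> on \<open>T\<close>; flipping by it untwists the
    tree.\<close>
  define U where "U = (\<lambda>s :: ('e \<times> bool \<Rightarrow> 'e \<times> bool) \<times> 'e set. the_inv_into ?P (\<lambda>W. edge_cut G W \<inter> T) (snd s \<inter> T))"
  have bij: "bij_betw (\<lambda>W. edge_cut G W \<inter> T) ?P (Pow T)"
    by (rule spanning_tree_cut_bij[OF G T r])
  have U1: "U s \<in> ?P \<and> edge_cut G (U s) \<inter> T = snd s \<inter> T" for s
    unfolding U_def using bij
    by (metis (no_types, lifting) Int_lower2 PowI bij_betw_def f_the_inv_into_f order_refl the_inv_into_into)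
  have U2: "U s = W" if "W \<in> ?P" "edge_cut G W \<inter> T = snd s \<inter> T" for s W
    unfolding U_def using bij that by (metis (no_types, lifting) bij_betw_def the_inv_into_f_f)
  have flip_S: "flip G W s \<in> S" if "s \<in> S" for W s
    using that reverse_rotation_srs[OF G] by (auto simp: flip_def S_def)
  have flip2: "flip G W (flip G W s) = s" if "s \<in> S" for W s
    using that flip_flip[OF G] by (auto simp: S_def)
  have GE: "s \<in> ?GE \<longleftrightarrow> s \<in> S \<and> snd s \<inter> T = {}" for s
    by (cases s) (auto simp: general_embeddings_def S_def)
  have nf: "(case flip G W s of (\<rho>, X) \<Rightarrow> h (num_faces G \<rho> X)) = (case s of (\<rho>, X) \<Rightarrow> h (num_faces G \<rho> X))"
    if "s \<in> S" for W s
    using that num_faces_flip[OF G] by (auto simp: S_def split: prod.splits)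
  have "(\<Sum>(\<rho>, X)\<in>S. h (num_faces G \<rho> X))
      = (\<Sum>(W, s)\<in>?P \<times> ?GE. case s of (\<rho>, X) \<Rightarrow> h (num_faces G \<rho> X))"
  proof (rule sum.reindex_bij_witness[of _ "\<lambda>(W, s). flip G W s" "\<lambda>s. (U s, flip G (U s) s)"])
    fix s assume s: "s \<in> S"
    show "(case (U s, flip G (U s) s) of (W, s) \<Rightarrow> flip G W s) = s" using flip2[OF s] by simp
    have "snd (flip G (U s) s) \<inter> T = {}" using U1[of s] unfolding flip_def snd_conv by blast
    then have "flip G (U s) s \<in> ?GE" using GE flip_S[OF s] by blast
    then show "(U s, flip G (U s) s) \<in> ?P \<times> ?GE" using U1[of s] by blast
    show "(case (U s, flip G (U s) s) of (W, s) \<Rightarrow> case s of (\<rho>, X) \<Rightarrow> h (num_faces G \<rho> X))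
      = (case s of (\<rho>, X) \<Rightarrow> h (num_faces G \<rho> X))" using nf[OF s, of "U s"] by simp
  next
    fix p assume "p \<in> ?P \<times> ?GE"
    then obtain W s where p': "p = (W, s)" "W \<in> ?P" "s \<in> ?GE" by blast
    then have p: "p = (W, s)" "W \<in> ?P" "s \<in> S" "snd s \<inter> T = {}"
      using GE by blast+
    have "edge_cut G W \<inter> T = snd (flip G W s) \<inter> T" using p(4) unfolding flip_def snd_conv by blast
    then have "U (flip G W s) = W" by (rule U2[OF p(2)])
    then show "(U (case p of (W, s) \<Rightarrow> flip G W s), flip G (U (case p of (W, s) \<Rightarrow> flip G W s))
        (case p of (W, s) \<Rightarrow> flip G W s)) = p"
      using flip2[OF p(3)] p(1) by simp
    show "(case p of (W, s) \<Rightarrow> flip G W s) \<in> S" using p flip_S by simp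
  qed
  also have "\<dots> = (\<Sum>W\<in>?P. \<Sum>(\<rho>, X)\<in>?GE. h (num_faces G \<rho> X))"
    by (rule sum.cartesian_product[symmetric])
  also have "\<dots> = 2 ^ (card (verts G) - 1) * (\<Sum>(\<rho>, X)\<in>?GE. h (num_faces G \<rho> X))"
    using r by (simp add: card_Pow)
  finally show ?thesis by (simp add: S_def)
qed

section \<open>Non-negativity of the Euler genus\<close>

text \<open>\<open>C\<close> is a union of faces and \<open>B\<close> its boundary modulo 2. That
  cuts and boundaries are orthogonal is seen by counting the sides in \<open>C\<close> at the
  edge-ends at vertices of \<open>W\<close>: disc steps pair them off, and an edge with both ends at
  \<open>W\<close> contributes twice.\<close>

lemma even_cut_boundary:
  fixes G :: "('v, 'e) pre_digraph"
  assumes G: "fin_digraph G" and srs: "signed_rotation_system G \<rho> X"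
    and closed: "\<And>x y. (x, y) \<in> face_steps G \<rho> X \<Longrightarrow> x \<in> C \<longleftrightarrow> y \<in> C"
  defines "B \<equiv> {e \<in> arcs G. (((e, False), True) \<in> C) \<noteq> (((e, False), False) \<in> C)}"
  shows "even (card (edge_cut G W \<inter> B))"
proof -
  interpret fin_digraph G by fact
  note perm = permutes_edge_ends[OF G srs]
  let ?t = "tail (bidirect G)"
  define S where "S = {d \<in> edge_ends G. ?t d \<in> W}"
  have "finite S" unfolding S_def by simp
  define x where "x d \<longleftrightarrow> ((d, True) \<in> C) \<noteq> ((d, False) \<in> C)" for d
  have \<rho>S: "\<rho> d \<in> S \<longleftrightarrow> d \<in> S" for d
    using permutes_in_image[OF perm, of d] tail_rotation[OF wf_digraph_axioms srs, of d]
    by (simp add: S_def)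
  have inv\<rho>S: "inv \<rho> d \<in> S \<longleftrightarrow> d \<in> S" for d
    using \<rho>S[of "inv \<rho> d"] by (simp add: permutes_inverses[OF perm])
  have disc: "(d, True) \<in> C \<longleftrightarrow> (\<rho> d, False) \<in> C" if "d \<in> S" for d
  proof (rule closed)
    show "((d, True), \<rho> d, False) \<in> face_steps G \<rho> X"
      using that unfolding face_steps_def S_def by blast
  qed
  \<comment> \<open>A band carries the two sides of one end to the two sides of the other, so
    \<open>B\<close> can be read off at either end.\<close>
  have band: "x (e, True) \<longleftrightarrow> x (e, False)" if "e \<in> arcs G" for e
  proof -
    have "((e, False), s) \<in> C \<longleftrightarrow> ((e, True), if e \<in> X then s else \<not> s) \<in> C" for s
    proof (rule closed)
      have "(((e, False), s), ((e, \<not> False), if e \<in> X then s else \<not> s)) \<in> face_steps G \<rho> X"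
        using that unfolding face_steps_def by blast
      then show "(((e, False), s), ((e, True), if e \<in> X then s else \<not> s)) \<in> face_steps G \<rho> X"
        by simp
    qed
    from this[of True] this[of False] show ?thesis by (auto simp: x_def split: if_splits)
  qed
  \<comment> \<open>\<open>\<rho>\<close> permutes \<open>S\<close>, and its disc steps match the
    sides named \<open>True\<close> in \<open>C\<close> with those named
    \<open>False\<close>.\<close>
  have "(\<Sum>d\<in>S. of_bool ((d, True) \<in> C) :: nat) = (\<Sum>d\<in>S. of_bool ((d, False) \<in> C))"
    using disc \<rho>S inv\<rho>S
    by (intro sum.reindex_bij_witness[of _ "inv \<rho>" \<rho>]) (simp_all add: permutes_inverses[OF perm])
  then have "even (\<Sum>d\<in>S. of_bool ((d, True) \<in> C) + of_bool ((d, False) \<in> C) :: nat)"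
    by (simp add: sum.distrib)
  also have "(\<Sum>d\<in>S. of_bool ((d, True) \<in> C) + of_bool ((d, False) \<in> C) :: nat)
      = (\<Sum>d\<in>S. of_bool (x d) + 2 * of_bool ((d, True) \<in> C \<and> (d, False) \<in> C))"
    by (rule sum.cong) (auto simp: x_def)
  finally have "even (\<Sum>d\<in>S. of_bool (x d) :: nat)"
    by (simp add: sum.distrib flip: sum_distrib_left)
  also have "(\<Sum>d\<in>S. of_bool (x d) :: nat) = (\<Sum>d\<in>edge_ends G. of_bool (?t d \<in> W \<and> x d))"
    by (rule sum.mono_neutral_cong_left) (auto simp: S_def)
  also have "\<dots> = (\<Sum>e\<in>arcs G. \<Sum>b\<in>UNIV. of_bool (?t (e, b) \<in> W \<and> x (e, b)))"
    unfolding sum.cartesian_product by (rule sum.cong) auto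
  also have "\<dots> = (\<Sum>e\<in>arcs G. of_bool (e \<in> edge_cut G W \<inter> B)
      + 2 * of_bool (tail G e \<in> W \<and> head G e \<in> W \<and> x (e, False)))"
  proof (rule sum.cong[OF refl])
    fix e assume e: "e \<in> arcs G"
    have "e \<in> B \<longleftrightarrow> x (e, False)" using e by (simp add: B_def x_def)
    then show "(\<Sum>b\<in>UNIV. of_bool (?t (e, b) \<in> W \<and> x (e, b)))
      = of_bool (e \<in> edge_cut G W \<inter> B) + (2::nat) * of_bool (tail G e \<in> W \<and> head G e \<in> W \<and> x (e, False))"
      using band[OF e] e by (auto simp: UNIV_bool edge_cut_def)
  qed
  finally have "even (\<Sum>e\<in>arcs G. of_bool (e \<in> edge_cut G W \<inter> B) :: nat)"
    by (simp add: sum.distrib flip: sum_distrib_left)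
  also have "(\<Sum>e\<in>arcs G. of_bool (e \<in> edge_cut G W \<inter> B) :: nat)
      = (\<Sum>e\<in>edge_cut G W \<inter> B. 1)"
    by (rule sum.mono_neutral_cong_right) (auto simp: edge_cut_def)
  finally show ?thesis by simp
qed

text \<open>Without boundary, membership in \<open>C\<close> does not change across a band; discs
  pass it around each vertex, and connectedness of the graph carries it everywhere.\<close>

lemma boundaryless_all_or_none:
  fixes G :: "('v, 'e) pre_digraph"
  assumes G: "fin_digraph G" "connected G" and srs: "signed_rotation_system G \<rho> X"
    and closed: "\<And>x y. (x, y) \<in> face_steps G \<rho> X \<Longrightarrow> x \<in> C \<longleftrightarrow> y \<in> C"
    and both: "\<And>e. e \<in> arcs G \<Longrightarrow> ((e, False), True) \<in> C \<longleftrightarrow> ((e, False), False) \<in> C"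
    and d: "d \<in> edge_ends G" "d' \<in> edge_ends G"
  shows "(d, s) \<in> C \<longleftrightarrow> (d', s') \<in> C"
proof -
  interpret fin_digraph G by fact
  let ?t = "tail (bidirect G)"
  have band: "((e, False), s) \<in> C \<longleftrightarrow> ((e, True), if e \<in> X then s else \<not> s) \<in> C"
    if "e \<in> arcs G" for e s
  proof (rule closed)
    have "(((e, False), s), ((e, \<not> False), if e \<in> X then s else \<not> s)) \<in> face_steps G \<rho> X"
      using that unfolding face_steps_def by blast
    then show "(((e, False), s), ((e, True), if e \<in> X then s else \<not> s)) \<in> face_steps G \<rho> X"
      by simp
  qed
  define q where "q d \<longleftrightarrow> (d, True) \<in> C" for d
  have q: "(d, s) \<in> C \<longleftrightarrow> q d" if d_in: "d \<in> edge_ends G" for d s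
  proof -
    obtain e b where d: "d = (e, b)" by fastforce
    then have "e \<in> arcs G" using d_in by simp
    have f: "((e, False), s') \<in> C \<longleftrightarrow> ((e, False), True) \<in> C" for s'
      using both[OF \<open>e \<in> arcs G\<close>] by (cases s') simp_all
    have t: "((e, True), s') \<in> C \<longleftrightarrow> ((e, False), True) \<in> C" for s'
    proof (cases "e \<in> X")
      case True
      have "((e, False), s') \<in> C \<longleftrightarrow> ((e, True), s') \<in> C"
        using band[OF \<open>e \<in> arcs G\<close>, of s'] unfolding if_P[OF True] .
      then show ?thesis using f[of s'] by blast
    next
      case False
      have "((e, False), \<not> s') \<in> C \<longleftrightarrow> ((e, True), s') \<in> C"
        using band[OF \<open>e \<in> arcs G\<close>, of "\<not> s'"] unfolding if_not_P[OF False] not_not .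
      then show ?thesis using f[of "\<not> s'"] by blast
    qed
    show ?thesis
    proof (cases b)
      case True
      then have "d = (e, True)" using d by simp
      then show ?thesis unfolding q_def using t[of s] t[of True] by blast
    next
      case False
      then have "d = (e, False)" using d by simp
      then show ?thesis unfolding q_def using f[of s] by blast
    qed
  qed
  have opp: "q (e, b) \<longleftrightarrow> q (e, b')" if "e \<in> arcs G" for e b b'
  proof -
    have "(e, False) \<in> edge_ends G" "(e, True) \<in> edge_ends G" using that by simp_all
    then have "q (e, False) \<longleftrightarrow> q (e, True)"
      using band[OF that, of True] q by blast
    then show ?thesis by (cases b; cases b') simp_all
  qed
  have disc: "\<rho> d \<in> edge_ends G" "q d \<longleftrightarrow> q (\<rho> d)" if d: "d \<in> edge_ends G" for d
  proof -
    show \<rho>d: "\<rho> d \<in> edge_ends G"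
      using permutes_in_image[OF permutes_edge_ends[OF G(1) srs]] d by blast
    have "((d, True), \<rho> d, False) \<in> face_steps G \<rho> X"
      using d unfolding face_steps_def by blast
    then have "(d, True) \<in> C \<longleftrightarrow> (\<rho> d, False) \<in> C" by (rule closed)
    then show "q d \<longleftrightarrow> q (\<rho> d)" using q[OF d, of True] q[OF \<rho>d, of False] by blast
  qed
  have star: "q d \<longleftrightarrow> q d'" if dd: "d \<in> edge_ends G" "d' \<in> edge_ends G" "?t d = ?t d'" for d d'
  proof -
    have "?t d \<in> verts G" using dd by (cases d) auto
    moreover have d: "d \<in> edge_ends_at G (?t d)" "d' \<in> edge_ends_at G (?t d)"
      using dd unfolding in_out_arcs_conv by auto
    ultimately have "cyclic_on \<rho> (edge_ends_at G (?t d))"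
      using srs unfolding signed_rotation_system_def by blast
    from orbit_cyclic_eq3[OF this d(1)] have "d' \<in> orbit \<rho> d" using d(2) by (simp only:)
    then have "d' \<in> edge_ends G \<and> (q d \<longleftrightarrow> q d')"
      by (induction rule: orbit.induct) (use disc dd(1) in blast)+
    then show ?thesis ..
  qed
  have "(?t d, ?t d') \<in> eq_closure (links G (arcs G))"
    using G(2) d by (cases d; cases d') (auto simp: connected_iff wf_digraph_axioms)
  then have "\<forall>d''\<in>edge_ends G. ?t d'' = ?t d' \<longrightarrow> (q d \<longleftrightarrow> q d'')"
  proof (induction rule: rtrancl_induct)
    case base
    then show ?case using star[OF d(1)] by metis
  next
    case (step u v)
    then obtain e where e: "e \<in> arcs G"
      "(u, v) = (tail G e, head G e) \<or> (v, u) = (tail G e, head G e)"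
      by (auto simp: links_def)
    then obtain b where b: "?t (e, b) = u" "?t (e, \<not> b) = v"
      using that[of False] that[of True] by auto
    have eb: "(e, b) \<in> edge_ends G" "(e, \<not> b) \<in> edge_ends G" using e by simp_all
    have "q d \<longleftrightarrow> q (e, b)" using step.IH eb(1) b(1) by blast
    also have "\<dots> \<longleftrightarrow> q (e, \<not> b)" using opp e(1) by blast
    finally show ?case using star[OF eb(2)] b(2) by metis
  qed
  then have "q d \<longleftrightarrow> q d'" using d by blast
  then show ?thesis using q d by blast
qed

text \<open>One face left out, a set of faces is determined by the non-tree edges of its boundary
  modulo 2. Hence 2^(F - 1) is at most 2^(|E| - |T|) for F faces, and |V| = |T| + 1.\<close>

lemma euler_inequality:
  fixes G :: "('v, 'e) pre_digraph"
  assumes G: "fin_digraph G" "connected G" and srs: "signed_rotation_system G \<rho> X"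
    and arcs: "arcs G \<noteq> {}"
  shows "card (verts G) + card (faces G \<rho> X) \<le> card (arcs G) + 2"
proof -
  interpret fin_digraph G by fact
  obtain T where T: "is_spanning_tree G T" using spanning_tree_exists[OF G] by blast
  obtain r where r: "r \<in> verts G"
    using T is_spanning_tree_iff[OF wf_digraph_axioms] by blast
  have TA: "T \<subseteq> arcs G" using T by (simp add: is_spanning_tree_def)
  define R where "R = eq_closure (face_steps G \<rho> X)"
  let ?V = "edge_ends G \<times> (UNIV :: bool set)"
  have faces: "faces G \<rho> X = (\<lambda>x. R `` {x}) ` ?V"
    by (simp add: faces_def R_def quotient_conv_image)
  have fin: "finite (faces G \<rho> X)" unfolding faces by simp
  obtain e0 where "e0 \<in> arcs G" using arcs by blast
  define x0 where "x0 = ((e0, False), True)"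
  have x0: "x0 \<in> ?V" using \<open>e0 \<in> arcs G\<close> by (simp add: x0_def)
  let ?F = "faces G \<rho> X - {R `` {x0}}"
  have f0: "R `` {x0} \<in> faces G \<rho> X" unfolding faces using x0 by blast
  have R_eq: "R `` {x} = R `` {y} \<longleftrightarrow> (x, y) \<in> R" for x y
    unfolding R_def by (rule eq_closure_image_eq_iff)
  define bd where "bd \<A> = {e \<in> arcs G - T. (((e, False), True) \<in> \<Union>\<A>) \<noteq> (((e, False), False) \<in> \<Union>\<A>)}"
    for \<A> :: "(('e \<times> bool) \<times> bool) set set"
  have Un: "x \<in> \<Union>\<A> \<longleftrightarrow> R `` {x} \<in> \<A>" if sub: "\<A> \<subseteq> faces G \<rho> X" for \<A> x
  proof
    assume "x \<in> \<Union>\<A>"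
    then obtain f where f: "f \<in> \<A>" "x \<in> f" by blast
    then obtain z where z: "f = R `` {z}" using sub unfolding faces by blast
    then have "R `` {z} = R `` {x}" using f(2) unfolding R_eq by blast
    then show "R `` {x} \<in> \<A>" using f(1) z by simp
  next
    assume "R `` {x} \<in> \<A>"
    moreover have "x \<in> R `` {x}" by (simp add: R_def)
    ultimately show "x \<in> \<Union>\<A>" by blast
  qed
  have "inj_on bd (Pow ?F)"
  proof (rule inj_onI)
    fix \<A> \<B> assume AB: "\<A> \<in> Pow ?F" "\<B> \<in> Pow ?F" and bd: "bd \<A> = bd \<B>"
    define C where "C = sym_diff (\<Union>\<A>) (\<Union>\<B>)"
    have C: "x \<in> C \<longleftrightarrow> (R `` {x} \<in> \<A>) \<noteq> (R `` {x} \<in> \<B>)" for x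
      using Un[of \<A> x] Un[of \<B> x] AB unfolding C_def by blast
    have CR: "x \<in> C \<longleftrightarrow> y \<in> C" if "(x, y) \<in> R" for x y
      using that R_eq C by metis
    have closed: "x \<in> C \<longleftrightarrow> y \<in> C" if "(x, y) \<in> face_steps G \<rho> X" for x y
      using that by (intro CR) (auto simp: R_def)
    define B where "B = {e \<in> arcs G. (((e, False), True) \<in> C) \<noteq> (((e, False), False) \<in> C)}"
    \<comment> \<open>Equal images mean that the two boundaries cancel outside the tree.\<close>
    have "B \<subseteq> T"
    proof
      fix e assume e: "e \<in> B"
      show "e \<in> T"
      proof (rule ccontr)
        assume "e \<notin> T"
        then have "e \<in> bd \<A> \<longleftrightarrow> e \<notin> bd \<B>" using e unfolding B_def bd_def C_def by blast
        then show False using bd by simp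
      qed
    qed
    have "B = {}"
    proof (rule ccontr)
      assume "B \<noteq> {}"
      then obtain e where e: "e \<in> B" "e \<in> T" using \<open>B \<subseteq> T\<close> by blast
      obtain W where "edge_cut G W \<inter> T = {e}"
        using spanning_tree_cut_single[OF wf_digraph_axioms T r e(2)] by blast
      \<comment> \<open>The fundamental cut of \<open>e\<close> would meet the boundary in a single
        edge, an odd number.\<close>
      then have "edge_cut G W \<inter> B = {e}" using e \<open>B \<subseteq> T\<close> by blast
      moreover have "even (card (edge_cut G W \<inter> B))"
        unfolding B_def using closed by (rule even_cut_boundary[OF G(1) srs])
      ultimately show False by simp
    qed
    then have both: "((e, False), True) \<in> C \<longleftrightarrow> ((e, False), False) \<in> C" if "e \<in> arcs G" for e
      using that unfolding B_def by blast
    \<comment> \<open>The face of \<open>x0\<close> belongs to neither set, which leaves "none" of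
      "all or none".\<close>
    have "x0 \<notin> C" using C AB by blast
    have "z \<notin> C" if zV: "z \<in> ?V" for z
    proof -
      obtain d s where z: "z = (d, s)" "d \<in> edge_ends G" using zV by blast
      have "(d, s) \<in> C \<longleftrightarrow> ((e0, False), True) \<in> C"
      proof (rule boundaryless_all_or_none[OF G srs])
        show "x \<in> C \<longleftrightarrow> y \<in> C" if "(x, y) \<in> face_steps G \<rho> X" for x y
          using that by (rule closed)
        show "((e, False), True) \<in> C \<longleftrightarrow> ((e, False), False) \<in> C" if "e \<in> arcs G" for e
          using that by (rule both)
        show "(e0, False) \<in> edge_ends G" using \<open>e0 \<in> arcs G\<close> by simp
      qed (rule z(2))
      then have "z \<in> C \<longleftrightarrow> x0 \<in> C" unfolding z(1) x0_def .
      then show ?thesis using \<open>x0 \<notin> C\<close> by simp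
    qed
    then have same: "R `` {z} \<in> \<A> \<longleftrightarrow> R `` {z} \<in> \<B>" if "z \<in> ?V" for z using C that by blast
    have "f \<in> \<A> \<longleftrightarrow> f \<in> \<B>" if "f \<in> faces G \<rho> X" for f using that same unfolding faces by blast
    then show "\<A> = \<B>" using AB by blast
  qed
  moreover have "bd ` Pow ?F \<subseteq> Pow (arcs G - T)" by (auto simp: bd_def)
  ultimately have "card (Pow ?F) \<le> card (Pow (arcs G - T))"
    by (intro card_inj_on_le) auto
  then have "(2::nat) ^ card ?F \<le> 2 ^ card (arcs G - T)" using fin by (simp add: card_Pow)
  then have "card ?F \<le> card (arcs G - T)" by simp
  moreover have "card ?F = card (faces G \<rho> X) - 1" "card (faces G \<rho> X) > 0"
    using f0 fin by (auto simp: card_gt_0_iff)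
  moreover have "card (arcs G - T) = card (arcs G) - card T" "card T \<le> card (arcs G)"
    using TA by (simp_all add: card_Diff_subset finite_subset card_mono)
  moreover have "card (verts G) = Suc (card T)" by (rule card_spanning_tree[OF G(1) T])
  ultimately show ?thesis by linarith
qed

text \<open>Makes the second summand of \<open>num_faces\<close> vanish.\<close>

lemma no_isolated_vertices:
  assumes "wf_digraph G" "connected G" "arcs G \<noteq> {}"
  shows "{v \<in> verts G. edge_ends_at G v = {}} = {}"
proof -
  have False if v: "v \<in> verts G" "edge_ends_at G v = {}" for v
  proof -
    obtain e where e: "e \<in> arcs G" using assms by blast
    have no: "tail G f \<noteq> v" "head G f \<noteq> v" if "f \<in> arcs G" for f
    proof -
      have "(f, False) \<notin> edge_ends_at G v" "(f, True) \<notin> edge_ends_at G v" using v by blast+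
      then show "tail G f \<noteq> v" "head G f \<noteq> v" using that by auto
    qed
    have "(v, tail G e) \<in> eq_closure (links G (arcs G))"
      using assms e v by (simp add: connected_iff wf_digraph.tail_in_verts)
    moreover have "links G (arcs G) \<subseteq> (- {v}) \<times> (- {v})" using no by (auto simp: links_def)
    ultimately have "tail G e = v" using eq_closure_outside[of _ "- {v}" v "tail G e"] by blast
    then show False using no e by blast
  qed
  then show ?thesis by blast
qed

text \<open>The exponent on the left is the rank of the face graph. With F faces the Euler genus is
  |E| + 2 - |V| - F, so the two differ by |V| + 3|E| - 2; the power of 2 comes from admitting twists
  on the tree. \<open>euler_inequality\<close> makes the natural subtractions genuine.\<close>

lemma euler_genus_poly_sum:
  assumes G: "fin_digraph G" "connected G" and arcs: "arcs G \<noteq> {}"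
  shows "(\<Sum>(\<rho>, X)\<in>{(\<rho>, X). signed_rotation_system G \<rho> X}.
      monom (1::int) (4 * card (arcs G) - card (faces G \<rho> X)))
    = 2 ^ (card (verts G) - 1) * monom 1 (card (verts G) + 3 * card (arcs G) - 2) * euler_genus_poly G"
proof -
  interpret fin_digraph G by fact
  define T where "T = (SOME T. is_spanning_tree G T)"
  have T: "is_spanning_tree G T"
    unfolding T_def using spanning_tree_exists[OF G] by (rule someI_ex)
  let ?V = "card (verts G)" and ?E = "card (arcs G)" and ?GE = "general_embeddings G T"
  have E: "?E > 0" using arcs by (simp add: card_gt_0_iff)
  have V: "?V > 0" using card_spanning_tree[OF G(1) T] by simp
  have nf: "num_faces G \<rho> X = card (faces G \<rho> X)" for \<rho> X
    using no_isolated_vertices[OF wf_digraph_axioms G(2) arcs] by (simp add: num_faces_def)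
  have le: "?V + card (faces G \<rho> X) \<le> ?E + 2" if "(\<rho>, X) \<in> ?GE" for \<rho> X
    using euler_inequality[OF G _ arcs] that by (simp add: general_embeddings_def)
  have poly: "euler_genus_poly G = (\<Sum>(\<rho>, X)\<in>?GE. monom 1 (?E + 2 - ?V - card (faces G \<rho> X)))"
  proof (rule poly_eqI)
    fix j
    have "coeff (\<Sum>(\<rho>, X)\<in>?GE. monom 1 (?E + 2 - ?V - card (faces G \<rho> X))) j
      = (\<Sum>s\<in>?GE. if (case s of (\<rho>, X) \<Rightarrow> euler_genus G \<rho> X = int j) then 1 else (0::int))"
      unfolding coeff_sum
    proof (rule sum.cong[OF refl])
      fix s assume "s \<in> ?GE"
      then obtain \<rho> X where s: "s = (\<rho>, X)" "(\<rho>, X) \<in> ?GE" by (cases s) auto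
      have "?E + 2 - ?V - card (faces G \<rho> X) = j \<longleftrightarrow> euler_genus G \<rho> X = int j"
        using le[OF s(2)] unfolding euler_genus_def nf by linarith
      then show "coeff (case s of (\<rho>, X) \<Rightarrow> monom 1 (?E + 2 - ?V - card (faces G \<rho> X))) j
        = (if (case s of (\<rho>, X) \<Rightarrow> euler_genus G \<rho> X = int j) then 1 else (0::int))"
        by (simp add: s(1))
    qed
    also have "\<dots> = int (card {s \<in> ?GE. case s of (\<rho>, X) \<Rightarrow> euler_genus G \<rho> X = int j})"
      by (simp add: finite_general_embeddings sum.If_cases Int_def)
    also have "{s \<in> ?GE. case s of (\<rho>, X) \<Rightarrow> euler_genus G \<rho> X = int j}
      = {(\<rho>, X) \<in> ?GE. euler_genus G \<rho> X = int j}" by auto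
    finally show "coeff (euler_genus_poly G) j
      = coeff (\<Sum>(\<rho>, X)\<in>?GE. monom 1 (?E + 2 - ?V - card (faces G \<rho> X))) j"
      by (simp add: coeff_euler_genus_poly euler_genus_count_def T_def)
  qed
  have "(\<Sum>(\<rho>, X)\<in>{(\<rho>, X). signed_rotation_system G \<rho> X}. monom (1::int) (4 * ?E - card (faces G \<rho> X)))
    = 2 ^ (?V - 1) * (\<Sum>(\<rho>, X)\<in>?GE. monom 1 (4 * ?E - card (faces G \<rho> X)))"
    using sum_signed_rotation_systems[OF G(1) T, of "\<lambda>k. monom (1::int) (4 * ?E - k)"]
    by (simp add: nf)
  also have "(\<Sum>(\<rho>, X)\<in>?GE. monom (1::int) (4 * ?E - card (faces G \<rho> X)))
    = monom 1 (?V + 3 * ?E - 2) * euler_genus_poly G"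
    unfolding poly sum_distrib_left
  proof (rule sum.cong[OF refl])
    fix s assume "s \<in> ?GE"
    then obtain \<rho> X where s: "s = (\<rho>, X)" "(\<rho>, X) \<in> ?GE" by (cases s) auto
    have "4 * ?E - card (faces G \<rho> X) = ?V + 3 * ?E - 2 + (?E + 2 - ?V - card (faces G \<rho> X))"
      using le[OF s(2)] E V by linarith
    then show "(case s of (\<rho>, X) \<Rightarrow> monom (1::int) (4 * ?E - card (faces G \<rho> X)))
      = monom 1 (?V + 3 * ?E - 2) * (case s of (\<rho>, X) \<Rightarrow> monom 1 (?E + 2 - ?V - card (faces G \<rho> X)))"
      by (simp add: s(1) mult_monom)
  qed
  finally show ?thesis by (simp add: mult.assoc)
qed

section \<open>Linear and circular families\<close>

lemma self_amalgamation_simps: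
  "verts (self_amalgamation G U \<psi>) = (\<lambda>v. if v \<in> U then \<psi> v else v) ` verts G"
  "arcs (self_amalgamation G U \<psi>) = arcs G"
  "tail (self_amalgamation G U \<psi>) e = (if tail G e \<in> U then \<psi> (tail G e) else tail G e)"
  "head (self_amalgamation G U \<psi>) e = (if head G e \<in> U then \<psi> (head G e) else head G e)"
  by (simp_all add: self_amalgamation_def Let_def)

lemma disjoint_union_simps:
  "verts (disjoint_union G K) = verts G \<union> verts K"
  "arcs (disjoint_union G K) = arcs G \<union> arcs K"
  "tail (disjoint_union G K) e = (if e \<in> arcs G then tail G e else tail K e)"
  "head (disjoint_union G K) e = (if e \<in> arcs G then head G e else head K e)"
  by (simp_all add: disjoint_union_def)

lemma graph_copy_simps:
  "verts (graph_copy i H) = Pair i ` verts H"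
  "arcs (graph_copy i H) = Pair i ` arcs H"
  "tail (graph_copy i H) (j, e) = (j, tail H e)"
  "head (graph_copy i H) (j, e) = (j, head H e)"
  by (simp_all add: graph_copy_def)

locale gluing_graph =
  fixes H :: "('v, 'e) pre_digraph" and U1 U2 :: "'v set" and \<phi> :: "'v \<Rightarrow> 'v"
  assumes fin_H: "fin_digraph H" and connected_H: "connected H" and gluing_H: "gluing H U1 U2 \<phi>"
begin

sublocale H: fin_digraph H by (rule fin_H)

lemma U: "U1 \<subseteq> verts H" "U2 \<subseteq> verts H" "U1 \<noteq> {}" "U1 \<inter> U2 = {}" "inj_on \<phi> U1" "\<phi> ` U1 = U2"
  using gluing_H by (auto simp: gluing_def bij_betw_def)

lemma \<phi>_in: "u \<in> U1 \<Longrightarrow> \<phi> u \<in> U2" "u \<in> U1 \<Longrightarrow> \<phi> u \<in> verts H" "u \<in> U1 \<Longrightarrow> \<phi> u \<notin> U1"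
  using U by blast+

text \<open>The successor is cyclic in both families. In the linear one \<open>succ_copy n n\<close>
  renames no vertex; it only says from which copy slot \<open>n\<close> takes its edge-ends at
  \<open>U2\<close>.\<close>

definition succ_copy :: "nat \<Rightarrow> nat \<Rightarrow> nat" where
  "succ_copy n i = (if i < n then Suc i else 1)"

text \<open>The name that vertex \<open>u\<close> of copy \<open>i\<close> bears after all gluings.
  One replacement is final because \<open>\<phi> u\<close> never lies in \<open>U1\<close>.\<close>

definition vmap :: "bool \<Rightarrow> nat \<Rightarrow> nat \<times> 'v \<Rightarrow> nat \<times> 'v" where
  "vmap c n = (\<lambda>(i, u). if u \<in> U1 \<and> (i < n \<or> c) then (succ_copy n i, \<phi> u) else (i, u))"

text \<open>The flag \<open>c\<close> says whether the last copy is glued to the first one.\<close>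

definition chain_graph :: "bool \<Rightarrow> nat \<Rightarrow> (nat \<times> 'v, nat \<times> 'e) pre_digraph \<Rightarrow> bool" where
  "chain_graph c n G \<longleftrightarrow>
     verts G = vmap c n ` ({1..n} \<times> verts H) \<and> arcs G = {1..n} \<times> arcs H \<and>
     (\<forall>i\<in>{1..n}. \<forall>e\<in>arcs H.
        tail G (i, e) = vmap c n (i, tail H e) \<and> head G (i, e) = vmap c n (i, head H e))"

lemma chain_graph_linear: "chain_graph False (Suc k) (linear_family H U1 \<phi> (Suc k))"
proof (induction k)
  case 0
  then show ?case
    by (auto simp: chain_graph_def graph_copy_def vmap_def image_iff)
next
  case (Suc k)
  let ?n = "Suc k"
  let ?G = "linear_family H U1 \<phi> ?n"
  define r where "r = (\<lambda>v. if v \<in> {?n} \<times> U1 then (\<lambda>(i, u). (Suc i, \<phi> u)) v else v)"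
  have G: "linear_family H U1 \<phi> (Suc ?n)
      = self_amalgamation (disjoint_union ?G (graph_copy (Suc ?n) H)) ({?n} \<times> U1) (\<lambda>(i, u). (Suc i, \<phi> u))"
    by (simp add: vertex_amalgamation_def)
  have IH: "verts ?G = vmap False ?n ` ({1..?n} \<times> verts H)" "arcs ?G = {1..?n} \<times> arcs H"
    "\<And>i e. i \<in> {1..?n} \<Longrightarrow> e \<in> arcs H \<Longrightarrow>
      tail ?G (i, e) = vmap False ?n (i, tail H e) \<and> head ?G (i, e) = vmap False ?n (i, head H e)"
    using Suc unfolding chain_graph_def by blast+
  \<comment> \<open>The new gluing affects only \<open>U1\<close> in copy \<open>?n\<close>;
    vertices renamed into this copy earlier lie in \<open>U2\<close> and stay.\<close>
  have old: "r (vmap False ?n (i, u)) = vmap False (Suc ?n) (i, u)" if "i \<in> {1..?n}" for i u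
    using that \<phi>_in(3) by (auto simp: r_def vmap_def succ_copy_def)
  have new: "r (Suc ?n, u) = vmap False (Suc ?n) (Suc ?n, u)" for u
    by (simp add: r_def vmap_def)
  have split: "{1..Suc ?n} = insert (Suc ?n) {1..?n}" by auto
  have "verts (linear_family H U1 \<phi> (Suc ?n)) = r ` (verts ?G \<union> Pair (Suc ?n) ` verts H)"
    unfolding G self_amalgamation_simps disjoint_union_simps graph_copy_simps r_def ..
  also have "\<dots> = vmap False (Suc ?n) ` ({1..Suc ?n} \<times> verts H)"
  proof -
    have "r ` vmap False ?n ` ({1..?n} \<times> verts H) = vmap False (Suc ?n) ` ({1..?n} \<times> verts H)"
      unfolding image_image by (rule image_cong[OF refl]) (use old in auto)
    moreover have "r ` Pair (Suc ?n) ` verts H = vmap False (Suc ?n) ` ({Suc ?n} \<times> verts H)"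
      using new by (force simp: image_iff)
    moreover have "{1..Suc ?n} \<times> verts H = {1..?n} \<times> verts H \<union> {Suc ?n} \<times> verts H" by auto
    ultimately show ?thesis unfolding IH(1) by (simp only: image_Un)
  qed
  finally have 1: "verts (linear_family H U1 \<phi> (Suc ?n)) = vmap False (Suc ?n) ` ({1..Suc ?n} \<times> verts H)" .
  have 2: "arcs (linear_family H U1 \<phi> (Suc ?n)) = {1..Suc ?n} \<times> arcs H"
  proof -
    have "{1..Suc ?n} \<times> arcs H = {1..?n} \<times> arcs H \<union> Pair (Suc ?n) ` arcs H"
      unfolding split by blast
    then show ?thesis
      unfolding G self_amalgamation_simps disjoint_union_simps graph_copy_simps IH(2) by (rule sym)
  qed
  have tl: "tail (linear_family H U1 \<phi> (Suc ?n)) (i, e)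
      = r (if i \<in> {1..?n} then tail ?G (i, e) else (i, tail H e))"
    "head (linear_family H U1 \<phi> (Suc ?n)) (i, e)
      = r (if i \<in> {1..?n} then head ?G (i, e) else (i, head H e))" if "e \<in> arcs H" for i e
    using that unfolding G self_amalgamation_simps disjoint_union_simps graph_copy_simps IH(2) r_def
    by simp_all
  have 3: "tail (linear_family H U1 \<phi> (Suc ?n)) (i, e) = vmap False (Suc ?n) (i, tail H e)"
      "head (linear_family H U1 \<phi> (Suc ?n)) (i, e) = vmap False (Suc ?n) (i, head H e)"
    if "i \<in> {1..Suc ?n}" "e \<in> arcs H" for i e
    using that tl[OF that(2), of i] IH(3)[of i e] old new unfolding split by auto
  show ?case unfolding chain_graph_def using 1 2 3 by blast
qed

lemma chain_graph_circular: "chain_graph True (Suc k) (circular_family H U1 \<phi> (Suc k))"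
proof -
  let ?n = "Suc k"
  let ?G = "linear_family H U1 \<phi> ?n"
  define r where "r = (\<lambda>v. if v \<in> {?n} \<times> U1 then (\<lambda>(i, u). (1::nat, \<phi> u)) v else v)"
  have G: "verts ?G = vmap False ?n ` ({1..?n} \<times> verts H)" "arcs ?G = {1..?n} \<times> arcs H"
    "\<And>i e. i \<in> {1..?n} \<Longrightarrow> e \<in> arcs H \<Longrightarrow>
      tail ?G (i, e) = vmap False ?n (i, tail H e) \<and> head ?G (i, e) = vmap False ?n (i, head H e)"
    using chain_graph_linear unfolding chain_graph_def by blast+
  have rv: "r (vmap False ?n (i, u)) = vmap True ?n (i, u)" if "i \<in> {1..?n}" for i u
    using that \<phi>_in(3) by (auto simp: r_def vmap_def succ_copy_def)
  have "verts (circular_family H U1 \<phi> ?n) = r ` verts ?G" "arcs (circular_family H U1 \<phi> ?n) = arcs ?G"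
    "tail (circular_family H U1 \<phi> ?n) x = r (tail ?G x)" "head (circular_family H U1 \<phi> ?n) x = r (head ?G x)" for x
    by (simp_all add: circular_family_def self_amalgamation_simps r_def)
  moreover have "r ` verts ?G = vmap True ?n ` ({1..?n} \<times> verts H)"
    unfolding G(1) image_image by (rule image_cong[OF refl]) (use rv in auto)
  ultimately show ?thesis
    unfolding chain_graph_def using G(2,3) rv by simp
qed

section \<open>Size and connectedness of chains\<close>

context
  fixes c :: bool and n :: nat and G :: "(nat \<times> 'v, nat \<times> 'e) pre_digraph"
  assumes n: "n \<ge> 1" and G: "chain_graph c n G"
begin

lemma chain_arcs: "arcs G = {1..n} \<times> arcs H"
  and chain_tail: "\<And>i e. i \<in> {1..n} \<Longrightarrow> e \<in> arcs H \<Longrightarrow> tail G (i, e) = vmap c n (i, tail H e)"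
  and chain_head: "\<And>i e. i \<in> {1..n} \<Longrightarrow> e \<in> arcs H \<Longrightarrow> head G (i, e) = vmap c n (i, head H e)"
  and chain_verts_image: "verts G = vmap c n ` ({1..n} \<times> verts H)"
  using G by (auto simp: chain_graph_def)

lemma fin_digraph_chain: "fin_digraph G"
proof
  show "finite (verts G)" "finite (arcs G)" by (simp_all add: chain_verts_image chain_arcs)
next
  fix e assume "e \<in> arcs G"
  then obtain i f where e: "e = (i, f)" "i \<in> {1..n}" "f \<in> arcs H" by (auto simp: chain_arcs)
  then show "tail G e \<in> verts G" "head G e \<in> verts G"
    unfolding e(1) chain_tail[OF e(2,3)] chain_head[OF e(2,3)] chain_verts_image by auto
qed

lemma chain_verts: "verts G = {1..n} \<times> (verts H - U1) \<union> (if c then {} else {n} \<times> U1)"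
proof (intro equalityI subsetI)
  fix x assume "x \<in> verts G"
  then obtain i u where x: "x = vmap c n (i, u)" "i \<in> {1..n}" "u \<in> verts H"
    by (auto simp: chain_verts_image)
  then show "x \<in> {1..n} \<times> (verts H - U1) \<union> (if c then {} else {n} \<times> U1)"
    using n \<phi>_in by (auto simp: vmap_def succ_copy_def)
next
  fix x assume x: "x \<in> {1..n} \<times> (verts H - U1) \<union> (if c then {} else {n} \<times> U1)"
  then have "x = vmap c n x" by (auto simp: vmap_def split: if_splits)
  moreover have "x \<in> {1..n} \<times> verts H" using x n U by (auto split: if_splits)
  ultimately show "x \<in> verts G" unfolding chain_verts_image by (rule image_eqI)
qed

text \<open>Affine growth in \<open>n\<close> is what makes the factors of
  \<open>euler_genus_poly_sum\<close> geometric.\<close>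

lemma card_chain_verts:
  "card (verts G) = n * (card (verts H) - card U1) + (if c then 0 else card U1)"
proof -
  have fin: "finite U1" using U(1) H.finite_verts by (rule finite_subset)
  have "card ({1..n} \<times> (verts H - U1)) = n * (card (verts H) - card U1)"
    using U fin by (simp add: card_cartesian_product card_Diff_subset)
  moreover have "({1..n} \<times> (verts H - U1)) \<inter> ({n} \<times> U1) = {}" by auto
  ultimately show ?thesis
    unfolding chain_verts using fin by (simp add: card_Un_disjoint card_cartesian_product)
qed

lemma connected_chain: "connected G"
proof -
  interpret G: fin_digraph G by (rule fin_digraph_chain)
  let ?R = "eq_closure (links G (arcs G))"
  have copy: "(vmap c n (i, u), vmap c n (i, v)) \<in> ?R"
    if i: "i \<in> {1..n}" and uv: "u \<in> verts H" "v \<in> verts H" for i u v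
  proof -
    have "(u, v) \<in> eq_closure (links H (arcs H))"
      using connected_H uv by (simp add: connected_iff H.wf_digraph_axioms)
    then show ?thesis
    proof (induction rule: rtrancl_induct)
      case (step v w)
      then obtain e where e: "e \<in> arcs H" "(v, w) = (tail H e, head H e) \<or> (w, v) = (tail H e, head H e)"
        by (auto simp: links_def)
      have "(vmap c n (i, tail H e), vmap c n (i, head H e)) \<in> ?R"
        using links_in_closure[of "(i, e)" "arcs G" G] e i
        by (simp add: chain_arcs chain_tail chain_head)
      then have "(vmap c n (i, v), vmap c n (i, w)) \<in> ?R" using e(2) eq_closure_sym by auto
      then show ?case using step.IH by (rule rtrancl_trans[rotated])
    qed simp
  qed
  obtain u0 where u0: "u0 \<in> U1" using U(3) by blast
  have to_first: "(vmap c n (1, u0), vmap c n (i, u)) \<in> ?R" if "i \<in> {1..n}" "u \<in> verts H" for i u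
    using that
  proof (induction i arbitrary: u)
    case (Suc i)
    show ?case
    proof (cases "i = 0")
      case True
      then show ?thesis using copy[of 1 u0 u] u0 U Suc.prems by auto
    next
      case False
      then have "(vmap c n (1, u0), vmap c n (i, u0)) \<in> ?R"
        using Suc u0 U by auto
      moreover have "vmap c n (i, u0) = vmap c n (Suc i, \<phi> u0)"
        using Suc.prems u0 \<phi>_in by (simp add: vmap_def succ_copy_def)
      moreover have "(vmap c n (Suc i, \<phi> u0), vmap c n (Suc i, u)) \<in> ?R"
        using copy Suc.prems u0 \<phi>_in by blast
      ultimately show ?thesis using rtrancl_trans[of "vmap c n (1, u0)" "vmap c n (i, u0)"] by simp
    qed
  qed simp
  have "(x, y) \<in> ?R" if xy: "x \<in> verts G" "y \<in> verts G" for x y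
  proof -
    obtain i u j v where "x = vmap c n (i, u)" "i \<in> {1..n}" "u \<in> verts H"
      "y = vmap c n (j, v)" "j \<in> {1..n}" "v \<in> verts H"
      using xy unfolding chain_verts_image by blast
    then have "(vmap c n (1, u0), x) \<in> ?R" "(vmap c n (1, u0), y) \<in> ?R"
      using to_first by simp_all
    then show ?thesis by (rule rtrancl_trans[OF eq_closure_sym])
  qed
  moreover have "verts G \<noteq> {}"
    using n u0 U by (auto simp: chain_verts_image)
  ultimately show ?thesis by (simp add: connected_iff G.wf_digraph_axioms)
qed

end

text \<open>A vertex of \<open>U1\<close> and its image are distinct and have to be joined.\<close>

lemma arcs_H_nonempty: "arcs H \<noteq> {}"
proof
  assume "arcs H = {}"
  obtain u where u: "u \<in> U1" using U(3) by blast
  have "(u, \<phi> u) \<in> eq_closure (links H (arcs H))"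
    using connected_H u U(1) \<phi>_in(2) by (auto simp: connected_iff H.wf_digraph_axioms)
  then show False using \<open>arcs H = {}\<close> u \<phi>_in(3)[OF u] by (simp add: links_def)
qed

lemma card_U1_less: "card U1 < card (verts H)"
proof (rule psubset_card_mono[OF H.finite_verts])
  show "U1 \<subset> verts H" using U \<phi>_in by blast
qed

end

section \<open>Rotation systems as words\<close>

text \<open>Vertices enter only as fibres of \<open>t\<close>, so labellings with the same fibres
  have the same rotations. This allows a chain to be compared with its slots, where vertices bear
  other names.\<close>

definition rotations :: "'d set \<Rightarrow> ('d \<Rightarrow> 'w) \<Rightarrow> ('d \<Rightarrow> 'd) set" where
  "rotations D t = {\<rho>. \<rho> permutes D \<and> (\<forall>d\<in>D. cyclic_on \<rho> {d' \<in> D. t d' = t d})}"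

lemma rotations_step:
  assumes "\<rho> \<in> rotations D t" "d \<in> D"
  shows "\<rho> d \<in> D" "t (\<rho> d) = t d"
proof -
  have "cyclic_on \<rho> {d' \<in> D. t d' = t d}" using assms by (simp add: rotations_def)
  moreover have "d \<in> {d' \<in> D. t d' = t d}" using assms by simp
  ultimately have "\<rho> d \<in> {d' \<in> D. t d' = t d}" by (rule cyclic_on_inI)
  then show "\<rho> d \<in> D" "t (\<rho> d) = t d" by simp_all
qed

lemma signed_rotation_system_iff:
  assumes "wf_digraph G"
  shows "signed_rotation_system G \<rho> X \<longleftrightarrow>
    \<rho> \<in> rotations (edge_ends G) (tail (bidirect G)) \<and> X \<subseteq> arcs G"
proof -
  let ?t = "tail (bidirect G)"
  have star: "edge_ends_at G v = {d' \<in> edge_ends G. ?t d' = v}" for v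
    by (auto simp: out_arcs_def)
  have t: "?t d \<in> verts G" if "d \<in> edge_ends G" for d
    using that assms by (cases d) (auto simp: wf_digraph_def)
  have "(\<forall>v\<in>verts G. edge_ends_at G v \<noteq> {} \<longrightarrow> cyclic_on \<rho> (edge_ends_at G v))
    \<longleftrightarrow> (\<forall>d\<in>edge_ends G. cyclic_on \<rho> {d' \<in> edge_ends G. ?t d' = ?t d})"
  proof (intro iffI ballI impI)
    fix d assume "\<forall>v\<in>verts G. edge_ends_at G v \<noteq> {} \<longrightarrow> cyclic_on \<rho> (edge_ends_at G v)"
      and d: "d \<in> edge_ends G"
    then have "edge_ends_at G (?t d) \<noteq> {} \<longrightarrow> cyclic_on \<rho> (edge_ends_at G (?t d))"
      using t[OF d] by blast
    moreover have "d \<in> edge_ends_at G (?t d)" using d unfolding star by blast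
    ultimately show "cyclic_on \<rho> {d' \<in> edge_ends G. ?t d' = ?t d}" unfolding star by blast
  next
    fix v assume *: "\<forall>d\<in>edge_ends G. cyclic_on \<rho> {d' \<in> edge_ends G. ?t d' = ?t d}"
      and "edge_ends_at G v \<noteq> {}"
    then obtain d where "d \<in> edge_ends G" "?t d = v" unfolding star by blast
    then show "cyclic_on \<rho> (edge_ends_at G v)" using * unfolding star by blast
  qed
  then show ?thesis unfolding signed_rotation_system_def rotations_def by blast
qed

definition glue_rotations ::
  "'b set \<Rightarrow> ('b \<Rightarrow> 'i \<times> 'd) \<Rightarrow> ('i \<times> 'd \<Rightarrow> 'b) \<Rightarrow> ('i \<Rightarrow> 'd \<Rightarrow> 'd) \<Rightarrow> 'b \<Rightarrow> 'b" where
  "glue_rotations B \<gamma> \<beta> p x = (if x \<in> B then \<beta> (fst (\<gamma> x), p (fst (\<gamma> x)) (snd (\<gamma> x))) else x)"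

text \<open>\<open>\<beta>\<close> places edge-end \<open>d\<close> of slot \<open>i\<close> in the
  chain and \<open>\<gamma>\<close> reads it back. By \<open>kernel\<close>, each fibre of
  \<open>t\<close> in \<open>B\<close> comes from a single slot \<open>i\<close> and is there a
  fibre of \<open>\<tau> i\<close>.\<close>

locale partitioned_darts =
  fixes I :: "'i set" and D :: "'d set" and B :: "'b set" and \<beta> :: "'i \<times> 'd \<Rightarrow> 'b"
    and \<gamma> :: "'b \<Rightarrow> 'i \<times> 'd" and \<tau> :: "'i \<Rightarrow> 'd \<Rightarrow> 'w" and t :: "'b \<Rightarrow> 'w2"
  assumes fin: "finite I" "finite D"
    and B: "B = \<beta> ` (I \<times> D)"
    and \<gamma>\<beta>: "\<And>i d. i \<in> I \<Longrightarrow> d \<in> D \<Longrightarrow> \<gamma> (\<beta> (i, d)) = (i, d)"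
    and kernel: "\<And>i d i' d'. i \<in> I \<Longrightarrow> d \<in> D \<Longrightarrow> i' \<in> I \<Longrightarrow> d' \<in> D \<Longrightarrow>
      t (\<beta> (i, d)) = t (\<beta> (i', d')) \<longleftrightarrow> i = i' \<and> \<tau> i d = \<tau> i d'"
begin

abbreviation "glue \<equiv> glue_rotations B \<gamma> \<beta>"

lemma glue_\<beta>: "i \<in> I \<Longrightarrow> d \<in> D \<Longrightarrow> glue p (\<beta> (i, d)) = \<beta> (i, p i d)"
  by (auto simp: glue_rotations_def \<gamma>\<beta> B)

lemma star_\<beta>:
  "i \<in> I \<Longrightarrow> d \<in> D \<Longrightarrow> {x \<in> B. t x = t (\<beta> (i, d))} = (\<lambda>d'. \<beta> (i, d')) ` {d' \<in> D. \<tau> i d' = \<tau> i d}"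
  unfolding B using kernel by auto

lemma permutes_if_inj:
  assumes "finite S" "inj_on f S" "f ` S \<subseteq> S" "\<And>x. x \<notin> S \<Longrightarrow> f x = x"
  shows "f permutes S"
  using assms endo_inj_surj[OF assms(1,3,2)] by (intro bij_imp_permutes) (auto simp: bij_betw_def)

lemma glue_in_rotations:
  assumes p: "\<And>i. i \<in> I \<Longrightarrow> p i \<in> rotations D (\<tau> i)"
  shows "glue p \<in> rotations B t"
proof -
  have "glue p permutes B"
  proof (rule permutes_if_inj)
    show "finite B" unfolding B using fin by simp
    show "inj_on (glue p) B"
    proof (rule inj_onI)
      fix x y assume xy: "x \<in> B" "y \<in> B" "glue p x = glue p y"
      then obtain i d i' d' where *: "x = \<beta> (i, d)" "i \<in> I" "d \<in> D" "y = \<beta> (i', d')" "i' \<in> I" "d' \<in> D"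
        unfolding B by blast
      have "\<beta> (i, p i d) = \<beta> (i', p i' d')" using xy * by (simp add: glue_\<beta>)
      then have "\<gamma> (\<beta> (i, p i d)) = \<gamma> (\<beta> (i', p i' d'))" by simp
      moreover have "\<gamma> (\<beta> (i, p i d)) = (i, p i d)" "\<gamma> (\<beta> (i', p i' d')) = (i', p i' d')"
        using * rotations_step(1)[OF p] by (simp_all add: \<gamma>\<beta>)
      ultimately have pair: "i = i' \<and> p i d = p i' d'" by (metis prod.inject)
      then have i: "i = i'" by blast
      have "p i d = p i d'" using pair unfolding i by blast
      note eq = i this
      have "inj (p i)" using p[OF *(2)] by (auto simp: rotations_def permutes_inj)
      then show "x = y" using eq * by (simp add: inj_eq)
    qed
    show "glue p ` B \<subseteq> B"
    proof (rule image_subsetI)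
      fix x assume "x \<in> B"
      then obtain i d where x: "x = \<beta> (i, d)" "i \<in> I" "d \<in> D" unfolding B by blast
      then have "p i d \<in> D" using rotations_step(1)[OF p] by blast
      then show "glue p x \<in> B" unfolding x(1) glue_\<beta>[OF x(2,3)] unfolding B using x(2) by blast
    qed
    show "glue p x = x" if "x \<notin> B" for x using that by (simp add: glue_rotations_def)
  qed
  moreover have "cyclic_on (glue p) {x' \<in> B. t x' = t x}" if xB: "x \<in> B" for x
  proof -
    obtain i d where x: "x = \<beta> (i, d)" "i \<in> I" "d \<in> D" using xB unfolding B by blast
    have cyc: "cyclic_on (p i) {d' \<in> D. \<tau> i d' = \<tau> i d}"
      using p x by (simp add: rotations_def)
    show ?thesis unfolding x(1) star_\<beta>[OF x(2,3)]
      by (rule cyclic_on_image[OF cyc]) (simp add: glue_\<beta> x(2))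
  qed
  ultimately show ?thesis by (simp add: rotations_def)
qed

text \<open>A rotation preserves \<open>t\<close>, hence the slots by \<open>kernel\<close>, so it
  can be read slot by slot. Off \<open>D\<close> the pieces are completed by the identity to be
  permutations of \<open>D\<close>.\<close>

lemma glue_surj:
  assumes \<rho>: "\<rho> \<in> rotations B t"
  obtains p where "\<And>i. i \<in> I \<Longrightarrow> p i \<in> rotations D (\<tau> i)" and "glue p = \<rho>"
proof -
  define p where "p i d = (if d \<in> D then snd (\<gamma> (\<rho> (\<beta> (i, d)))) else d)" for i d
  have p: "\<rho> (\<beta> (i, d)) = \<beta> (i, p i d)" "p i d \<in> D" "\<tau> i (p i d) = \<tau> i d" if id: "i \<in> I" "d \<in> D" for i d
  proof -
    have "\<beta> (i, d) \<in> B" using id unfolding B by blast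
    from rotations_step[OF \<rho> this]
    obtain i' d' where *: "\<rho> (\<beta> (i, d)) = \<beta> (i', d')" "i' \<in> I" "d' \<in> D" "t (\<beta> (i', d')) = t (\<beta> (i, d))"
      unfolding B by auto
    then have "i' = i" "\<tau> i d' = \<tau> i d" using kernel id by metis+
    moreover have "p i d = d'" using * id by (simp add: p_def \<gamma>\<beta>)
    ultimately show "\<rho> (\<beta> (i, d)) = \<beta> (i, p i d)" "p i d \<in> D" "\<tau> i (p i d) = \<tau> i d"
      using * by simp_all
  qed
  have inj: "inj \<rho>" using \<rho> by (auto simp: rotations_def permutes_inj)
  have "p i \<in> rotations D (\<tau> i)" if i: "i \<in> I" for i
  proof -
    have "p i permutes D"
    proof (rule permutes_if_inj[OF fin(2)])
      show "inj_on (p i) D"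
      proof (rule inj_onI)
        fix d d' assume d: "d \<in> D" "d' \<in> D" "p i d = p i d'"
        then have "\<rho> (\<beta> (i, d)) = \<rho> (\<beta> (i, d'))" using p i by simp
        then have "\<beta> (i, d) = \<beta> (i, d')" using inj by (simp add: inj_eq)
        then have "(i, d) = (i, d')" using \<gamma>\<beta>[OF i d(1)] \<gamma>\<beta>[OF i d(2)] by metis
        then show "d = d'" by blast
      qed
      show "p i ` D \<subseteq> D" using p i by auto
    qed (simp add: p_def)
    moreover have "cyclic_on (p i) {d' \<in> D. \<tau> i d' = \<tau> i d}" if d: "d \<in> D" for d
    proof -
      have "\<beta> (i, d) \<in> B" using i d unfolding B by blast
      then have cyc: "cyclic_on \<rho> {x \<in> B. t x = t (\<beta> (i, d))}" using \<rho> by (simp add: rotations_def)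
      have "cyclic_on (p i) ((\<lambda>x. snd (\<gamma> x)) ` {x \<in> B. t x = t (\<beta> (i, d))})"
      proof (rule cyclic_on_image[OF cyc])
        fix x assume "x \<in> {x \<in> B. t x = t (\<beta> (i, d))}"
        then obtain d' where d': "x = \<beta> (i, d')" "d' \<in> D" unfolding star_\<beta>[OF i d] by blast
        then show "p i (snd (\<gamma> x)) = snd (\<gamma> (\<rho> x))" using p(1,2)[OF i d'(2)] i by (simp add: \<gamma>\<beta>)
      qed
      moreover have "(\<lambda>x. snd (\<gamma> x)) ` {x \<in> B. t x = t (\<beta> (i, d))} = {d' \<in> D. \<tau> i d' = \<tau> i d}"
      proof -
        have "(\<lambda>d'. snd (\<gamma> (\<beta> (i, d')))) ` {d' \<in> D. \<tau> i d' = \<tau> i d}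
          = (\<lambda>d'. d') ` {d' \<in> D. \<tau> i d' = \<tau> i d}"
          by (rule image_cong) (simp_all add: \<gamma>\<beta> i)
        then show ?thesis unfolding star_\<beta>[OF i d] image_image by simp
      qed
      ultimately show ?thesis by simp
    qed
    ultimately show ?thesis by (simp add: rotations_def)
  qed
  moreover have "glue p = \<rho>"
  proof
    fix x
    show "glue p x = \<rho> x"
    proof (cases "x \<in> B")
      case True
      then obtain i d where x: "x = \<beta> (i, d)" "i \<in> I" "d \<in> D" unfolding B by blast
      show ?thesis unfolding x(1) glue_\<beta>[OF x(2,3)] p(1)[OF x(2,3)] ..
    next
      case False
      moreover have "\<rho> permutes B" using \<rho> by (simp add: rotations_def)
      ultimately have "\<rho> x = x" by (metis permutes_not_in)
      then show ?thesis using False by (simp add: glue_rotations_def)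
    qed
  qed
  ultimately show thesis by (rule that)
qed

lemma glue_inj:
  assumes "p i \<in> rotations D (\<tau> i)" "p' i \<in> rotations D (\<tau> i)" "glue p = glue p'" "i \<in> I"
  shows "p i = p' i"
proof
  fix d
  show "p i d = p' i d"
  proof (cases "d \<in> D")
    case True
    then have "\<gamma> (\<beta> (i, p i d)) = \<gamma> (\<beta> (i, p' i d))"
      using assms(3,4) glue_\<beta>[of i d p] glue_\<beta>[of i d p'] by simp
    then show ?thesis using True assms rotations_step(1) by (metis \<gamma>\<beta> snd_conv)
  next
    case False
    have "p i permutes D" "p' i permutes D" using assms by (simp_all add: rotations_def)
    then show ?thesis using False by (metis permutes_not_in)
  qed
qed

lemma glue_cong: "(\<And>i. i \<in> I \<Longrightarrow> p i = p' i) \<Longrightarrow> glue p = glue p'"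
  by (auto simp: fun_eq_iff glue_rotations_def B \<gamma>\<beta>)

end

definition SRS :: "('w, 'f) pre_digraph \<Rightarrow> (('f \<times> bool \<Rightarrow> 'f \<times> bool) \<times> 'f set) set" where
  "SRS G = {(\<rho>, X). signed_rotation_system G \<rho> X}"

section \<open>Slots of a chain and words of letters\<close>

context gluing_graph
begin

abbreviation "dtail \<equiv> tail (bidirect H)"
abbreviation "darts \<equiv> edge_ends H"

text \<open>Slot \<open>i\<close> consists of the edge-ends of copy \<open>i\<close> away from \<open>U2\<close> and of the edge-ends at \<open>U2\<close>
  in the next copy \<open>j\<close>, so that glued vertices do not straddle slots.\<close>

definition place :: "nat \<Rightarrow> nat \<Rightarrow> 'e \<times> bool \<Rightarrow> (nat \<times> 'e) \<times> bool" where
  "place i j d = ((if dtail d \<in> U2 then j else i, fst d), snd d)"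

text \<open>Edge-ends at \<open>U2\<close> belong to the slot of the preceding copy, cyclically:
  those of copy 1 to slot \<open>n\<close>, also when the chain is open.\<close>

definition unplace :: "nat \<Rightarrow> (nat \<times> 'e) \<times> bool \<Rightarrow> nat \<times> 'e \<times> bool" where
  "unplace n x = (let d = (snd (fst x), snd x); j = fst (fst x)
     in (if dtail d \<in> U2 then if j = 1 then n else j - 1 else j, d))"

text \<open>Within a slot, \<open>U1\<close> of one copy meets \<open>U2\<close> of the next as in
  the self-amalgamation of \<open>H\<close>; only the last slot of an open chain keeps them apart,
  as in \<open>H\<close>.\<close>

definition slot_graph :: "bool \<Rightarrow> nat \<Rightarrow> nat \<Rightarrow> ('v, 'e) pre_digraph" where
  "slot_graph c n i = (if i < n \<or> c then self_amalgamation H U1 \<phi> else H)"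

text \<open>Rotations are read by slot but twists by copy: an edge of copy \<open>i\<close> has its
  twist in letter \<open>i - 1\<close> even if one of its ends lies in another slot. Letters are
  numbered from 0, slots from 1.\<close>

definition glue_word ::
  "nat \<Rightarrow> (('e \<times> bool \<Rightarrow> 'e \<times> bool) \<times> 'e set) list \<Rightarrow>
   ((nat \<times> 'e) \<times> bool \<Rightarrow> (nat \<times> 'e) \<times> bool) \<times> (nat \<times> 'e) set" where
  "glue_word n w =
     (glue_rotations (({1..n} \<times> arcs H) \<times> UNIV) (unplace n) (\<lambda>(i, d). place i (succ_copy n i) d)
        (\<lambda>i. fst (w ! (i - 1))),
      {(i, e). i \<in> {1..n} \<and> e \<in> snd (w ! (i - 1))})"

lemma slot_graph_wf: "wf_digraph (slot_graph c n i)"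
  using H.wf_digraph_axioms
  by (auto simp: slot_graph_def wf_digraph_def self_amalgamation_simps image_iff)

lemma edge_ends_slot_graph: "edge_ends (slot_graph c n i) = darts"
  by (simp add: slot_graph_def self_amalgamation_simps)

lemma arcs_slot_graph: "arcs (slot_graph c n i) = arcs H"
  by (simp add: slot_graph_def self_amalgamation_simps)

lemma tl_slot_graph: "tail (bidirect (slot_graph c n i)) d
    = (if (i < n \<or> c) \<and> dtail d \<in> U1 then \<phi> (dtail d) else dtail d)"
  by (cases d) (simp add: slot_graph_def self_amalgamation_simps)

lemma SRS_slot_graph:
  "SRS (slot_graph c n i) = rotations darts (tail (bidirect (slot_graph c n i))) \<times> Pow (arcs H)"
  by (auto simp: SRS_def signed_rotation_system_iff[OF slot_graph_wf] edge_ends_slot_graph arcs_slot_graph)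

lemma succ_copy_props:
  assumes "i \<in> {1..n}"
  shows "succ_copy n i \<in> {1..n}" "(if succ_copy n i = 1 then n else succ_copy n i - 1) = i"
  using assms by (auto simp: succ_copy_def)

lemma partitioned_darts_chain:
  assumes n: "n \<ge> 1" and G: "chain_graph c n G"
  shows "partitioned_darts {1..n} darts (({1..n} \<times> arcs H) \<times> UNIV)
    (\<lambda>(i, d). place i (succ_copy n i) d) (unplace n)
    (\<lambda>i. tail (bidirect (slot_graph c n i))) (tail (bidirect G))"
proof
  show "finite {1..n}" "finite darts" by simp_all
  show un: "unplace n ((\<lambda>(i, d). place i (succ_copy n i) d) (i, d)) = (i, d)"
    if "i \<in> {1..n}" "d \<in> darts" for i d
    using succ_copy_props[OF that(1)] by (auto simp: place_def unplace_def Let_def split: if_splits)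
  have in_B: "place i (succ_copy n i) d \<in> ({1..n} \<times> arcs H) \<times> UNIV" if "i \<in> {1..n}" "d \<in> darts" for i d
    using that succ_copy_props(1)[OF that(1)] by (cases d) (auto simp: place_def)
  show "({1..n} \<times> arcs H) \<times> (UNIV :: bool set) = (\<lambda>(i, d). place i (succ_copy n i) d) ` ({1..n} \<times> darts)"
  \<comment> \<open>\<open>unplace\<close> gives injectivity, and counting gives
    surjectivity.\<close>
  proof (rule card_subset_eq[symmetric])
    show "finite (({1..n} \<times> arcs H) \<times> (UNIV :: bool set))" by simp
    show "(\<lambda>(i, d). place i (succ_copy n i) d) ` ({1..n} \<times> darts) \<subseteq> ({1..n} \<times> arcs H) \<times> UNIV"
    proof (rule image_subsetI)
      fix x assume "x \<in> {1..n} \<times> darts"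
      then obtain i d where "x = (i, d)" "i \<in> {1..n}" "d \<in> darts" by blast
      then show "(case x of (i, d) \<Rightarrow> place i (succ_copy n i) d) \<in> ({1..n} \<times> arcs H) \<times> UNIV"
        using in_B by (simp only: prod.case)
    qed
    have "inj_on (\<lambda>(i, d). place i (succ_copy n i) d) ({1..n} \<times> darts)"
    proof (rule inj_on_inverseI)
      show "unplace n (case x of (i, d) \<Rightarrow> place i (succ_copy n i) d) = x"
        if "x \<in> {1..n} \<times> darts" for x using that un by (cases x) auto
    qed
    then show "card ((\<lambda>(i, d). place i (succ_copy n i) d) ` ({1..n} \<times> darts))
      = card (({1..n} \<times> arcs H) \<times> (UNIV :: bool set))"
      by (simp add: card_image card_cartesian_product)
  qed
  let ?w = "\<lambda>i d. tail (bidirect (slot_graph c n i)) d"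
  \<comment> \<open>The second component is the vertex in the slot graph. Whether it lies in
    \<open>U2\<close> tells if the copy number is that of the slot or its successor, so the slot can
    be recovered.\<close>
  have t: "tail (bidirect G) (place i (succ_copy n i) d)
      = (if ?w i d \<in> U2 then succ_copy n i else i, ?w i d)" if i: "i \<in> {1..n}" and d: "d \<in> darts" for i d
  proof -
    obtain e b where e: "d = (e, b)" "e \<in> arcs H" using d by (cases d) auto
    define j where "j = (if dtail d \<in> U2 then succ_copy n i else i)"
    have j: "j \<in> {1..n}" using i succ_copy_props(1)[OF i] by (simp add: j_def)
    have "tail (bidirect G) (place i (succ_copy n i) d) = vmap c n (j, dtail d)"
    proof -
      have "place i (succ_copy n i) d = ((j, e), b)" by (simp add: e(1) place_def j_def)
      then show ?thesis
        using chain_tail[OF n G j e(2)] chain_head[OF n G j e(2)] by (simp add: e(1))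
    qed
    also have "\<dots> = (if ?w i d \<in> U2 then succ_copy n i else i, ?w i d)"
      using U(4) \<phi>_in by (auto simp: vmap_def tl_slot_graph j_def)
    finally show ?thesis .
  qed
  show "(tail (bidirect G) (case (i, d) of (i, d) \<Rightarrow> place i (succ_copy n i) d)
      = tail (bidirect G) (case (i', d') of (i, d) \<Rightarrow> place i (succ_copy n i) d))
    = (i = i' \<and> ?w i d = ?w i d')"
    if "i \<in> {1..n}" "d \<in> darts" "i' \<in> {1..n}" "d' \<in> darts" for i d i' d'
  proof -
    have inj: "succ_copy n i = succ_copy n i' \<Longrightarrow> i = i'"
      using succ_copy_props(2)[OF that(1)] succ_copy_props(2)[OF that(3)] by metis
    show ?thesis using t[OF that(1,2)] t[OF that(3,4)] inj by (auto split: if_splits)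
  qed
qed

lemma glue_word_bij:
  assumes n: "n \<ge> 1" and G: "chain_graph c n G"
  shows "bij_betw (glue_word n)
    {w. length w = n \<and> (\<forall>i\<in>{1..n}. w ! (i - 1) \<in> SRS (slot_graph c n i))} (SRS G)"
proof -
  let ?W = "{w. length w = n \<and> (\<forall>i\<in>{1..n}. w ! (i - 1) \<in> SRS (slot_graph c n i))}"
  interpret G: fin_digraph G by (rule fin_digraph_chain[OF n G])
  interpret P: partitioned_darts "{1..n}" darts "({1..n} \<times> arcs H) \<times> UNIV"
    "\<lambda>(i, d). place i (succ_copy n i) d" "unplace n"
    "\<lambda>i. tail (bidirect (slot_graph c n i))" "tail (bidirect G)"
    by (rule partitioned_darts_chain[OF n G])
  have SRS: "SRS G = rotations (({1..n} \<times> arcs H) \<times> UNIV) (tail (bidirect G)) \<times> Pow ({1..n} \<times> arcs H)"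
    by (auto simp: SRS_def signed_rotation_system_iff[OF G.wf_digraph_axioms] chain_arcs[OF n G])
  have W: "fst (w ! (i - 1)) \<in> rotations darts (tail (bidirect (slot_graph c n i)))"
    "snd (w ! (i - 1)) \<subseteq> arcs H" if "w \<in> ?W" "i \<in> {1..n}" for w i
  proof -
    have "w ! (i - 1) \<in> SRS (slot_graph c n i)" using that by blast
    then show "fst (w ! (i - 1)) \<in> rotations darts (tail (bidirect (slot_graph c n i)))"
      "snd (w ! (i - 1)) \<subseteq> arcs H" unfolding SRS_slot_graph mem_Times_iff by blast+
  qed
  have gw: "fst (glue_word n w) = P.glue (\<lambda>i. fst (w ! (i - 1)))"
    "snd (glue_word n w) = {(i, e). i \<in> {1..n} \<and> e \<in> snd (w ! (i - 1))}" for w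
    by (simp_all add: glue_word_def)
  have "inj_on (glue_word n) ?W"
  proof (rule inj_onI)
    fix w w' assume ww: "w \<in> ?W" "w' \<in> ?W" "glue_word n w = glue_word n w'"
    show "w = w'"
    proof (rule nth_equalityI)
      show "length w = length w'" using ww by simp
      fix k assume "k < length w"
      then have i: "Suc k \<in> {1..n}" using ww by auto
      have "fst (w ! (Suc k - 1)) = fst (w' ! (Suc k - 1))"
      proof (rule P.glue_inj[where p = "\<lambda>i. fst (w ! (i - 1))" and p' = "\<lambda>i. fst (w' ! (i - 1))"])
        show "P.glue (\<lambda>i. fst (w ! (i - 1))) = P.glue (\<lambda>i. fst (w' ! (i - 1)))"
          using ww(3) unfolding gw(1)[symmetric] by (rule arg_cong)
      qed (use W(1)[OF ww(1) i] W(1)[OF ww(2) i] i in simp_all)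
      moreover have "snd (w ! (Suc k - 1)) = snd (w' ! (Suc k - 1))"
      proof -
        have "(Suc k, e) \<in> snd (glue_word n w) \<longleftrightarrow> (Suc k, e) \<in> snd (glue_word n w')" for e
          using ww(3) by simp
        then show ?thesis using i unfolding gw(2) by auto
      qed
      ultimately show "w ! k = w' ! k" by (simp add: prod_eq_iff)
    qed
  qed
  moreover have "glue_word n ` ?W \<subseteq> SRS G"
  proof (rule image_subsetI)
    fix w assume w: "w \<in> ?W"
    have "fst (glue_word n w) \<in> rotations (({1..n} \<times> arcs H) \<times> UNIV) (tail (bidirect G))"
      unfolding gw by (rule P.glue_in_rotations) (rule W(1)[OF w])
    moreover have "snd (glue_word n w) \<subseteq> {1..n} \<times> arcs H"
      unfolding gw using W(2)[OF w] by blast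
    ultimately show "glue_word n w \<in> SRS G" unfolding SRS mem_Times_iff by simp
  qed
  moreover have "SRS G \<subseteq> glue_word n ` ?W"
  proof
    fix s assume s: "s \<in> SRS G"
    then obtain \<rho> X where \<rho>: "s = (\<rho>, X)" "\<rho> \<in> rotations (({1..n} \<times> arcs H) \<times> UNIV) (tail (bidirect G))"
      "X \<subseteq> {1..n} \<times> arcs H" unfolding SRS by blast
    obtain p where p: "\<And>i. i \<in> {1..n} \<Longrightarrow> p i \<in> rotations darts (tail (bidirect (slot_graph c n i)))"
      "P.glue p = \<rho>" by (rule P.glue_surj[OF \<rho>(2)], rule that)
    define w where "w = map (\<lambda>k. (p (Suc k), {e. (Suc k, e) \<in> X})) [0..<n]"
    have nth: "w ! (i - 1) = (p i, {e. (i, e) \<in> X})" if i: "i \<in> {1..n}" for i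
    proof -
      obtain k where "i = Suc k" "k < n" using i by (cases i) auto
      then show ?thesis by (simp add: w_def)
    qed
    have "w \<in> ?W"
    proof (intro CollectI conjI ballI)
      show "length w = n" by (simp add: w_def)
      fix i assume i: "i \<in> {1..n}"
      show "w ! (i - 1) \<in> SRS (slot_graph c n i)"
        unfolding nth[OF i] SRS_slot_graph using p(1)[OF i] \<rho>(3) by auto
    qed
    moreover have "glue_word n w = s"
    proof (rule prod_eqI)
      have "fst (glue_word n w) = P.glue p"
        unfolding gw by (rule P.glue_cong) (simp only: nth fst_conv)
      then show "fst (glue_word n w) = fst s" using p(2) \<rho>(1) by simp
      show "snd (glue_word n w) = snd s" unfolding gw using \<rho>(1,3) by (auto simp: nth simp del: One_nat_def)
    qed
    ultimately show "s \<in> glue_word n ` ?W" by blast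
  qed
  ultimately show ?thesis by (auto simp: bij_betw_def)
qed

text \<open>The share of letter \<open>l\<close> in the face graph: the discs of the slot between
  copies \<open>i\<close> and \<open>j\<close>, and the bands of copy \<open>i\<close>. With
  \<open>i\<close> and \<open>j\<close> as parameters, a letter is moved into the window by renaming
  copies.\<close>

definition slot_steps ::
  "nat \<Rightarrow> nat \<Rightarrow> ('e \<times> bool \<Rightarrow> 'e \<times> bool) \<times> 'e set \<Rightarrow> (((nat \<times> 'e) \<times> bool) \<times> bool) rel" where
  "slot_steps i j l =
     {((place i j d, True), (place i j (fst l d), False)) | d. d \<in> darts} \<union>
     {((((i, e), b), s), (((i, e), \<not> b), if e \<in> snd l then s else \<not> s)) | e b s. e \<in> arcs H}"

lemma face_steps_glue_word:
  assumes n: "n \<ge> 1" and G: "chain_graph c n G"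
  shows "face_steps G (fst (glue_word n w)) (snd (glue_word n w))
    = (\<Union>i\<in>{1..n}. slot_steps i (succ_copy n i) (w ! (i - 1)))"
proof -
  interpret P: partitioned_darts "{1..n}" darts "({1..n} \<times> arcs H) \<times> UNIV"
    "\<lambda>(i, d). place i (succ_copy n i) d" "unplace n"
    "\<lambda>i. tail (bidirect (slot_graph c n i))" "tail (bidirect G)"
    by (rule partitioned_darts_chain[OF n G])
  let ?\<rho> = "fst (glue_word n w)" and ?X = "snd (glue_word n w)"
  have \<rho>: "?\<rho> (place i (succ_copy n i) d) = place i (succ_copy n i) (fst (w ! (i - 1)) d)"
    if "i \<in> {1..n}" "d \<in> darts" for i d
    using P.glue_\<beta>[OF that] by (simp add: glue_word_def)
  have "edge_ends G = ({1..n} \<times> arcs H) \<times> UNIV" by (simp add: chain_arcs[OF n G])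
  also have "\<dots> = (\<Union>i\<in>{1..n}. place i (succ_copy n i) ` darts)"
    unfolding P.B by force
  finally have ends: "edge_ends G = (\<Union>i\<in>{1..n}. place i (succ_copy n i) ` darts)" .
  have "{((x, True), (?\<rho> x, False)) | x. x \<in> edge_ends G}
    = (\<Union>i\<in>{1..n}. {((place i (succ_copy n i) d, True),
        (place i (succ_copy n i) (fst (w ! (i - 1)) d), False)) | d. d \<in> darts})"
    (is "?L = ?R")
  proof (intro equalityI subsetI)
    fix z assume "z \<in> ?L"
    then obtain i d where id: "i \<in> {1..n}" "d \<in> darts"
      "z = ((place i (succ_copy n i) d, True), (?\<rho> (place i (succ_copy n i) d), False))"
      unfolding ends by blast
    then show "z \<in> ?R" unfolding id(3) \<rho>[OF id(1,2)] by blast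
  next
    fix z assume "z \<in> ?R"
    then obtain i d where *: "i \<in> {1..n}" "d \<in> darts"
      "z = ((place i (succ_copy n i) d, True), (place i (succ_copy n i) (fst (w ! (i - 1)) d), False))"
      by blast
    then have "place i (succ_copy n i) d \<in> edge_ends G" unfolding ends by blast
    then show "z \<in> ?L" unfolding *(3) \<rho>[OF *(1,2), symmetric] by blast
  qed
  moreover have "{(((e, b), s), ((e, \<not> b), if e \<in> ?X then s else \<not> s)) | e b s. e \<in> arcs G}
    = (\<Union>i\<in>{1..n}. {((((i, e), b), s), (((i, e), \<not> b), if e \<in> snd (w ! (i - 1)) then s else \<not> s)) | e b s. e \<in> arcs H})"
    (is "?L = ?R")
  proof -
    have X: "(i, f) \<in> ?X \<longleftrightarrow> f \<in> snd (w ! (i - 1))" if "i \<in> {1..n}" for i f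
      using that by (simp add: glue_word_def)
    show ?thesis
    proof (intro equalityI subsetI)
      fix z assume "z \<in> ?L"
      then obtain i f b s where *: "i \<in> {1..n}" "f \<in> arcs H"
        "z = ((((i, f), b), s), (((i, f), \<not> b), if (i, f) \<in> ?X then s else \<not> s))"
        unfolding chain_arcs[OF n G] by blast
      then show "z \<in> ?R" unfolding *(3) X[OF *(1)] by blast
    next
      fix z assume "z \<in> ?R"
      then obtain i f b s where *: "i \<in> {1..n}" "f \<in> arcs H"
        "z = ((((i, f), b), s), (((i, f), \<not> b), if f \<in> snd (w ! (i - 1)) then s else \<not> s))"
        by blast
      then have "(i, f) \<in> arcs G" unfolding chain_arcs[OF n G] by blast
      then show "z \<in> ?L" unfolding *(3) X[OF *(1), symmetric] by blast
    qed
  qed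
  ultimately show ?thesis unfolding face_steps_def slot_steps_def by (simp only: UN_Un_distrib)
qed

end

section \<open>The automaton\<close>

definition relabel :: "(nat \<Rightarrow> nat) \<Rightarrow> ((nat \<times> 'e) \<times> bool) \<times> bool \<Rightarrow> ((nat \<times> 'e) \<times> bool) \<times> bool" where
  "relabel f = (\<lambda>(((i, e), b), s). (((f i, e), b), s))"

lemma relabel_simp [simp]: "relabel f (((i, e), b), s) = (((f i, e), b), s)"
  by (simp add: relabel_def)

context gluing_graph
begin

abbreviation "letters \<equiv> SRS (self_amalgamation H U1 \<phi>)"

lemma letters_conv: "letters = SRS (slot_graph True n i)"
  by (simp add: slot_graph_def)

lemma finite_SRS_slot_graph: "finite (SRS (slot_graph c n i))"
proof (rule finite_subset)
  show "SRS (slot_graph c n i) \<subseteq> {\<rho>. \<rho> permutes darts} \<times> Pow (arcs H)"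
    unfolding SRS_slot_graph by (auto simp: rotations_def)
  have "finite darts" by simp
  then show "finite ({\<rho>. \<rho> permutes darts} \<times> Pow (arcs H))"
    by (intro finite_cartesian_product finite_permutations) simp_all
qed

definition flags :: "nat set \<Rightarrow> (((nat \<times> 'e) \<times> bool) \<times> bool) set" where
  "flags P = ((P \<times> arcs H) \<times> UNIV) \<times> UNIV"

lemma finite_flags: "finite P \<Longrightarrow> finite (flags P)"
  by (simp add: flags_def)

lemma card_flags: "card (flags P) = 4 * (card P * card (arcs H))"
  by (simp add: flags_def card_cartesian_product)

lemma flags_mono: "P \<subseteq> Q \<Longrightarrow> flags P \<subseteq> flags Q"
  by (auto simp: flags_def)

lemma relabel_place: "relabel f (place i j d, s) = (place (f i) (f j) d, s)"
  by (simp add: place_def)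

lemma relabel_slot_steps:
  "map_prod (relabel f) (relabel f) ` slot_steps i j l = slot_steps (f i) (f j) l"
proof -
  have 1: "map_prod (relabel f) (relabel f) ` {((place i j d, True), (place i j (fst l d), False)) | d. d \<in> darts}
    = {((place (f i) (f j) d, True), (place (f i) (f j) (fst l d), False)) | d. d \<in> darts}"
    (is "?A = ?B")
    unfolding setcompr_eq_image image_image Collect_mem_eq map_prod_simp relabel_place ..
  have 2: "map_prod (relabel f) (relabel f) `
      {((((i, e), b), s), (((i, e), \<not> b), if e \<in> snd l then s else \<not> s)) | e b s. e \<in> arcs H}
    = {((((f i, e), b), s), (((f i, e), \<not> b), if e \<in> snd l then s else \<not> s)) | e b s. e \<in> arcs H}"
    (is "?A = ?B")
  proof (intro equalityI subsetI)
    fix z assume "z \<in> ?A"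
    then obtain x where x: "z = map_prod (relabel f) (relabel f) x"
      "x \<in> {((((i, e), b), s), (((i, e), \<not> b), if e \<in> snd l then s else \<not> s)) | e b s. e \<in> arcs H}"
      by (rule imageE)
    then obtain e b s where e: "e \<in> arcs H"
      "x = ((((i, e), b), s), (((i, e), \<not> b), if e \<in> snd l then s else \<not> s))" by blast
    show "z \<in> ?B" unfolding x(1) e(2) map_prod_simp relabel_simp using e(1) by blast
  next
    fix z assume "z \<in> ?B"
    then obtain e b s where e: "e \<in> arcs H" "z = map_prod (relabel f) (relabel f)
        ((((i, e), b), s), (((i, e), \<not> b), if e \<in> snd l then s else \<not> s))"
      unfolding map_prod_simp relabel_simp by blast
    show "z \<in> ?A" unfolding e(2) by (rule imageI) (use e(1) in blast)
  qed
  show ?thesis unfolding slot_steps_def image_Un 1 2 ..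
qed

lemma place_in_flags: "d \<in> darts \<Longrightarrow> (place i j d, s) \<in> flags {i, j}"
  by (cases d) (simp add: place_def flags_def)

lemma slot_steps_subset:
  assumes "l \<in> SRS (slot_graph c n k)"
  shows "slot_steps i j l \<subseteq> flags {i, j} \<times> flags {i, j}"
proof
  fix z assume "z \<in> slot_steps i j l"
  then consider d where "d \<in> darts" "z = ((place i j d, True), (place i j (fst l d), False))"
    | e b s s' where "e \<in> arcs H" "z = ((((i, e), b), s), (((i, e), \<not> b), s'))"
    unfolding slot_steps_def by blast
  then show "z \<in> flags {i, j} \<times> flags {i, j}"
  proof cases
    case 1
    have "fst l \<in> rotations darts (tail (bidirect (slot_graph c n k)))"
      using assms unfolding SRS_slot_graph mem_Times_iff by (rule conjunct1)
    then have "fst l d \<in> darts" using 1(1) by (rule rotations_step(1))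
    then show ?thesis unfolding 1(2) using place_in_flags[OF 1(1)] place_in_flags by simp
  next
    case 2
    then show ?thesis by (simp add: flags_def)
  qed
qed

text \<open>The steps of a word without its closing letter. Letter \<open>k\<close> fills slot
  \<open>Suc k\<close> and reaches into copy \<open>Suc (Suc k)\<close>, so a prefix of length
  \<open>m\<close> touches only the copies 1 to \<open>Suc m\<close>.\<close>

definition prefix_steps :: "(('e \<times> bool \<Rightarrow> 'e \<times> bool) \<times> 'e set) list \<Rightarrow> (((nat \<times> 'e) \<times> bool) \<times> bool) rel" where
  "prefix_steps ws = (\<Union>k<length ws. slot_steps (Suc k) (Suc (Suc k)) (ws ! k))"

lemma prefix_steps_snoc:
  "prefix_steps (ws @ [l]) = prefix_steps ws \<union> slot_steps (Suc (length ws)) (Suc (Suc (length ws))) l"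
  by (simp add: prefix_steps_def lessThan_Suc nth_append Un_commute)

lemma prefix_steps_subset:
  assumes "set ws \<subseteq> letters"
  shows "prefix_steps ws \<subseteq> flags {1..Suc (length ws)} \<times> flags {1..Suc (length ws)}"
proof -
  have "slot_steps (Suc k) (Suc (Suc k)) (ws ! k)
      \<subseteq> flags {1..Suc (length ws)} \<times> flags {1..Suc (length ws)}" if "k < length ws" for k
  proof -
    have "ws ! k \<in> SRS (slot_graph True 1 1)"
      using assms that letters_conv by (metis nth_mem subsetD)
    from slot_steps_subset[OF this] flags_mono[of "{Suc k, Suc (Suc k)}" "{1..Suc (length ws)}"]
    show ?thesis using that by fastforce
  qed
  then show ?thesis unfolding prefix_steps_def by blast
qed

text \<open>A window on the first copy (position 0), the current copy (1) and the next copy (2).\<close>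

definition pos :: "nat \<Rightarrow> nat \<Rightarrow> nat" where
  "pos k p = (if p = 0 then 1 else p + k)"

text \<open>After \<open>length ws\<close> letters the current copy is number
  \<open>Suc (length ws)\<close>, seen at position 1. For the empty word, positions 0 and 1 both
  denote copy 1, and the state identifies their flags.\<close>

definition state :: "(('e \<times> bool \<Rightarrow> 'e \<times> bool) \<times> 'e set) list \<Rightarrow> (((nat \<times> 'e) \<times> bool) \<times> bool) rel" where
  "state ws = {(y, z) \<in> flags {0, 1} \<times> flags {0, 1}.
     (relabel (pos (length ws)) y, relabel (pos (length ws)) z) \<in> eq_closure (prefix_steps ws)}"

text \<open>Once the letter is added, position 1 is forgotten and position 2 becomes the new
  position 1.\<close>

definition state_step where
  "state_step s l = {(y, z) \<in> flags {0, 1} \<times> flags {0, 1}.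
     (relabel (\<lambda>p. if p = 0 then 0 else 2) y, relabel (\<lambda>p. if p = 0 then 0 else 2) z)
       \<in> eq_closure (s \<union> slot_steps 1 2 l)}"

lemma state_subset: "state ws \<subseteq> flags {0, 1} \<times> flags {0, 1}"
  by (auto simp: state_def)

lemma state_window:
  assumes "y \<in> flags {0, 1}" "z \<in> flags {0, 1}"
  shows "(relabel (pos (length ws)) y, relabel (pos (length ws)) z) \<in> eq_closure (prefix_steps ws)
    \<longleftrightarrow> (y, z) \<in> eq_closure (state ws)"
  unfolding state_def by (rule restrict_eq_closure[OF assms])

text \<open>Neither the prefix nor the state touches the flags of the next copy, so on them both
  relations are trivial.\<close>

lemma state_window_next:
  assumes ws: "set ws \<subseteq> letters" and y: "y \<in> flags {0, 1, 2}" and z: "z \<in> flags {0, 1, 2}"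
  shows "(relabel (pos (length ws)) y, relabel (pos (length ws)) z) \<in> eq_closure (prefix_steps ws)
    \<longleftrightarrow> (y, z) \<in> eq_closure (state ws)"
proof -
  let ?r = "relabel (pos (length ws))"
  have fresh: "((?r y, ?r z) \<in> eq_closure (prefix_steps ws) \<longleftrightarrow> z = y)
      \<and> ((y, z) \<in> eq_closure (state ws) \<longleftrightarrow> z = y)"
    if yz: "y \<in> flags {2}" "z \<in> flags {0, 1, 2}" for y z
  proof -
    obtain e b s where y: "y = (((2, e), b), s)" using yz(1) by (auto simp: flags_def)
    have "?r y \<notin> flags {1..Suc (length ws)}" by (simp add: y pos_def flags_def)
    then have "(?r y, ?r z) \<in> eq_closure (prefix_steps ws) \<longleftrightarrow> ?r z = ?r y"
      using eq_closure_outside[OF prefix_steps_subset[OF ws], of "?r y" "?r z"]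
      by (metis rtrancl.rtrancl_refl)
    also have "?r z = ?r y \<longleftrightarrow> z = y"
      using yz(2) by (auto simp: y pos_def flags_def split: if_splits)
    moreover have "y \<notin> flags {0, 1}" by (simp add: y flags_def)
    then have "(y, z) \<in> eq_closure (state ws) \<longleftrightarrow> z = y"
      using eq_closure_outside[OF state_subset, of y z ws] by (metis rtrancl.rtrancl_refl)
    ultimately show ?thesis by blast
  qed
  have split: "flags {0, 1, 2} = flags {0, 1} \<union> flags {2}" by (auto simp: flags_def)
  consider "y \<in> flags {0, 1}" "z \<in> flags {0, 1}" | "y \<in> flags {2}" | "z \<in> flags {2}"
    using y z unfolding split by blast
  then show ?thesis
  proof cases
    case 1
    then show ?thesis by (rule state_window)
  next
    case 2
    then show ?thesis using fresh[OF 2 z] by blast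
  next
    case 3
    then show ?thesis using fresh[OF 3 y] eq_closure_sym by metis
  qed
qed

lemma relabel_pos_flags:
  assumes "P \<subseteq> {0..m}"
  shows "relabel (pos k) ` flags P \<subseteq> flags {1..max 1 (m + k)}"
proof (rule image_subsetI)
  fix x assume "x \<in> flags P"
  then obtain p e b s where x: "x = (((p, e), b), s)" "p \<in> P" "e \<in> arcs H"
    by (auto simp: flags_def)
  moreover have "pos k p \<in> {1..max 1 (m + k)}" using assms x(2) by (auto simp: pos_def)
  ultimately show "relabel (pos k) x \<in> flags {1..max 1 (m + k)}" by (simp add: flags_def)
qed

text \<open>Position 1 of the longer word is position 2 of the shorter one. So the new window lies
  inside the old one enlarged by the next copy, where \<open>window_eq_closure\<close> adds the
  letter.\<close>

lemma state_snoc: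
  assumes ws: "set ws \<subseteq> letters" and l: "l \<in> letters"
  shows "state (ws @ [l]) = state_step (state ws) l"
proof -
  let ?k = "length ws" and ?h = "\<lambda>p::nat. if p = 0 then 0 else (2::nat)"
  have steps: "slot_steps 1 2 l \<subseteq> flags {0, 1, 2} \<times> flags {0, 1, 2}"
    using slot_steps_subset[of l True 1 1 1 2] l flags_mono[of "{1, 2}" "{0, 1, 2}"]
    unfolding letters_conv[of 1 1] by blast
  have s: "state ws \<subseteq> flags {0, 1, 2} \<times> flags {0, 1, 2}"
    using state_subset[of ws] flags_mono[of "{0, 1}" "{0, 1, 2}"] by blast
  have image: "map_prod (relabel (pos ?k)) (relabel (pos ?k)) ` slot_steps 1 2 l
      = slot_steps (Suc ?k) (Suc (Suc ?k)) l"
    by (simp add: relabel_slot_steps pos_def)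
  have "(relabel (pos (Suc ?k)) y, relabel (pos (Suc ?k)) z) \<in> eq_closure (prefix_steps (ws @ [l]))
      \<longleftrightarrow> (relabel ?h y, relabel ?h z) \<in> eq_closure (state ws \<union> slot_steps 1 2 l)"
    if yz: "y \<in> flags {0, 1}" "z \<in> flags {0, 1}" for y z
  proof -
    have h: "relabel ?h y \<in> flags {0, 1, 2}" "relabel (pos (Suc ?k)) y = relabel (pos ?k) (relabel ?h y)"
      if "y \<in> flags {0, 1}" for y
      using that by (auto simp: flags_def pos_def)
    show ?thesis
      unfolding h(2)[OF yz(1)] h(2)[OF yz(2)] prefix_steps_snoc image[symmetric]
      using state_window_next[OF ws] s steps h(1)[OF yz(1)] h(1)[OF yz(2)]
      by (rule window_eq_closure)
  qed
  then have "(y, z) \<in> state (ws @ [l]) \<longleftrightarrow> (y, z) \<in> state_step (state ws) l" for y z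
    unfolding state_def[of "ws @ [l]"] state_step_def mem_Collect_eq prod.case mem_Sigma_iff
      length_append_singleton by blast
  then show ?thesis by (intro set_eqI) (metis prod.exhaust)
qed

text \<open>The gain is computed in the window, hence from state and letter alone; including the
  next copy costs no rank.\<close>

lemma rank_prefix_snoc:
  assumes ws: "set ws \<subseteq> letters" and l: "l \<in> letters"
  shows "rank (flags {1..Suc (Suc (length ws))}) (prefix_steps (ws @ [l]))
    = rank_gain (flags {0, 1, 2}) (state ws) (slot_steps 1 2 l)
      + rank (flags {1..Suc (length ws)}) (prefix_steps ws)"
proof -
  let ?k = "length ws" and ?Y = "flags {0, 1, 2}"
  have steps: "slot_steps 1 2 l \<subseteq> ?Y \<times> ?Y"
    using slot_steps_subset[of l True 1 1 1 2] l flags_mono[of "{1, 2}" "{0, 1, 2}"]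
    unfolding letters_conv[of 1 1] by blast
  have s: "state ws \<subseteq> ?Y \<times> ?Y"
    using state_subset[of ws] flags_mono[of "{0, 1}" "{0, 1, 2}"] by blast
  have image: "map_prod (relabel (pos ?k)) (relabel (pos ?k)) ` slot_steps 1 2 l
      = slot_steps (Suc ?k) (Suc (Suc ?k)) l"
    by (simp add: relabel_slot_steps pos_def)
  have "rank (flags {1..Suc (Suc ?k)}) (prefix_steps (ws @ [l]))
    = rank_gain ?Y (state ws) (slot_steps 1 2 l) + rank (flags {1..Suc (Suc ?k)}) (prefix_steps ws)"
    unfolding prefix_steps_snoc image[symmetric]
  proof (rule rank_add_edges[OF state_window_next[OF ws] s steps])
    show "finite (flags {1..Suc (Suc ?k)})" "finite ?Y" by (simp_all add: finite_flags)
    show "relabel (pos ?k) ` ?Y \<subseteq> flags {1..Suc (Suc ?k)}"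
      using relabel_pos_flags[of "{0, 1, 2}" 2 ?k] by simp
  qed
  also have "rank (flags {1..Suc (Suc ?k)}) (prefix_steps ws) = rank (flags {1..Suc ?k}) (prefix_steps ws)"
  proof -
    have "flags {1..Suc (Suc ?k)} = flags {1..Suc ?k} \<union> flags {Suc (Suc ?k)}"
      by (auto simp: flags_def)
    moreover have "flags {1..Suc ?k} \<inter> flags {Suc (Suc ?k)} = {}" by (auto simp: flags_def)
    ultimately show ?thesis
      using rank_isolated[OF _ _ _ prefix_steps_subset[OF ws]] by (simp add: finite_flags)
  qed
  finally show ?thesis .
qed

text \<open>The closing slot joins the current copy (position 1) to copy 1 (position 0), and both
  are already in the window. The letter may come from \<open>H\<close> or from its
  self-amalgamation.\<close>

lemma rank_closing:
  assumes ws: "set ws \<subseteq> letters" and l: "l \<in> SRS (slot_graph c n i)"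
  shows "rank (flags {1..Suc (length ws)}) (prefix_steps ws \<union> slot_steps (Suc (length ws)) 1 l)
    = rank_gain (flags {0, 1}) (state ws) (slot_steps 1 0 l)
      + rank (flags {1..Suc (length ws)}) (prefix_steps ws)"
proof -
  let ?k = "length ws" and ?Y = "flags {0, 1}"
  have steps: "slot_steps 1 0 l \<subseteq> ?Y \<times> ?Y"
    using slot_steps_subset[OF l, of 1 0] by (simp add: insert_commute)
  have image: "map_prod (relabel (pos ?k)) (relabel (pos ?k)) ` slot_steps 1 0 l
      = slot_steps (Suc ?k) 1 l"
    by (simp add: relabel_slot_steps pos_def)
  show ?thesis
    unfolding image[symmetric]
  proof (rule rank_add_edges[OF state_window state_subset steps])
    show "finite (flags {1..Suc ?k})" "finite ?Y" by (simp_all add: finite_flags)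
    show "relabel (pos ?k) ` ?Y \<subseteq> flags {1..Suc ?k}"
      using relabel_pos_flags[of "{0, 1}" 1 ?k] by simp
  qed
qed

text \<open>The last letter is split off because its slot leads back to copy 1 and has its own
  alphabet in an open chain. \<open>slot_graph c 1 1\<close> serves as last slot for every length,
  since \<open>slot_graph c n n\<close> depends on \<open>c\<close> alone.\<close>

lemma sum_SRS_chain:
  fixes f :: "nat \<Rightarrow> 'a :: comm_monoid_add"
  assumes G: "chain_graph c (Suc k) G"
  shows "(\<Sum>(\<rho>, X)\<in>SRS G. f (4 * card (arcs G) - card (faces G \<rho> X)))
    = (\<Sum>ws\<in>{ws. set ws \<subseteq> letters \<and> length ws = k}. \<Sum>l\<in>SRS (slot_graph c 1 1).
        f (rank (flags {1..Suc k}) (prefix_steps ws \<union> slot_steps (Suc k) 1 l)))"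
proof -
  let ?n = "Suc k"
  let ?L = "SRS (slot_graph c 1 1)" and ?W = "{ws. set ws \<subseteq> letters \<and> length ws = k}"
  let ?V = "{w. length w = ?n \<and> (\<forall>i\<in>{1..?n}. w ! (i - 1) \<in> SRS (slot_graph c ?n i))}"
  have arcs: "arcs G = {1..?n} \<times> arcs H" using G by (simp add: chain_graph_def)
  have V: "ws @ [l] \<in> ?V \<longleftrightarrow> set ws \<subseteq> letters \<and> l \<in> ?L" if len: "length ws = k" for ws l
  proof -
    have "ws @ [l] \<in> ?V \<longleftrightarrow> (\<forall>j<?n. (ws @ [l]) ! j \<in> SRS (slot_graph c ?n (Suc j)))"
    proof -
      have "(\<forall>i\<in>{1..?n}. P (i - 1) i) \<longleftrightarrow> (\<forall>j<?n. P j (Suc j))" for P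
        unfolding image_Suc_lessThan[symmetric] by auto
      from this[of "\<lambda>j i. (ws @ [l]) ! j \<in> SRS (slot_graph c ?n i)"] show ?thesis
        using that by simp
    qed
    also have "\<dots> \<longleftrightarrow> (\<forall>j<k. ws ! j \<in> letters) \<and> l \<in> ?L"
    proof -
      have "(ws @ [l]) ! j \<in> SRS (slot_graph c ?n (Suc j)) \<longleftrightarrow> ws ! j \<in> letters" if "j < k" for j
        using that len by (simp add: nth_append slot_graph_def)
      moreover have "(ws @ [l]) ! k \<in> SRS (slot_graph c ?n ?n) \<longleftrightarrow> l \<in> ?L"
        using len by (simp add: nth_append slot_graph_def)
      ultimately show ?thesis unfolding less_Suc_eq by blast
    qed
    also have "(\<forall>j<k. ws ! j \<in> letters) \<longleftrightarrow> set ws \<subseteq> letters"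
      using that by (auto simp: set_conv_nth)
    finally show ?thesis .
  qed
  have faces: "4 * card (arcs G) - card (faces G (fst (glue_word ?n (ws @ [l]))) (snd (glue_word ?n (ws @ [l]))))
      = rank (flags {1..?n}) (prefix_steps ws \<union> slot_steps ?n 1 l)" if len: "length ws = k" for ws l
  proof -
    have "face_steps G (fst (glue_word ?n (ws @ [l]))) (snd (glue_word ?n (ws @ [l])))
        = (\<Union>i\<in>{1..?n}. slot_steps i (succ_copy ?n i) ((ws @ [l]) ! (i - 1)))"
      by (rule face_steps_glue_word[OF _ G]) simp
    also have "{1..?n} = Suc ` {..<k} \<union> {?n}"
      by (simp add: image_Suc_lessThan atLeastAtMostSuc_conv)
    also have "(\<Union>i\<in>Suc ` {..<k} \<union> {?n}. slot_steps i (succ_copy ?n i) ((ws @ [l]) ! (i - 1)))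
        = prefix_steps ws \<union> slot_steps ?n 1 l"
      using len by (simp add: prefix_steps_def succ_copy_def nth_append Un_commute)
    finally have "faces G (fst (glue_word ?n (ws @ [l]))) (snd (glue_word ?n (ws @ [l])))
        = flags {1..?n} // eq_closure (prefix_steps ws \<union> slot_steps ?n 1 l)"
      unfolding faces_def by (simp add: arcs flags_def)
    moreover have "4 * card (arcs G) = card (flags {1..?n})"
      by (simp add: arcs card_flags card_cartesian_product)
    ultimately show ?thesis by (simp add: rank_def)
  qed
  have "(\<Sum>(\<rho>, X)\<in>SRS G. f (4 * card (arcs G) - card (faces G \<rho> X)))
    = (\<Sum>w\<in>?V. f (4 * card (arcs G) - card (faces G (fst (glue_word ?n w)) (snd (glue_word ?n w)))))"
    using sum.reindex_bij_betw[OF glue_word_bij[OF _ G],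
        of "\<lambda>s. f (4 * card (arcs G) - card (faces G (fst s) (snd s)))"]
    by (simp add: case_prod_unfold)
  also have "\<dots> = (\<Sum>(ws, l)\<in>?W \<times> ?L. f (rank (flags {1..?n}) (prefix_steps ws \<union> slot_steps ?n 1 l)))"
  proof (rule sum.reindex_bij_witness[of _ "\<lambda>(ws, l). ws @ [l]" "\<lambda>w. (butlast w, last w)"])
    fix w assume w: "w \<in> ?V"
    then obtain ws l where wl: "w = ws @ [l]" "length ws = k"
      by (auto simp: length_Suc_conv_rev)
    show "(case (butlast w, last w) of (ws, l) \<Rightarrow> ws @ [l]) = w" by (simp add: wl)
    show "(butlast w, last w) \<in> ?W \<times> ?L" using w V[OF wl(2)] wl by simp
    show "(case (butlast w, last w) of (ws, l) \<Rightarrow> f (rank (flags {1..?n}) (prefix_steps ws \<union> slot_steps ?n 1 l)))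
      = f (4 * card (arcs G) - card (faces G (fst (glue_word ?n w)) (snd (glue_word ?n w))))"
      using faces[OF wl(2)] by (simp add: wl)
  next
    fix p assume p: "p \<in> ?W \<times> ?L"
    then obtain ws l where wl: "p = (ws, l)" "set ws \<subseteq> letters" "length ws = k" "l \<in> ?L" by blast
    show "(butlast (case p of (ws, l) \<Rightarrow> ws @ [l]), last (case p of (ws, l) \<Rightarrow> ws @ [l])) = p"
      by (simp add: wl(1))
    show "(case p of (ws, l) \<Rightarrow> ws @ [l]) \<in> ?V" unfolding wl(1) prod.case using V[OF wl(3)] wl by blast
  qed
  also have "\<dots> = (\<Sum>ws\<in>?W. \<Sum>l\<in>?L. f (rank (flags {1..?n}) (prefix_steps ws \<union> slot_steps ?n 1 l)))"
    by (rule sum.cartesian_product[symmetric])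
  finally show ?thesis .
qed

text \<open>The closing letter is no transition of the automaton but a sum in its output function,
  so words of length \<open>k\<close> describe the graph with \<open>Suc k\<close> copies.\<close>

lemma chain_family_rational:
  assumes chain: "\<And>k. chain_graph c (Suc k) (\<G> (Suc k))"
  shows "rational_fraction (genus_gen_fun \<G>)"
proof -
  let ?L = "SRS (slot_graph c 1 1)"
  define tot where "tot ws = (\<Sum>l\<in>?L. monom (1::int)
    (rank (flags {1..Suc (length ws)}) (prefix_steps ws \<union> slot_steps (Suc (length ws)) 1 l)))" for ws
  define wt where "wt ws = monom (1::int) (rank (flags {1..Suc (length ws)}) (prefix_steps ws))" for ws
  define S where "S k = (\<Sum>ws\<in>{ws. set ws \<subseteq> letters \<and> length ws = k}. tot ws)" for k
  obtain d q where q: "\<exists>i\<le>d. q i \<noteq> 0"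
    and rec': "\<And>k. (\<Sum>i\<le>d. q i * (\<Sum>ws\<in>{ws. set ws \<subseteq> letters \<and> length ws = k + i}. tot ws)) = 0"
  proof (rule automaton_linear_recurrence[of letters "Pow (flags {0, 1} \<times> flags {0, 1})" state
        state_step wt "\<lambda>s l. monom 1 (rank_gain (flags {0, 1, 2}) s (slot_steps 1 2 l))" tot
        "\<lambda>s. \<Sum>l\<in>?L. monom 1 (rank_gain (flags {0, 1}) s (slot_steps 1 0 l))"])
    show "finite letters" using finite_SRS_slot_graph[of True 1 1] by (simp flip: letters_conv)
    show "finite (Pow (flags {0, 1} \<times> flags {0, 1}))" by (simp add: finite_flags)
    show "state ws \<in> Pow (flags {0, 1} \<times> flags {0, 1})" for ws using state_subset by blast
  next
    fix ws l assume wl: "set ws \<subseteq> letters" "l \<in> letters"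
    show "state (ws @ [l]) = state_step (state ws) l" by (rule state_snoc[OF wl])
    show "wt (ws @ [l]) = monom 1 (rank_gain (flags {0, 1, 2}) (state ws) (slot_steps 1 2 l)) * wt ws"
      using rank_prefix_snoc[OF wl] by (simp add: wt_def mult_monom)
  next
    fix ws assume ws: "set ws \<subseteq> letters"
    show "tot ws = (\<Sum>l\<in>?L. monom 1 (rank_gain (flags {0, 1}) (state ws) (slot_steps 1 0 l))) * wt ws"
      unfolding tot_def wt_def sum_distrib_right
    proof (rule sum.cong[OF refl])
      fix l assume l: "l \<in> ?L"
      show "monom 1 (rank (flags {1..Suc (length ws)}) (prefix_steps ws \<union> slot_steps (Suc (length ws)) 1 l))
        = monom 1 (rank_gain (flags {0, 1}) (state ws) (slot_steps 1 0 l))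
          * monom (1::int) (rank (flags {1..Suc (length ws)}) (prefix_steps ws))"
        unfolding rank_closing[OF ws l] by (simp add: mult_monom)
    qed
  qed (rule that)
  note rec = rec'[folded S_def]
  \<comment> \<open>Each further copy adds \<open>v\<close> vertices; an open chain keeps the
    \<open>v0\<close> vertices of \<open>U1\<close> in its last copy.\<close>
  define v where "v = card (verts H) - card U1"
  define v0 where "v0 = (if c then 0 else card U1)"
  let ?E = "card (arcs H)"
  have v: "v \<ge> 1" using card_U1_less by (simp add: v_def)
  have E: "?E \<ge> 1" using arcs_H_nonempty by (simp add: Suc_le_eq card_gt_0_iff)
  \<comment> \<open>\<open>\<mu>\<close> is the factor of \<open>euler_genus_poly_sum\<close> for a
    single copy, and each further copy multiplies that factor by \<open>\<nu>\<close>.\<close>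
  define \<mu> :: "int poly" where "\<mu> = 2 ^ (v + v0 - 1) * monom 1 (v + v0 + 3 * ?E - 2)"
  define \<nu> :: "int poly" where "\<nu> = 2 ^ v * monom 1 (v + 3 * ?E)"
  have nz: "\<mu> \<noteq> 0" "\<nu> \<noteq> 0" by (simp_all add: \<mu>_def \<nu>_def monom_eq_0_iff)
  have S: "S k = \<mu> * \<nu> ^ k * euler_genus_poly (\<G> (Suc k))" for k
  proof -
    let ?G = "\<G> (Suc k)"
    have n: "Suc k \<ge> 1" by simp
    have arcs: "card (arcs ?G) = Suc k * ?E"
      by (simp only: chain_arcs[OF n chain] card_cartesian_product card_atLeastAtMost) simp
    have verts: "card (verts ?G) = Suc k * v + v0"
      using card_chain_verts[OF n chain[of k]] by (simp add: v_def v0_def)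
    have ne: "arcs ?G \<noteq> {}" using arcs_H_nonempty by (simp add: chain_arcs[OF n chain])
    have "S k = (\<Sum>ws\<in>{ws. set ws \<subseteq> letters \<and> length ws = k}. \<Sum>l\<in>?L.
        monom 1 (rank (flags {1..Suc k}) (prefix_steps ws \<union> slot_steps (Suc k) 1 l)))"
      unfolding S_def by (rule sum.cong[OF refl]) (simp add: tot_def)
    also have "\<dots> = (\<Sum>(\<rho>, X)\<in>SRS ?G. monom 1 (4 * card (arcs ?G) - card (faces ?G \<rho> X)))"
      by (rule sum_SRS_chain[OF chain, symmetric])
    also have "\<dots> = 2 ^ (card (verts ?G) - 1) * monom 1 (card (verts ?G) + 3 * card (arcs ?G) - 2)
        * euler_genus_poly ?G"
      unfolding SRS_def
      by (rule euler_genus_poly_sum[OF fin_digraph_chain[OF n chain] connected_chain[OF n chain] ne])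
    also have "card (verts ?G) - 1 = v * k + (v + v0 - 1)"
      using v by (simp add: verts algebra_simps)
    also have "card (verts ?G) + 3 * card (arcs ?G) - 2 = (v + 3 * ?E) * k + (v + v0 + 3 * ?E - 2)"
      using v E by (simp add: verts arcs algebra_simps)
    also have "2 ^ (v * k + (v + v0 - 1)) * monom 1 ((v + 3 * ?E) * k + (v + v0 + 3 * ?E - 2)) = \<mu> * \<nu> ^ k"
    proof -
      have "monom (1::int) ((v + 3 * ?E) * k + (v + v0 + 3 * ?E - 2))
        = monom 1 (v + 3 * ?E) ^ k * monom 1 (v + v0 + 3 * ?E - 2)"
        by (simp add: monom_power mult_monom)
      moreover have "(2 :: int poly) ^ (v * k + (v + v0 - 1)) = (2 ^ v) ^ k * 2 ^ (v + v0 - 1)"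
        by (simp only: power_add power_mult)
      ultimately show ?thesis
        unfolding \<mu>_def \<nu>_def power_mult_distrib by (simp only: mult_ac)
    qed
    finally show ?thesis .
  qed
  define F where "F = genus_gen_fun \<G>"
  have F: "fps_nth F (Suc k) = euler_genus_poly (\<G> (Suc k))" for k
    by (simp add: F_def genus_gen_fun_def)
  \<comment> \<open>Scaling \<open>q i\<close> by \<open>\<nu> ^ i\<close> turns the recurrence for
    \<open>S\<close> into one for the polynomials, up to the non-zero factor
    \<open>\<mu> * \<nu> ^ k\<close>, which is cancelled.\<close>
  have "(\<Sum>i\<le>d. (q i * \<nu> ^ i) * fps_nth F (n + i)) = 0" if n1: "n \<ge> 1" for n
  proof -
    obtain k where n: "n = Suc k" using n1 by (cases n) auto
    have "\<mu> * \<nu> ^ k * (\<Sum>i\<le>d. (q i * \<nu> ^ i) * fps_nth F (n + i)) = (\<Sum>i\<le>d. q i * S (k + i))"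
      by (simp add: sum_distrib_left S F n power_add mult_ac)
    then show ?thesis using rec[of k] nz by simp
  qed
  moreover have "\<exists>i\<le>d. q i * \<nu> ^ i \<noteq> 0" using q nz by simp
  ultimately show ?thesis unfolding F_def[symmetric] by (intro rational_fraction_if_recurrence)
qed

end

theorem theorem6p7:
  fixes H :: "('v, 'e) pre_digraph" and U1 U2 :: "'v set" and \<phi> :: "'v \<Rightarrow> 'v"
  assumes "fin_digraph H" and "connected H" and "gluing H U1 U2 \<phi>"
  shows "rational_fraction (genus_gen_fun (linear_family H U1 \<phi>))
       \<and> rational_fraction (genus_gen_fun (circular_family H U1 \<phi>))"
proof -
  interpret gluing_graph H U1 U2 \<phi> by (intro gluing_graph.intro assms)
  show ?thesis
    using chain_family_rational chain_graph_linear chain_graph_circular by blast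
qed

end
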